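(* Let $R>0$ be arbitrary, and let $\varepsilon>0$ be fixed and sufficiently small, with $u_\varepsilon$, $\Omega_-$ and the map $\xi=\lambda(z)$ (depending on $m$) as in the context. For $|\xi|<R$ and $z=z(\xi)\in\Omega_-\cap u_\varepsilon\cap\mathbb{C}^+$, $$\pi_m(z)=\frac{(1+z)^m(1+z)^{\frac12}\left(\xi e^{-\frac{5\pi i}{4}}\right)^{\frac12}e^{\frac{i\xi^2}{4}}}{2\,z^{\frac12}}\Bigg\{\left[1-\frac{1}{(1-z)^{\frac12}(1+z)^{\frac12}}\right]\left[e^{\frac{\pi i}{4}}D_{-\frac12}\left(e^{-\frac{3\pi i}{4}}\xi\right)-i\sqrt2\,D_{-\frac12}\left(e^{-\frac{5\pi i}{4}}\xi\right)\right]+\mathcal{O}\left(\frac{1}{\sqrt m}\right)\Bigg\},$$ where the $\mathcal{O}(1/\sqrt m)$ term is uniform: there are a constant $C>0$ and an integer $M>0$ such that it is bounded in modulus by $C/\sqrt m$ for all $m\ge M$ and all such $z$.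
   Context: **Polynomials.** For an integer $m\ge 1$ let $$P_m(z)=P_m^{(m+\frac12,-m-\frac12)}(z)=2^{-m}\sum_{k=0}^m\binom{2m+\frac12}{m-k}\binom{-\frac12}{k}(z-1)^k(z+1)^{m-k}$$ (generalized binomial coefficients), which is the Jacobi polynomial $P_m^{(\alpha,\beta)}$ with $\alpha=m+\frac12$, $\beta=-m-\frac12$. Let $\pi_m(z)=P_m(z)/\kappa_m$ with $\kappa_m=2^{-m}\binom{2m}{m}$, so that $\pi_m$ is monic of degree $m$. **Branches.** The square roots are $$(1+z)^{\frac12}=|1+z|^{\frac12}e^{i\theta/2},\quad \theta=\mathrm{Arg}(z+1)\in[0,2\pi),$$ $$(1-z)^{\frac12}=|1-z|^{\frac12}e^{i(\phi+\pi)/2},\quad \phi=\mathrm{Arg}(z-1)\in[0,2\pi),$$ and for any other argument $w$ (in particular $w=z$ and $w=\xi e^{-5\pi i/4}$) $w^{\frac12}=|w|^{\frac12}e^{i\,\mathrm{Arg}(w)/2}$ with $\mathrm{Arg}(w)\in[0,2\pi)$. **Region.** $\mathbb{C}^+$ is the open upper half-plane and $u_\varepsilon=\{z\in\mathbb{C}:|z|<\varepsilon\}$. Let $\Sigma_{-1}=\{z:|1-z^2|=1,\ \mathrm{Re}\,z\le 0\}$, a simple closed curve through the origin encircling $-1$. Let $\Sigma_{1/r}$ be a fixed (independent of $m$) simple closed curve consisting of the segment $[-i\varepsilon,i\varepsilon]$ of the imaginary axis together with a simple differentiable arc in the open left half-plane joining the endpoints of this segment, such that $\Sigma_{-1}\setminus\{0\}$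 lies inside $\Sigma_{1/r}$ and this arc stays at a positive distance from $\Sigma_{-1}$. Then $\Omega_-$ is the open region of points inside $\Sigma_{1/r}$ and outside $\Sigma_{-1}$. **Local variable.** For $z\in u_\varepsilon$, $$\xi=\lambda(z)=\sqrt{2m}\,z\,e^{-\pi i/4}\,\tau(z),\qquad \tau(z)=\sqrt{\sum_{k=0}^\infty\frac{z^{2k}}{k+1}},\quad \tau(0)=1,$$ where $\varepsilon$ is small enough that $\tau$ is analytic in $u_\varepsilon$ and $\lambda$ is biholomorphic from $u_\varepsilon$ onto its image. It satisfies $(1-z^2)^m=e^{-i\xi^2/2}$; $z(\xi)$ denotes the inverse map. **Special function.** $D_\nu$ is the standard (Whittaker) parabolic cylinder function: the entire solution of $D_\nu''(\eta)+\left(\nu+\frac12-\frac{\eta^2}{4}\right)D_\nu(\eta)=0$ with $D_\nu(\eta)\sim\eta^\nu e^{-\eta^2/4}$ as $\eta\to\infty$ in $|\arg\eta|<\frac{3\pi}{4}$. *)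

theory Defs
  imports "HOL-Analysis.Analysis"
begin

text \<open>Jacobi polynomials with parameters \<open>\<alpha> = m + 1/2\<close>, \<open>\<beta> = - m - 1/2\<close>, so that
  \<open>m + \<alpha> = 2 m + 1/2\<close> and \<open>m + \<beta> = - 1/2\<close>.\<close>

definition jacobi_P :: "nat \<Rightarrow> complex \<Rightarrow> complex" where
  "jacobi_P m z = (1 / 2 ^ m) *
     (\<Sum>k = 0..m. ((2 * of_nat m + 1/2) gchoose (m - k)) * ((- 1/2) gchoose k)
                  * (z - 1) ^ k * (z + 1) ^ (m - k))"

definition lead_kappa :: "nat \<Rightarrow> complex" where
  "lead_kappa m = (1 / 2 ^ m) * of_nat ((2 * m) choose m)"

definition monic_pi :: "nat \<Rightarrow> complex \<Rightarrow> complex" where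
  "monic_pi m z = jacobi_P m z / lead_kappa m"

text \<open>Square roots with arguments in \<open>[0, 2\<pi>)\<close>, i.e. cut along the positive real axis; this is
  not the principal branch \<open>csqrt\<close>. The branch of \<open>(1 - z)\<^sup>1\<^sup>/\<^sup>2\<close> is prescribed
  through the argument of \<open>z - 1\<close> and is not \<open>sqrt_pos\<close> applied to \<open>1 - z\<close>.\<close>

definition sqrt_pos :: "complex \<Rightarrow> complex" where
  "sqrt_pos w = of_real (sqrt (cmod w)) * exp (\<i> * of_real (Arg2pi w / 2))"

definition sqrt_one_minus :: "complex \<Rightarrow> complex" where
  "sqrt_one_minus z =
     of_real (sqrt (cmod (1 - z))) * exp (\<i> * of_real ((Arg2pi (z - 1) + pi) / 2))"

definition upper_half_plane :: "complex set" where
  "upper_half_plane = {z. Im z > 0}"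

definition Sigma_minus_one :: "complex set" where
  "Sigma_minus_one = {z. cmod (1 - z\<^sup>2) = 1 \<and> Re z \<le> 0}"

text \<open>The curve \<open>\<Sigma>\<^bsub>1/r\<^esub>\<close> depends on the choice of its left arc, parametrised here by \<open>g\<close>.\<close>

definition Sigma_r :: "real \<Rightarrow> (real \<Rightarrow> complex) \<Rightarrow> complex set" where
  "Sigma_r \<epsilon> g = closed_segment (- \<i> * of_real \<epsilon>) (\<i> * of_real \<epsilon>) \<union> path_image g"

definition admissible_arc :: "real \<Rightarrow> (real \<Rightarrow> complex) \<Rightarrow> bool" where
  "admissible_arc \<epsilon> g \<longleftrightarrow>
     arc g \<and> g differentiable_on {0..1} \<and>
     pathstart g = \<i> * of_real \<epsilon> \<and> pathfinish g = - \<i> * of_real \<epsilon> \<and>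
     (\<forall>t\<in>{0<..<1}. Re (g t) < 0) \<and>
     Sigma_minus_one - {0} \<subseteq> inside (Sigma_r \<epsilon> g) \<and>
     setdist (path_image g) Sigma_minus_one > 0"

definition Omega_minus :: "real \<Rightarrow> (real \<Rightarrow> complex) \<Rightarrow> complex set" where
  "Omega_minus \<epsilon> g = inside (Sigma_r \<epsilon> g) \<inter> outside Sigma_minus_one"

text \<open>The series is \<open>- Ln (1 - z\<^sup>2) / z\<^sup>2\<close>, which has positive real part on the unit disc, so
  the principal root is the analytic branch with \<open>\<tau> 0 = 1\<close>.\<close>

definition tau :: "complex \<Rightarrow> complex" where
  "tau z = csqrt (\<Sum>k. z ^ (2 * k) / of_nat (k + 1))"

definition lam :: "nat \<Rightarrow> complex \<Rightarrow> complex" where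
  "lam m z = of_real (sqrt (2 * real m)) * z * exp (- (\<i> * of_real pi / 4)) * tau z"

definition lam_inv :: "real \<Rightarrow> nat \<Rightarrow> complex \<Rightarrow> complex" where
  "lam_inv \<epsilon> m = the_inv_into (ball 0 \<epsilon>) (lam m)"

definition admissible_radius :: "real \<Rightarrow> bool" where
  "admissible_radius \<epsilon> \<longleftrightarrow>
     \<epsilon> > 0 \<and> tau analytic_on ball 0 \<epsilon> \<and>
     (\<forall>m\<ge>1. lam m holomorphic_on ball 0 \<epsilon> \<and> inj_on (lam m) (ball 0 \<epsilon>) \<and>
            lam_inv \<epsilon> m holomorphic_on lam m ` ball 0 \<epsilon>)"

text \<open>The asymptotic relation in the open sector \<open>|arg \<eta>| < 3\<pi>/4\<close> is, as usual, uniform on each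
  smaller closed sector (it cannot be uniform up to the boundary rays); \<open>powr\<close> is principal.\<close>

definition is_parabolic_cylinder :: "complex \<Rightarrow> (complex \<Rightarrow> complex) \<Rightarrow> bool" where
  "is_parabolic_cylinder \<nu> D \<longleftrightarrow>
     D holomorphic_on UNIV \<and>
     (\<forall>\<eta>. (deriv ^^ 2) D \<eta> + (\<nu> + 1/2 - \<eta>\<^sup>2 / 4) * D \<eta> = 0) \<and>
     (\<forall>\<delta>>0. ((\<lambda>\<eta>. D \<eta> / (\<eta> powr \<nu> * exp (- \<eta>\<^sup>2 / 4))) \<longlongrightarrow> 1)
        (inf at_infinity (principal {\<eta>. \<bar>Arg \<eta>\<bar> \<le> 3 * pi / 4 - \<delta>})))"

definition parabolic_cylinder_D :: "complex \<Rightarrow> complex \<Rightarrow> complex" where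
  "parabolic_cylinder_D \<nu> = (THE D. is_parabolic_cylinder \<nu> D)"

end

theory Submission
  imports Defs "HOL-Complex_Analysis.Complex_Analysis" "HOL-Probability.Distributions"
begin

text \<open>The sum defining the Jacobi polynomial is a terminating hypergeometric series, and its Euler integral
has a surprisingly simple form: with \<open>w = (1 - z) / (1 + z)\<close>,
\<open>\<pi>\<^sub>m(z) = (1 + z)^m K\<^sub>m \<integral> ((1 - s\<^sup>2) (1 + w s\<^sup>2))^m ds\<close> over \<open>[-1, 1]\<close>, where
\<open>K\<^sub>m = (1/2)\<^sub>2\<^sub>m\<^sub>+\<^sub>1 / (2m)!\<close> is asymptotic to \<open>sqrt (2m / \<pi>)\<close> with relative error \<open>O(1/m)\<close>
(\<open>monic_pi_eq_integral\<close>, \<open>euler_const_asymptotic\<close>). There is no oscillation or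
steepest descent to perform: this is a Laplace integral concentrated near \<open>s = 0\<close>.

Put \<open>N = sqrt (2m)\<close>, \<open>s = v / sqrt N\<close> and \<open>\<zeta> = z \<tau>(z)\<close>. For \<open>z\<close> of size \<open>1/N\<close> the
integrand tends to \<open>exp (- N \<zeta> v\<^sup>2 - v^4 / 2)\<close>, because \<open>(1 - t)(1 + w t) = 1 - 2 \<zeta> t - t\<^sup>2 + \<dots>\<close>; the two
\<open>m\<close>-th powers differ by \<open>O(1/N)\<close> times an integrable function (\<open>laplace_integrand_error\<close>).
Hence \<open>\<pi>\<^sub>m(z) = (1 + z)^m sqrt N (G(x) + O(1 / sqrt m))\<close> with \<open>x = N \<zeta> = exp (\<i>\<pi>/4) \<xi>\<close> and
\<open>G(x) = \<pi>^(-1/2) \<integral> exp (- x s\<^sup>2 - s^4 / 2) ds\<close> over the real line (\<open>monic_pi_asymptotic\<close>).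

The function \<open>exp (- x\<^sup>2 / 4) G(x)\<close> is \<open>D\<close> with index \<open>-1/2\<close> (\<open>parabolic_cylinder_D_eq_pcf\<close>). It solves
\<open>D'' = x\<^sup>2 D / 4\<close> by an integration by parts; its asymptotics in the whole sector \<open>|arg x| < 3\<pi>/4\<close>
come from rotating the line of integration by less than \<open>\<pi>/8\<close>; and it is the only solution with these
asymptotics because \<open>D(x)\<close> and \<open>D(-x)\<close> span the solution space while \<open>D(-x)\<close> is not recessive on the
positive axis. As \<open>D(\<i> x)\<close> solves the same equation, comparing values and derivatives at 0 gives the
connection formula \<open>D(x) = \<i> D(-x) + sqrt 2 exp (-\<i>\<pi>/4) D(\<i> x)\<close>, which turns \<open>D(x)\<close> into the
combination of two parabolic cylinder functions in the theorem.

The rest is bookkeeping: in the upper half-plane all the prescribed square roots are principal ones up to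
explicit constants, and the factors \<open>(1 + z)^(1/2)\<close>, \<open>\<tau>^(1/2)\<close> and \<open>1 - (1 - z)^(-1/2) (1 + z)^(-1/2)\<close> equal
1, 1 and 2 up to \<open>O(z)\<close>, that is \<open>O(1 / sqrt m)\<close>.\<close>

section \<open>Quartic exponential integrals on the real line\<close>

lemma power_le_fact_times_exp:
  fixes x :: real
  assumes "0 \<le> x"
  shows "x ^ n \<le> fact n * exp x"
proof -
  have "(\<Sum>k\<in>{n}. x ^ k /\<^sub>R fact k) \<le> (\<Sum>k. x ^ k /\<^sub>R fact k)"
    by (rule sum_le_suminf) (use assms summable_exp_generic[of x] in auto)
  then show ?thesis
    by (simp add: exp_def divide_simps mult.commute)
qed

text \<open>One Gaussian majorant for all moments and all real \<open>R\<close>: the quartic term absorbs both the growing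
quadratic exponent and, through \<open>|s| \<le> 1 + s\<^sup>2\<close>, the polynomial factor. All integrability claims about
\<open>exp (- x s\<^sup>2 - s^4 / 2)\<close> reduce to it.\<close>

lemma quartic_le_gaussian:
  fixes R s c :: real
  assumes "c > 0"
  shows "\<bar>s\<bar> ^ n * exp (R * s\<^sup>2 - c * s ^ 4)
           \<le> fact n * exp (1 + (R + 2)\<^sup>2 / (4 * c)) * exp (- s\<^sup>2)"
proof -
  have sq: "(R + 2) * s\<^sup>2 - c * s ^ 4 \<le> (R + 2)\<^sup>2 / (4 * c)"
  proof -
    have "0 \<le> (2 * c * s\<^sup>2 - (R + 2))\<^sup>2 / (4 * c)"
      using assms by simp
    also have "\<dots> = (R + 2)\<^sup>2 / (4 * c) - ((R + 2) * s\<^sup>2 - c * s ^ 4)"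
      using assms by (simp add: field_simps power2_eq_square power4_eq_xxxx)
    finally show ?thesis by simp
  qed
  have "\<bar>s\<bar> \<le> 1 + s\<^sup>2"
  proof -
    have "0 \<le> (\<bar>s\<bar> - 1/2)\<^sup>2" by simp
    then have "\<bar>s\<bar> \<le> \<bar>s\<bar>\<^sup>2 + 1/4" by (simp add: power2_eq_square algebra_simps)
    then show ?thesis by simp
  qed
  then have "\<bar>s\<bar> + (R * s\<^sup>2 - c * s ^ 4) \<le> (1 + (R + 2)\<^sup>2 / (4 * c)) + - s\<^sup>2"
    using sq by (simp add: algebra_simps)
  then have "exp (\<bar>s\<bar> + (R * s\<^sup>2 - c * s ^ 4)) \<le> exp ((1 + (R + 2)\<^sup>2 / (4 * c)) + - s\<^sup>2)"
    by simp
  then have "exp \<bar>s\<bar> * exp (R * s\<^sup>2 - c * s ^ 4) \<le> exp (1 + (R + 2)\<^sup>2 / (4 * c)) * exp (- s\<^sup>2)"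
    unfolding exp_add[of "\<bar>s\<bar>"] exp_add[of _ "- s\<^sup>2"] .
  then have "fact n * (exp \<bar>s\<bar> * exp (R * s\<^sup>2 - c * s ^ 4))
      \<le> fact n * (exp (1 + (R + 2)\<^sup>2 / (4 * c)) * exp (- s\<^sup>2))"
    by simp
  moreover have "\<bar>s\<bar> ^ n * exp (R * s\<^sup>2 - c * s ^ 4) \<le> (fact n * exp \<bar>s\<bar>) * exp (R * s\<^sup>2 - c * s ^ 4)"
    by (intro mult_right_mono power_le_fact_times_exp) auto
  ultimately show ?thesis by (simp only: mult.assoc)
qed

lemma has_bochner_integral_gaussian:
  "has_bochner_integral lborel (\<lambda>s::real. exp (- s\<^sup>2)) (sqrt pi)"
  using has_bochner_integral_even_function[OF gaussian_moment_0] by simp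

lemma integrable_gaussian: "integrable lborel (\<lambda>s::real. exp (- s\<^sup>2))"
  using has_bochner_integral_gaussian by (simp add: has_bochner_integral_iff)

lemma integral_gaussian: "(\<integral>s. exp (- s\<^sup>2) \<partial>lborel) = sqrt pi"
  using has_bochner_integral_gaussian by (simp add: has_bochner_integral_iff)

lemma integrable_quartic:
  fixes R c :: real
  assumes "c > 0"
  shows "integrable lborel (\<lambda>s. \<bar>s\<bar> ^ n * exp (R * s\<^sup>2 - c * s ^ 4))"
proof (rule Bochner_Integration.integrable_bound)
  show "integrable lborel (\<lambda>s. fact n * exp (1 + (R + 2)\<^sup>2 / (4 * c)) * exp (- s\<^sup>2))"
    by (intro integrable_mult_right integrable_gaussian)
  show "AE s in lborel. norm (\<bar>s\<bar> ^ n * exp (R * s\<^sup>2 - c * s ^ 4))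
      \<le> norm (fact n * exp (1 + (R + 2)\<^sup>2 / (4 * c)) * exp (- s\<^sup>2))"
    using quartic_le_gaussian[OF assms] by (intro AE_I2) (simp add: abs_mult)
qed measurable

lemma integral_primitive_limit:
  fixes f F :: "real \<Rightarrow> complex"
  assumes F: "\<And>s. (F has_vector_derivative f s) (at s)"
    and f: "continuous_on UNIV f" "integrable lborel f"
  shows "(\<lambda>n. F (real n) - F (- real n)) \<longlonglongrightarrow> (\<integral>s. f s \<partial>lborel)"
proof -
  have "(\<lambda>n. \<integral>s. indicator {- real n .. real n} s *\<^sub>R f s \<partial>lborel) \<longlonglongrightarrow> (\<integral>s. f s \<partial>lborel)"
  proof (rule integral_dominated_convergence[where w = "\<lambda>s. norm (f s)"])
    show "f \<in> borel_measurable lborel" using f(2) by auto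
    then show "(\<lambda>s. indicator {- real n .. real n} s *\<^sub>R f s) \<in> borel_measurable lborel" for n
      by measurable
    show "AE s in lborel. (\<lambda>n. indicator {- real n .. real n} s *\<^sub>R f s) \<longlonglongrightarrow> f s"
    proof (rule AE_I2)
      fix s :: real
      obtain n0 where n0: "\<bar>s\<bar> < real n0" using reals_Archimedean2 by blast
      have "eventually (\<lambda>n. indicator {- real n .. real n} s *\<^sub>R f s = f s) sequentially"
        using eventually_ge_at_top[of n0] by eventually_elim (use n0 in \<open>auto simp: indicator_def abs_le_iff\<close>)
      then show "(\<lambda>n. indicator {- real n .. real n} s *\<^sub>R f s) \<longlonglongrightarrow> f s"
        by (rule tendsto_eventually)
    qed
  qed (use f(2) in \<open>auto simp: indicator_def\<close>)
  moreover have "(\<integral>s. indicator {- real n .. real n} s *\<^sub>R f s \<partial>lborel) = F (real n) - F (- real n)" for n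
    by (rule integral_FTC_atLeastAtMost)
      (auto intro: has_vector_derivative_at_within[OF F] continuous_on_subset[OF f(1)])
  ultimately show ?thesis by simp
qed

text \<open>Rotation of the line of integration. A primitive \<open>F\<close> of \<open>f\<close> evaluates both integrals over \<open>[-n, n]\<close>, so
they differ by increments of \<open>F\<close> along two circular arcs of radius \<open>n\<close>; these vanish in the limit as soon
as \<open>n h(n)\<close> does.\<close>

lemma integral_rotate_line:
  fixes f :: "complex \<Rightarrow> complex" and h :: "real \<Rightarrow> real" and \<theta> :: real
  assumes holf: "f holomorphic_on UNIV"
    and bound: "\<And>s \<phi>. \<phi> \<in> closed_segment 0 \<theta> \<Longrightarrow> cmod (f (of_real s * cis \<phi>)) \<le> h s"
    and h: "integrable lborel h" "\<And>s. h (- s) = h s" "((\<lambda>s. s * h s) \<longlongrightarrow> 0) at_top"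
  shows "integrable lborel (\<lambda>s. f (of_real s * cis \<theta>))"
    and "(\<integral>s. f (of_real s) \<partial>lborel) = cis \<theta> * (\<integral>s. f (of_real s * cis \<theta>) \<partial>lborel)"
proof -
  have contf: "continuous_on UNIV f"
    using holf holomorphic_on_imp_continuous_on by blast
  have cont: "continuous_on UNIV (\<lambda>s::real. f (of_real s * cis \<phi>))" for \<phi>
    by (intro continuous_on_compose2[OF contf] continuous_intros) auto
  have int: "integrable lborel (\<lambda>s. f (of_real s * cis \<phi>))" if "\<phi> \<in> closed_segment 0 \<theta>" for \<phi>
  proof (rule Bochner_Integration.integrable_bound[OF h(1)])
    show "(\<lambda>s. f (of_real s * cis \<phi>)) \<in> borel_measurable lborel"
      using borel_measurable_continuous_onI[OF cont] by simp
    show "AE s in lborel. cmod (f (of_real s * cis \<phi>)) \<le> norm (h s)"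
      unfolding real_norm_def by (intro AE_I2 order_trans[OF bound[OF that] abs_ge_self])
  qed
  show "integrable lborel (\<lambda>s. f (of_real s * cis \<theta>))" by (rule int) auto
  obtain F where F: "\<And>u. (F has_field_derivative f u) (at u)"
    using holomorphic_convex_primitive'[OF convex_UNIV open_UNIV holf] by (metis UNIV_I)
  have lim: "(\<lambda>n. F (of_real (real n) * cis \<phi>) - F (of_real (- real n) * cis \<phi>))
      \<longlonglongrightarrow> (\<integral>s. cis \<phi> * f (of_real s * cis \<phi>) \<partial>lborel)" if "\<phi> \<in> closed_segment 0 \<theta>" for \<phi>
  proof (rule integral_primitive_limit)
    show "((\<lambda>s. F (of_real s * cis \<phi>)) has_vector_derivative cis \<phi> * f (of_real s * cis \<phi>)) (at s)" for s
    proof -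
      have "((\<lambda>s. s *\<^sub>R cis \<phi>) has_vector_derivative cis \<phi>) (at s)"
        using has_vector_derivative_scaleR[OF DERIV_ident has_vector_derivative_const, of "cis \<phi>" s UNIV] by simp
      then have "((\<lambda>s. of_real s * cis \<phi>) has_vector_derivative cis \<phi>) (at s)"
        by (simp add: scaleR_conv_of_real)
      from field_vector_diff_chain_at[OF this F] show ?thesis
        by (simp add: o_def)
    qed
    show "continuous_on UNIV (\<lambda>s. cis \<phi> * f (of_real s * cis \<phi>))"
      by (intro continuous_on_mult continuous_on_const cont)
    show "integrable lborel (\<lambda>s. cis \<phi> * f (of_real s * cis \<phi>))"
      by (intro integrable_mult_right int that)
  qed
  \<comment> \<open>The two primitives differ by an increment along a circular arc of length \<open>\<bar>s\<theta>\<bar>\<close>.\<close>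
  have arc: "cmod (F (of_real s * cis \<theta>) - F (of_real s)) \<le> \<bar>s\<bar> * h s * \<bar>\<theta>\<bar>" for s
  proof -
    have "cmod (F (of_real s * cis \<theta>) - F (of_real s * cis 0)) \<le> (\<bar>s\<bar> * h s) * norm (\<theta> - 0)"
    proof (rule differentiable_bound
        [where S = "closed_segment 0 \<theta>" and f' = "\<lambda>\<phi> t. t *\<^sub>R (of_real s * (\<i> * cis \<phi>) * f (of_real s * cis \<phi>))"])
      fix \<phi> assume \<phi>: "\<phi> \<in> closed_segment 0 \<theta>"
      have "((\<lambda>\<phi>. of_real s * cis \<phi>) has_derivative (\<lambda>t. of_real s * (t *\<^sub>R (\<i> * cis \<phi>)))) (at \<phi>)"
        by (intro has_derivative_mult_right has_derivative_cis has_derivative_ident)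
      then have "((\<lambda>\<phi>. of_real s * cis \<phi>) has_vector_derivative (of_real s * (\<i> * cis \<phi>))) (at \<phi>)"
        by (simp add: has_vector_derivative_def)
      from field_vector_diff_chain_at[OF this F]
      show "((\<lambda>\<phi>. F (of_real s * cis \<phi>)) has_derivative
          (\<lambda>t. t *\<^sub>R (of_real s * (\<i> * cis \<phi>) * f (of_real s * cis \<phi>)))) (at \<phi> within closed_segment 0 \<theta>)"
        unfolding has_vector_derivative_def o_def by (rule has_derivative_at_withinI)
      have "cmod (of_real s * (\<i> * cis \<phi>) * f (of_real s * cis \<phi>)) \<le> \<bar>s\<bar> * h s"
        using bound[OF \<phi>, of s] by (simp add: norm_mult mult_left_mono)
      then show "onorm (\<lambda>t. t *\<^sub>R (of_real s * (\<i> * cis \<phi>) * f (of_real s * cis \<phi>))) \<le> \<bar>s\<bar> * h s"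
        by (intro onorm_le) (simp add: mult.commute mult_left_mono)
    qed auto
    then show ?thesis by simp
  qed
  have h0: "(\<lambda>n. real n * h (real n) * \<bar>\<theta>\<bar>) \<longlonglongrightarrow> 0"
    using tendsto_mult_left_zero[OF filterlim_compose[OF h(3) filterlim_real_sequentially]] by simp
  have z1: "(\<lambda>n. F (of_real (real n) * cis \<theta>) - F (of_real (real n))) \<longlonglongrightarrow> 0"
    by (rule Lim_null_comparison[OF _ h0]) (rule always_eventually, use arc[of "real n" for n] in simp)
  have z2: "(\<lambda>n. F (of_real (- real n) * cis \<theta>) - F (of_real (- real n))) \<longlonglongrightarrow> 0"
  proof (rule Lim_null_comparison[OF _ h0])
    show "\<forall>\<^sub>F n in sequentially. cmod (F (of_real (- real n) * cis \<theta>) - F (of_real (- real n)))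
        \<le> real n * h (real n) * \<bar>\<theta>\<bar>"
      by (rule always_eventually) (use arc[of "- real n" for n] h(2) in simp)
  qed
  have "(\<lambda>n. (F (of_real (real n) * cis 0) - F (of_real (- real n) * cis 0))
      + ((F (of_real (real n) * cis \<theta>) - F (of_real (real n)))
        - (F (of_real (- real n) * cis \<theta>) - F (of_real (- real n)))))
      \<longlonglongrightarrow> (\<integral>s. cis 0 * f (of_real s * cis 0) \<partial>lborel) + (0 - 0)"
    by (intro tendsto_add tendsto_diff z1 z2 lim) auto
  moreover have "(\<lambda>n. F (of_real (real n) * cis \<theta>) - F (of_real (- real n) * cis \<theta>))
      \<longlonglongrightarrow> (\<integral>s. cis \<theta> * f (of_real s * cis \<theta>) \<partial>lborel)"
    by (rule lim) auto
  ultimately have "(\<integral>s. cis \<theta> * f (of_real s * cis \<theta>) \<partial>lborel) = (\<integral>s. cis 0 * f (of_real s * cis 0) \<partial>lborel) + (0 - 0)"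
    by (intro LIMSEQ_unique) simp_all
  then show "(\<integral>s. f (of_real s) \<partial>lborel) = cis \<theta> * (\<integral>s. f (of_real s * cis \<theta>) \<partial>lborel)"
    by simp
qed

section \<open>The parabolic cylinder function of index \<open>-1/2\<close> as an integral\<close>

text \<open>The derivatives of \<open>\<integral> exp (- x s\<^sup>2 - s^4 / 2) ds\<close>, up to sign; the substitution \<open>t = s\<^sup>2\<close> turns the case \<open>n = 0\<close>
into the classical integral \<open>\<integral> t^(-1/2) exp (- x t - t\<^sup>2 / 2) dt\<close> over the half-line, without its singularity.\<close>

definition quartic_moment :: "nat \<Rightarrow> complex \<Rightarrow> complex" where
  "quartic_moment n x = (\<integral>s. of_real (s ^ (2 * n)) * exp (- x * of_real (s\<^sup>2) - of_real (s ^ 4 / 2)) \<partial>lborel)"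

lemma norm_quartic_integrand:
  "cmod (of_real (s ^ (2 * n)) * exp (- x * of_real (s\<^sup>2) - of_real (s ^ 4 / 2)))
     = \<bar>s\<bar> ^ (2 * n) * exp (- Re x * s\<^sup>2 - (1/2) * s ^ 4)"
  by (simp add: norm_mult norm_power)

lemma integrable_quartic_integrand:
  "integrable lborel (\<lambda>s. complex_of_real (s ^ (2 * n)) * exp (- x * of_real (s\<^sup>2) - of_real (s ^ 4 / 2)))"
proof (rule Bochner_Integration.integrable_bound)
  show "integrable lborel (\<lambda>s. \<bar>s\<bar> ^ (2 * n) * exp (- Re x * s\<^sup>2 - (1/2) * s ^ 4))"
    by (rule integrable_quartic) simp
  show "(\<lambda>s. complex_of_real (s ^ (2 * n)) * exp (- x * of_real (s\<^sup>2) - of_real (s ^ 4 / 2))) \<in> borel_measurable lborel"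
  proof -
    have "continuous_on UNIV (\<lambda>s. complex_of_real (s ^ (2 * n)) * exp (- x * of_real (s\<^sup>2) - of_real (s ^ 4 / 2)))"
      by (intro continuous_intros) auto
    then show ?thesis using borel_measurable_continuous_onI by simp
  qed
  show "AE s in lborel. cmod (of_real (s ^ (2 * n)) * exp (- x * of_real (s\<^sup>2) - of_real (s ^ 4 / 2)))
      \<le> norm (\<bar>s\<bar> ^ (2 * n) * exp (- Re x * s\<^sup>2 - (1/2) * s ^ 4))"
    unfolding norm_quartic_integrand by simp
qed

lemma exp_minus_one_minus_bound:
  fixes w :: complex
  shows "cmod (exp w - 1 - w) \<le> exp (cmod w) * (cmod w)\<^sup>2"
proof -
  have "cmod (exp w - (\<Sum>k\<le>1. w ^ k / fact k)) \<le> exp \<bar>Re w\<bar> * cmod w ^ Suc 1 / fact 1"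
    by (rule Taylor_exp)
  then have "cmod (exp w - 1 - w) \<le> exp \<bar>Re w\<bar> * (cmod w)\<^sup>2"
    by (simp add: power2_eq_square algebra_simps)
  also have "\<dots> \<le> exp (cmod w) * (cmod w)\<^sup>2"
    by (intro mult_right_mono) (auto simp: abs_Re_le_cmod)
  finally show ?thesis .
qed

text \<open>Differentiation under the integral sign, with an explicit second-order remainder: \<open>exp (- h s\<^sup>2) - 1 + h s\<^sup>2\<close>
is at most \<open>|h|\<^sup>2 s^4 exp (s\<^sup>2)\<close> for \<open>|h| < 1\<close>, and the factor \<open>exp (s\<^sup>2)\<close> is harmless against the quartic decay.\<close>

lemma quartic_moment_has_field_derivative:
  "(quartic_moment n has_field_derivative - quartic_moment (Suc n) x) (at x)"
proof -
  let ?f = "\<lambda>n x s. complex_of_real (s ^ (2 * n)) * exp (- x * of_real (s\<^sup>2) - of_real (s ^ 4 / 2))"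
  define B where "B = (\<integral>s. \<bar>s\<bar> ^ (2 * n + 4) * exp ((cmod x + 1) * s\<^sup>2 - (1/2) * s ^ 4) \<partial>lborel)"
  have quot: "cmod ((quartic_moment n (x + h) - quartic_moment n x) / h - - quartic_moment (Suc n) x) \<le> B * cmod h"
    if h: "h \<noteq> 0" "cmod h < 1" for h
  proof -
    let ?d = "\<lambda>s. ?f n (x + h) s - ?f n x s + h * ?f (Suc n) x s"
    have int: "integrable lborel ?d"
      by (intro Bochner_Integration.integrable_add Bochner_Integration.integrable_diff
          integrable_mult_right integrable_quartic_integrand)
    have eq: "quartic_moment n (x + h) - quartic_moment n x + h * quartic_moment (Suc n) x = (\<integral>s. ?d s \<partial>lborel)"
      unfolding quartic_moment_def
      by (simp only: Bochner_Integration.integral_add Bochner_Integration.integral_diff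
          Bochner_Integration.integrable_diff integral_mult_right_zero
          integrable_mult_right integrable_quartic_integrand)
    have "cmod (\<integral>s. ?d s \<partial>lborel) \<le> (\<integral>s. (cmod h)\<^sup>2 * (\<bar>s\<bar> ^ (2 * n + 4) * exp ((cmod x + 1) * s\<^sup>2 - (1/2) * s ^ 4)) \<partial>lborel)"
    proof (rule Bochner_Integration.integral_norm_bound_integral[OF int])
      show "integrable lborel (\<lambda>s. (cmod h)\<^sup>2 * (\<bar>s\<bar> ^ (2 * n + 4) * exp ((cmod x + 1) * s\<^sup>2 - (1/2) * s ^ 4)))"
        by (intro integrable_mult_right integrable_quartic) simp
      fix s :: real
      have "?d s = ?f n x s * (exp (- h * of_real (s\<^sup>2)) - 1 - (- h * of_real (s\<^sup>2)))"
      proof -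
        have e: "exp (- (x + h) * of_real (s\<^sup>2) - of_real (s ^ 4 / 2))
            = exp (- x * of_real (s\<^sup>2) - of_real (s ^ 4 / 2)) * exp (- h * of_real (s\<^sup>2))"
          by (simp add: exp_add[symmetric] algebra_simps)
        have p: "complex_of_real (s ^ (2 * Suc n)) = of_real (s ^ (2 * n)) * of_real (s\<^sup>2)"
          by (simp add: power_add power2_eq_square)
        show ?thesis unfolding e p by (simp only: ring_distribs mult_ac) simp
      qed
      then have "cmod (?d s) = (\<bar>s\<bar> ^ (2 * n) * exp (- Re x * s\<^sup>2 - (1/2) * s ^ 4))
           * cmod (exp (- h * of_real (s\<^sup>2)) - 1 - (- h * of_real (s\<^sup>2)))"
        by (simp only: norm_mult[of "?f n x s"] norm_quartic_integrand)
      also have "\<dots> \<le> (\<bar>s\<bar> ^ (2 * n) * exp (- Re x * s\<^sup>2 - (1/2) * s ^ 4)) * (exp (s\<^sup>2) * (cmod h * s\<^sup>2)\<^sup>2)"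
      proof (rule mult_left_mono)
        have "cmod (exp (- h * of_real (s\<^sup>2)) - 1 - (- h * of_real (s\<^sup>2)))
            \<le> exp (cmod (- h * of_real (s\<^sup>2))) * (cmod (- h * of_real (s\<^sup>2)))\<^sup>2"
          by (rule exp_minus_one_minus_bound)
        also have "\<dots> \<le> exp (s\<^sup>2) * (cmod h * s\<^sup>2)\<^sup>2"
          using h mult_right_mono[of "cmod h" 1 "s\<^sup>2"] by (auto intro!: mult_right_mono simp: norm_mult norm_power)
        finally show "cmod (exp (- h * of_real (s\<^sup>2)) - 1 - (- h * of_real (s\<^sup>2))) \<le> exp (s\<^sup>2) * (cmod h * s\<^sup>2)\<^sup>2" .
      qed simp
      also have "\<dots> = (cmod h)\<^sup>2 * (\<bar>s\<bar> ^ (2 * n + 4) * exp ((- Re x + 1) * s\<^sup>2 - (1/2) * s ^ 4))"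
      proof -
        have e: "exp ((- Re x + 1) * s\<^sup>2 - (1/2) * s ^ 4) = exp (- Re x * s\<^sup>2 - (1/2) * s ^ 4) * exp (s\<^sup>2)"
          by (simp add: exp_add[symmetric] algebra_simps)
        have p: "\<bar>s\<bar> ^ (2 * n + 4) = \<bar>s\<bar> ^ (2 * n) * (s\<^sup>2)\<^sup>2"
          by (simp add: power_add)
        show ?thesis unfolding e p by (simp only: power_mult_distrib mult_ac)
      qed
      also have "\<dots> \<le> (cmod h)\<^sup>2 * (\<bar>s\<bar> ^ (2 * n + 4) * exp ((cmod x + 1) * s\<^sup>2 - (1/2) * s ^ 4))"
        using abs_Re_le_cmod[of x] by (intro mult_left_mono) (auto intro!: mult_right_mono)
      finally show "cmod (?d s) \<le> (cmod h)\<^sup>2 * (\<bar>s\<bar> ^ (2 * n + 4) * exp ((cmod x + 1) * s\<^sup>2 - (1/2) * s ^ 4))" .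
    qed
    then have *: "cmod (quartic_moment n (x + h) - quartic_moment n x + h * quartic_moment (Suc n) x) \<le> (cmod h)\<^sup>2 * B"
      by (simp only: eq B_def integral_mult_right_zero)
    have "(quartic_moment n (x + h) - quartic_moment n x) / h - - quartic_moment (Suc n) x
        = (quartic_moment n (x + h) - quartic_moment n x + h * quartic_moment (Suc n) x) / h"
      using h by (simp add: field_simps)
    then show ?thesis
      using * h by (simp only: norm_divide) (simp add: divide_le_eq power2_eq_square mult_ac)
  qed
  have "(\<lambda>h. (quartic_moment n (x + h) - quartic_moment n x) / h - - quartic_moment (Suc n) x) \<midarrow>0\<rightarrow> 0"
  proof (rule Lim_null_comparison)
    show "\<forall>\<^sub>F h in at 0. cmod ((quartic_moment n (x + h) - quartic_moment n x) / h - - quartic_moment (Suc n) x) \<le> B * cmod h"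
      unfolding eventually_at by (intro exI[of _ 1]) (use quot in \<open>auto simp: dist_norm\<close>)
    show "((\<lambda>h. B * cmod h) \<longlongrightarrow> 0) (at 0)"
      by (auto intro!: tendsto_eq_intros)
  qed
  then show ?thesis
    unfolding DERIV_def by (rule LIM_zero_cancel)
qed

lemmas quartic_moment_derivative [derivative_intros] =
  DERIV_chain2[OF quartic_moment_has_field_derivative]

text \<open>The integral of \<open>(s exp (- x s\<^sup>2 - s^4 / 2))'\<close> over the line is zero. As the moments are derivatives of each
other, this is the equation \<open>G'' - x G' - G / 2 = 0\<close>.\<close>

lemma quartic_moment_recurrence:
  "quartic_moment 0 x = 2 * x * quartic_moment 1 x + 2 * quartic_moment 2 x"
proof -
  let ?f = "\<lambda>n s. complex_of_real (s ^ (2 * n)) * exp (- x * of_real (s\<^sup>2) - of_real (s ^ 4 / 2))"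
  let ?F = "\<lambda>s::real. complex_of_real s * exp (- x * of_real (s\<^sup>2) - of_real (s ^ 4 / 2))"
  let ?g = "\<lambda>s. ?f 0 s - 2 * x * ?f 1 s - 2 * ?f 2 s"
  have lim: "(\<lambda>n. ?F (real n) - ?F (- real n)) \<longlonglongrightarrow> (\<integral>s. ?g s \<partial>lborel)"
  proof (rule integral_primitive_limit)
    fix s :: real
    have "((\<lambda>s::complex. s * exp (- x * s\<^sup>2 - s ^ 4 / 2)) has_field_derivative ?g s) (at (of_real s))"
      by (auto intro!: derivative_eq_intros simp: algebra_simps power2_eq_square power3_eq_cube power4_eq_xxxx)
    from has_vector_derivative_real_field[OF this]
    show "(?F has_vector_derivative ?g s) (at s)" by simp
    show "continuous_on UNIV ?g" by (intro continuous_intros) auto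
    show "integrable lborel ?g"
      by (intro Bochner_Integration.integrable_diff integrable_mult_right integrable_quartic_integrand)
  qed
  have "(\<lambda>n. ?F (real n) - ?F (- real n)) \<longlonglongrightarrow> 0"
  proof (rule Lim_null_comparison)
    let ?b = "\<lambda>s::real. 2 * (fact 1 * exp (1 + (- Re x + 2)\<^sup>2 / (4 * (1/2)))) * exp (- s\<^sup>2)"
    have "cmod (?F s) \<le> fact 1 * exp (1 + (- Re x + 2)\<^sup>2 / (4 * (1/2))) * exp (- s\<^sup>2)" for s
      using quartic_le_gaussian[of "1/2" s 1 "- Re x"] by (simp add: norm_mult)
    note F = this
    have "cmod (?F s - ?F (- s)) \<le> ?b s" for s
    proof -
      let ?K = "fact 1 * exp (1 + (- Re x + 2)\<^sup>2 / (4 * (1/2))) :: real"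
      have "cmod (?F s - ?F (- s)) \<le> ?K * exp (- s\<^sup>2) + ?K * exp (- (- s)\<^sup>2)"
        by (intro order_trans[OF norm_triangle_ineq4] add_mono F)
      also have "\<dots> = ?b s" unfolding power2_minus by (simp only: mult_2 distrib_right)
      finally show ?thesis .
    qed
    then show "\<forall>\<^sub>F n in sequentially. cmod (?F (real n) - ?F (- real n)) \<le> ?b (real n)"
      by (rule always_eventually[OF allI])
    have "((\<lambda>s::real. exp (- s\<^sup>2)) \<longlongrightarrow> 0) at_top" by real_asymp
    then show "(\<lambda>n. ?b (real n)) \<longlonglongrightarrow> 0"
      by (intro tendsto_mult_right_zero filterlim_compose[OF _ filterlim_real_sequentially])
  qed
  with lim have "(\<integral>s. ?g s \<partial>lborel) = 0" by (rule LIMSEQ_unique)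
  moreover have "(\<integral>s. ?g s \<partial>lborel) = quartic_moment 0 x - 2 * x * quartic_moment 1 x - 2 * quartic_moment 2 x"
    unfolding quartic_moment_def
    by (simp only: Bochner_Integration.integral_diff Bochner_Integration.integrable_diff
        integral_mult_right_zero integrable_mult_right integrable_quartic_integrand)
  ultimately show ?thesis by (simp add: algebra_simps)
qed

text \<open>The function that turns out to be \<open>D\<close> of index \<open>-1/2\<close>, together with its derivative.\<close>

definition pcf :: "complex \<Rightarrow> complex" where
  "pcf x = exp (- x\<^sup>2 / 4) * quartic_moment 0 x / of_real (sqrt pi)"

definition pcf' :: "complex \<Rightarrow> complex" where
  "pcf' x = - exp (- x\<^sup>2 / 4) * (x / 2 * quartic_moment 0 x + quartic_moment 1 x) / of_real (sqrt pi)"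

lemma pcf_has_field_derivative: "(pcf has_field_derivative pcf' x) (at x)"
  unfolding pcf_def[abs_def] pcf'_def
  by (auto intro!: derivative_eq_intros simp: field_simps)

lemma pcf'_has_field_derivative: "(pcf' has_field_derivative x\<^sup>2 / 4 * pcf x) (at x)"
proof -
  have "(pcf' has_field_derivative
      (x / 2 * exp (- x\<^sup>2 / 4) * (x / 2 * quartic_moment 0 x + quartic_moment 1 x)
       - exp (- x\<^sup>2 / 4) * (1/2 * quartic_moment 0 x - x / 2 * quartic_moment 1 x - quartic_moment 2 x)) / of_real (sqrt pi)) (at x)"
    unfolding pcf'_def[abs_def]
    by (auto intro!: derivative_eq_intros simp: field_simps numeral_2_eq_2)
  also have "(x / 2 * exp (- x\<^sup>2 / 4) * (x / 2 * quartic_moment 0 x + quartic_moment 1 x)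
       - exp (- x\<^sup>2 / 4) * (1/2 * quartic_moment 0 x - x / 2 * quartic_moment 1 x - quartic_moment 2 x)) / of_real (sqrt pi)
      = x\<^sup>2 / 4 * pcf x + exp (- x\<^sup>2 / 4) * (x * quartic_moment 1 x + quartic_moment 2 x - 1/2 * quartic_moment 0 x) / of_real (sqrt pi)"
    unfolding pcf_def by (simp add: field_simps power2_eq_square)
  also have "x * quartic_moment 1 x + quartic_moment 2 x - 1/2 * quartic_moment 0 x = 0"
    using quartic_moment_recurrence[of x] by simp
  finally show ?thesis by simp
qed

text \<open>The Wronskian of \<open>U\<close> and a solution \<open>V\<close> with \<open>V 0 \<noteq> 0\<close> is constant, hence zero, so \<open>U / V\<close> is constant near 0 and
\<open>U\<close> vanishes there; the identity theorem does the rest.\<close>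

lemma linear_ode_unique:
  fixes U U' V V' q :: "complex \<Rightarrow> complex"
  assumes U: "\<And>x. (U has_field_derivative U' x) (at x)" "\<And>x. (U' has_field_derivative q x * U x) (at x)"
    and V: "\<And>x. (V has_field_derivative V' x) (at x)" "\<And>x. (V' has_field_derivative q x * V x) (at x)"
    and init: "U 0 = 0" "U' 0 = 0" "V 0 \<noteq> 0"
  shows "U x = 0"
proof -
  have "((\<lambda>x. U x * V' x - U' x * V x) has_field_derivative 0) (at x)" for x
    by (rule derivative_eq_intros U V refl)+ (simp add: algebra_simps)
  then obtain c where c: "\<And>x. U x * V' x - U' x * V x = c"
    using has_field_derivative_zero_constant[OF convex_UNIV, of "\<lambda>x. U x * V' x - U' x * V x"] by auto
  have wronskian: "U x * V' x - U' x * V x = 0" for x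
    using c[of x] c[of 0] init by simp
  have contV: "isCont V 0" using V(1) DERIV_isCont by blast
  obtain r where r: "r > 0" "\<And>x. dist 0 x < r \<Longrightarrow> V x \<noteq> 0"
    using continuous_at_avoid[OF contV init(3)] by (auto simp: dist_commute)
  have "((\<lambda>x. U x / V x) has_field_derivative 0) (at x within ball 0 r)" if "x \<in> ball 0 r" for x
  proof -
    have "V x \<noteq> 0" using r that by auto
    then have "((\<lambda>x. U x / V x) has_field_derivative (U' x * V x - U x * V' x) / (V x * V x)) (at x within ball 0 r)"
      using U(1) V(1) has_field_derivative_at_within by (intro DERIV_divide) blast+
    also have "(U' x * V x - U x * V' x) / (V x * V x) = 0"
      using wronskian[of x] by (simp add: algebra_simps)
    finally show ?thesis .
  qed
  then obtain c where c: "\<And>x. x \<in> ball 0 r \<Longrightarrow> U x / V x = c"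
    using has_field_derivative_zero_constant[OF convex_ball, of 0 r "\<lambda>x. U x / V x"] by auto
  have "U x = 0" if "x \<in> ball 0 r" for x
    using c[OF that] c[of 0] r init that by auto
  moreover have "U holomorphic_on UNIV"
    using U(1) by (auto simp: holomorphic_on_def field_differentiable_def intro: has_field_derivative_at_within)
  ultimately show ?thesis
    using analytic_continuation_open[of "ball 0 r" UNIV U "\<lambda>_. 0" x] r(1)
    by (auto simp: open_ball)
qed

lemma quartic_moment_of_real:
  "quartic_moment n (of_real x) = of_real (\<integral>s. s ^ (2 * n) * exp (- x * s\<^sup>2 - s ^ 4 / 2) \<partial>lborel)"
  unfolding quartic_moment_def
  by (subst integral_complex_of_real[symmetric]) (simp add: exp_of_real[symmetric])

lemma integrable_quartic_even:
  "integrable lborel (\<lambda>s::real. s ^ (2 * n) * exp (- x * s\<^sup>2 - s ^ 4 / 2))"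
  using integrable_quartic[of "1/2" "2 * n" "- x"] by (simp add: power_mult)

text \<open>Positivity of the moments makes the value and the derivative of \<open>pcf\<close> at 0 nonzero, which is what the
comparison of initial values below needs.\<close>

lemma integral_quartic_pos:
  fixes x :: real
  shows "0 < (\<integral>s. s ^ (2 * n) * exp (- x * s\<^sup>2 - s ^ 4 / 2) \<partial>lborel)"
proof -
  have "0 < exp (- \<bar>x\<bar> * 4 - 8) * measure lborel {1..2::real}" by simp
  also have "\<dots> = (\<integral>s. exp (- \<bar>x\<bar> * 4 - 8) * indicator {1..2::real} s \<partial>lborel)" by simp
  also have "\<dots> \<le> (\<integral>s. s ^ (2 * n) * exp (- x * s\<^sup>2 - s ^ 4 / 2) \<partial>lborel)"
  proof (rule integral_mono[OF _ integrable_quartic_even])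
    show "integrable lborel (\<lambda>s. exp (- \<bar>x\<bar> * 4 - 8) * indicator {1..2::real} s)"
      by (intro integrable_mult_right integrable_real_indicator) auto
    fix s :: real
    show "exp (- \<bar>x\<bar> * 4 - 8) * indicator {1..2} s \<le> s ^ (2 * n) * exp (- x * s\<^sup>2 - s ^ 4 / 2)"
    proof (cases "s \<in> {1..2}")
      case True
      have s2: "s\<^sup>2 \<le> 4" using True power_mono[of s 2 2] by simp
      have s4: "s ^ 4 \<le> 16" using True power_mono[of s 2 4] by simp
      have "x * s\<^sup>2 \<le> \<bar>x\<bar> * s\<^sup>2" by (intro mult_right_mono) auto
      also have "\<dots> \<le> \<bar>x\<bar> * 4" using s2 by (intro mult_left_mono) auto
      finally have "exp (- \<bar>x\<bar> * 4 - 8) \<le> exp (- x * s\<^sup>2 - s ^ 4 / 2)" using s4 by simp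
      moreover have "1 \<le> s ^ (2 * n)" using True by simp
      ultimately show ?thesis using True mult_mono[of 1 "s ^ (2 * n)" "exp (- \<bar>x\<bar> * 4 - 8)" "exp (- x * s\<^sup>2 - s ^ 4 / 2)"]
        by simp
    qed simp
  qed
  finally show ?thesis .
qed

lemma quartic_moment_0_neq_0: "quartic_moment n 0 \<noteq> 0"
  using quartic_moment_of_real[of n 0] integral_quartic_pos[of n 0] by simp

lemma pcf_0: "pcf 0 \<noteq> 0" and pcf'_0: "pcf' 0 \<noteq> 0"
  by (simp_all add: pcf_def pcf'_def quartic_moment_0_neq_0)

section \<open>Asymptotics in the sector of opening \<open>3\<pi>/2\<close>\<close>

lemma cis_power2: "(cis t)\<^sup>2 = cis (2 * t)"
  by (simp add: power2_eq_square cis_mult)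

lemma integrable_gaussian_scaled:
  assumes "c > 0"
  shows "integrable lborel (\<lambda>s::real. exp (- c * s\<^sup>2))"
  using lborel_integrable_real_affine[OF integrable_gaussian, of "sqrt c" 0] assms
  by (simp add: power_mult_distrib)

text \<open>Rotating the real Gaussian integral by \<open>Arg y / 2\<close>, which is less than \<open>\<pi>/4\<close> in modulus, and scaling by
\<open>sqrt |y|\<close> replaces \<open>s\<^sup>2\<close> by \<open>y s\<^sup>2\<close>.\<close>

lemma integral_complex_gaussian:
  assumes y: "Re y > 0"
  shows "integrable lborel (\<lambda>s::real. exp (- y * of_real (s\<^sup>2)))"
    and "(\<integral>s. exp (- y * of_real (s\<^sup>2)) \<partial>lborel) = of_real (sqrt pi) / csqrt y"
proof -
  define \<theta> where "\<theta> = Arg y / 2"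
  define r where "r = sqrt (cmod y)"
  have y0: "y \<noteq> 0" using y by auto
  then have r: "r > 0" "r\<^sup>2 = cmod y" by (auto simp: r_def)
  have arg: "\<bar>Arg y\<bar> < pi / 2"
    using y Arg_Re_pos by blast
  have ypolar: "y = of_real (r\<^sup>2) * cis (2 * \<theta>)"
    using y0 r unfolding \<theta>_def by (metis Arg_eq cis_conv_exp field_sum_of_halves mult_2)
  have csq: "csqrt y = of_real r * cis \<theta>"
  proof (rule csqrt_unique)
    show "(of_real r * cis \<theta>)\<^sup>2 = y"
      by (subst ypolar) (simp add: power_mult_distrib cis_power2)
    show "0 < Re (of_real r * cis \<theta>) \<or> Re (of_real r * cis \<theta>) = 0 \<and> 0 \<le> Im (of_real r * cis \<theta>)"
      using r arg cos_gt_zero_pi[of \<theta>] by (simp add: \<theta>_def)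
  qed
  show "integrable lborel (\<lambda>s::real. exp (- y * of_real (s\<^sup>2)))"
  proof (rule Bochner_Integration.integrable_bound[OF integrable_gaussian_scaled[OF y]])
    have "continuous_on UNIV (\<lambda>s::real. exp (- y * of_real (s\<^sup>2)))"
      by (intro continuous_intros)
    then show "(\<lambda>s::real. exp (- y * of_real (s\<^sup>2))) \<in> borel_measurable lborel"
      using borel_measurable_continuous_onI by simp
  qed simp
  define c where "c = cos (2 * \<theta>)"
  have c: "c > 0" using arg cos_gt_zero_pi[of "2 * \<theta>"] by (simp add: c_def \<theta>_def)
  have "(\<integral>s. exp (- (of_real s)\<^sup>2) \<partial>lborel) = cis \<theta> * (\<integral>s. exp (- (of_real s * cis \<theta>)\<^sup>2) \<partial>lborel)"
  proof (rule integral_rotate_line(2)[where h = "\<lambda>s. exp (- c * s\<^sup>2)"])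
    show "(\<lambda>u. exp (- u\<^sup>2)) holomorphic_on UNIV" by (intro holomorphic_intros)
    show "integrable lborel (\<lambda>s. exp (- c * s\<^sup>2))" by (rule integrable_gaussian_scaled[OF c])
    show "((\<lambda>s. s * exp (- c * s\<^sup>2)) \<longlongrightarrow> 0) at_top" using c by real_asymp
    fix s \<phi> :: real assume "\<phi> \<in> closed_segment 0 \<theta>"
    then have "\<bar>\<phi>\<bar> \<le> \<bar>\<theta>\<bar>" by (auto simp: closed_segment_eq_real_ivl split: if_splits)
    then have "cos (2 * \<bar>\<theta>\<bar>) \<le> cos (2 * \<bar>\<phi>\<bar>)"
      using arg by (intro cos_monotone_0_pi_le) (auto simp: \<theta>_def)
    then have "c \<le> cos (2 * \<phi>)" unfolding c_def by (cases "\<theta> \<ge> 0"; cases "\<phi> \<ge> 0") auto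
    then have "c * s\<^sup>2 \<le> cos (2 * \<phi>) * s\<^sup>2" by (intro mult_right_mono) auto
    then show "cmod (exp (- (of_real s * cis \<phi>)\<^sup>2)) \<le> exp (- c * s\<^sup>2)"
      by (simp add: power_mult_distrib cis_power2 Re_power2 Im_power2 flip: of_real_power) (simp add: mult.commute)
  qed simp
  also have "(\<integral>s. exp (- (of_real s)\<^sup>2) \<partial>lborel) = complex_of_real (sqrt pi)"
    unfolding integral_gaussian[symmetric]
    by (subst integral_complex_of_real[symmetric]) (simp add: exp_of_real[symmetric])
  also have "(\<integral>s. exp (- (of_real s * cis \<theta>)\<^sup>2) \<partial>lborel) = r *\<^sub>R (\<integral>s. exp (- y * of_real (s\<^sup>2)) \<partial>lborel)"
    using r(1) lborel_integral_real_affine[of r "\<lambda>s. exp (- (of_real s * cis \<theta>)\<^sup>2)" 0]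
    by (subst ypolar) (simp add: power_mult_distrib cis_power2 mult_ac)
  finally have "of_real (sqrt pi) = csqrt y * (\<integral>s. exp (- y * of_real (s\<^sup>2)) \<partial>lborel)"
    by (simp add: csq scaleR_conv_of_real mult_ac)
  then show "(\<integral>s. exp (- y * of_real (s\<^sup>2)) \<partial>lborel) = of_real (sqrt pi) / csqrt y"
    using y0 by (simp add: field_simps)
qed

text \<open>The derivative of \<open>exp (- w)\<close> is bounded by 1 on the right half-plane, which is convex; unlike a Taylor bound
this does not grow with \<open>|w|\<close>.\<close>

lemma norm_exp_minus_one_le:
  fixes w :: complex
  assumes "Re w \<ge> 0"
  shows "cmod (exp (- w) - 1) \<le> cmod w"
proof -
  have "cmod (exp (- w) - exp (- 0)) \<le> 1 * cmod (w - 0)"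
  proof (rule field_differentiable_bound[where S = "{z. Re z \<ge> 0}" and f' = "\<lambda>z. - exp (- z)"])
    show "convex {z. 0 \<le> Re z}" by (rule convex_halfspace_Re_ge)
    show "((\<lambda>z. exp (- z)) has_field_derivative - exp (- z)) (at z within {z. 0 \<le> Re z})" for z
      by (auto intro!: derivative_eq_intros)
  qed (use assms in auto)
  then show ?thesis by simp
qed

lemma csqrt_times_cis:
  assumes "y \<noteq> 0" "\<bar>Arg y + 2 * \<theta>\<bar> < pi"
  shows "csqrt (y * cis (2 * \<theta>)) = csqrt y * cis \<theta>"
proof (rule csqrt_unique)
  show "(csqrt y * cis \<theta>)\<^sup>2 = y * cis (2 * \<theta>)"
    by (simp add: power_mult_distrib cis_power2)
  have "csqrt y = of_real (sqrt (cmod y)) * cis (Arg y / 2)"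
    using Arg_eq[of "csqrt y"] assms(1) by (simp add: cis_conv_exp norm_csqrt)
  then have "csqrt y * cis \<theta> = of_real (sqrt (cmod y)) * cis (Arg y / 2 + \<theta>)"
    by (simp add: cis_mult)
  moreover have "cos (Arg y / 2 + \<theta>) > 0"
    using assms(2) by (intro cos_gt_zero_pi) (auto simp: abs_less_iff field_simps)
  ultimately show "0 < Re (csqrt y * cis \<theta>) \<or> Re (csqrt y * cis \<theta>) = 0 \<and> 0 \<le> Im (csqrt y * cis \<theta>)"
    using assms(1) by simp
qed

text \<open>A rotation by less than \<open>\<pi>/8\<close> keeps the real part of \<open>s^4\<close> positive, so the quartic term still ensures
convergence, while the quadratic coefficient \<open>x\<close> is turned by up to \<open>\<pi>/4\<close>.\<close>

lemma quartic_moment_rotate: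
  assumes "\<bar>\<theta>\<bar> < pi / 8"
  shows "integrable lborel (\<lambda>s. exp (- (x * cis (2 * \<theta>)) * of_real (s\<^sup>2) - cis (4 * \<theta>) * of_real (s ^ 4 / 2)))"
    and "quartic_moment 0 x = cis \<theta> *
      (\<integral>s. exp (- (x * cis (2 * \<theta>)) * of_real (s\<^sup>2) - cis (4 * \<theta>) * of_real (s ^ 4 / 2)) \<partial>lborel)"
proof -
  define c where "c = cos (4 * \<theta>) / 2"
  have c: "c > 0" using assms cos_gt_zero_pi[of "4 * \<theta>"] by (simp add: c_def abs_less_iff)
  let ?f = "\<lambda>u. exp (- x * u\<^sup>2 - u ^ 4 / 2)"
  define h where "h = (\<lambda>s::real. exp (cmod x * s\<^sup>2 - c * s ^ 4))"
  have hol: "?f holomorphic_on UNIV" by (intro holomorphic_intros) auto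
  have h1: "integrable lborel h"
    using integrable_quartic[OF c, of 0 "cmod x"] by (simp add: h_def)
  have h2: "h (- s) = h s" for s by (simp add: h_def)
  have h3: "((\<lambda>s. s * h s) \<longlongrightarrow> 0) at_top"
    using c unfolding h_def by real_asymp
  have cis4: "cis t ^ 4 = cis (4 * t)" for t
    using Complex.DeMoivre[of t 4] by simp
  have bound: "cmod (?f (of_real s * cis \<phi>)) \<le> h s" if "\<phi> \<in> closed_segment 0 \<theta>" for s \<phi>
  proof -
    have "\<bar>\<phi>\<bar> \<le> \<bar>\<theta>\<bar>" using that by (auto simp: closed_segment_eq_real_ivl split: if_splits)
    then have "cos (4 * \<bar>\<theta>\<bar>) \<le> cos (4 * \<bar>\<phi>\<bar>)"
      using assms by (intro cos_monotone_0_pi_le) auto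
    then have "2 * c \<le> cos (4 * \<phi>)" unfolding c_def by (cases "\<theta> \<ge> 0"; cases "\<phi> \<ge> 0") auto
    then have "2 * c * s ^ 4 \<le> cos (4 * \<phi>) * s ^ 4" by (intro mult_right_mono) auto
    moreover have "Re ((of_real s * cis \<phi>) ^ 4) = cos (4 * \<phi>) * s ^ 4"
      by (simp add: power_mult_distrib cis4 mult.commute flip: of_real_power)
    moreover have "- Re (x * (of_real s * cis \<phi>)\<^sup>2) \<le> cmod x * s\<^sup>2"
    proof -
      have "- Re (x * (of_real s * cis \<phi>)\<^sup>2) \<le> cmod (x * (of_real s * cis \<phi>)\<^sup>2)"
        using abs_Re_le_cmod abs_le_D2 by blast
      then show ?thesis by (simp add: norm_mult norm_power power_mult_distrib)
    qed
    ultimately show ?thesis by (simp add: h_def)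
  qed
  have e: "?f (of_real s * cis \<theta>) = exp (- (x * cis (2 * \<theta>)) * of_real (s\<^sup>2) - cis (4 * \<theta>) * of_real (s ^ 4 / 2))" for s
    by (simp add: power_mult_distrib cis4 cis_power2 mult_ac)
  show "integrable lborel (\<lambda>s. exp (- (x * cis (2 * \<theta>)) * of_real (s\<^sup>2) - cis (4 * \<theta>) * of_real (s ^ 4 / 2)))"
    using integral_rotate_line(1)[where \<theta> = \<theta>, OF hol bound h1 h2 h3] unfolding e .
  have "quartic_moment 0 x = (\<integral>s. ?f (of_real s) \<partial>lborel)" by (simp add: quartic_moment_def)
  also have "\<dots> = cis \<theta> * (\<integral>s. ?f (of_real s * cis \<theta>) \<partial>lborel)"
    by (rule integral_rotate_line(2)[where \<theta> = \<theta>, OF hol bound h1 h2 h3])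
  finally show "quartic_moment 0 x = cis \<theta> *
      (\<integral>s. exp (- (x * cis (2 * \<theta>)) * of_real (s\<^sup>2) - cis (4 * \<theta>) * of_real (s ^ 4 / 2)) \<partial>lborel)"
    unfolding e .
qed

text \<open>This integral controls the error of replacing \<open>exp (- r\<^sup>2 s\<^sup>2 - s^4 / 2)\<close> by the Gaussian; its decay \<open>r^(-5)\<close>,
against the size \<open>r^(-1)\<close> of the Gaussian integral, makes the relative error \<open>O(r^(-4))\<close>.\<close>

lemma integral_quartic_gaussian_scale:
  fixes r :: real
  assumes r: "r > 0"
  shows "integrable lborel (\<lambda>s. (s ^ 4 / 2) * exp (- (r\<^sup>2 * s\<^sup>2)))"
    and "(\<integral>s. (s ^ 4 / 2) * exp (- (r\<^sup>2 * s\<^sup>2)) \<partial>lborel) = (\<integral>s. (s ^ 4 / 2) * exp (- s\<^sup>2) \<partial>lborel) / r ^ 5"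
proof -
  have int: "integrable lborel (\<lambda>s. (s ^ 4 / 2) * exp (- (s\<^sup>2)) :: real)"
  proof (rule Bochner_Integration.integrable_bound)
    show "integrable lborel (\<lambda>s::real. (fact 4 * exp 9) * exp (- (1/4) * s\<^sup>2))"
      by (intro integrable_mult_right integrable_gaussian_scaled) simp
    show "AE s in lborel. norm (((s::real) ^ 4 / 2) * exp (- s\<^sup>2)) \<le> norm ((fact 4 * exp 9) * exp (- (1/4) * s\<^sup>2))"
    proof (rule AE_I2)
      fix s :: real
      have "s ^ 4 = \<bar>s\<bar> ^ 4" by simp
      also have "\<dots> \<le> fact 4 * exp \<bar>s\<bar>" by (rule power_le_fact_times_exp) simp
      also have "\<dots> \<le> fact 4 * exp (9 + (3/4) * s\<^sup>2)"
      proof -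
        have "0 \<le> (\<bar>s\<bar> - 1)\<^sup>2" by simp
        then have "\<bar>s\<bar> \<le> 1/2 + 1/2 * s\<^sup>2" by (simp add: power2_eq_square algebra_simps)
        also have "\<dots> \<le> 9 + (3/4) * s\<^sup>2" by (intro add_mono mult_right_mono) auto
        finally show ?thesis by simp
      qed
      finally have "s ^ 4 * exp (- s\<^sup>2) \<le> (fact 4 * exp (9 + (3/4) * s\<^sup>2)) * exp (- s\<^sup>2)"
        by (intro mult_right_mono) auto
      also have "\<dots> = (fact 4 * exp 9) * exp (- (1/4) * s\<^sup>2)"
        unfolding mult.assoc exp_add[symmetric] by (simp add: algebra_simps)
      finally have *: "s ^ 4 * exp (- s\<^sup>2) \<le> (fact 4 * exp 9) * exp (- (1/4) * s\<^sup>2)" .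
      have "norm ((s ^ 4 / 2) * exp (- s\<^sup>2)) \<le> s ^ 4 * exp (- s\<^sup>2)" by (simp add: abs_mult)
      also note *
      finally show "norm ((s ^ 4 / 2) * exp (- s\<^sup>2)) \<le> norm ((fact 4 * exp 9) * exp (- (1/4) * s\<^sup>2))"
        by simp
    qed
  qed measurable
  have e: "((0 + r * s) ^ 4 / 2) * exp (- (0 + r * s)\<^sup>2) = r ^ 4 * ((s ^ 4 / 2) * exp (- (r\<^sup>2 * s\<^sup>2)))" for s
    by (simp add: power_mult_distrib)
  have "integrable lborel (\<lambda>s. r ^ 4 * ((s ^ 4 / 2) * exp (- (r\<^sup>2 * s\<^sup>2))))"
    using lborel_integrable_real_affine[OF int, of r 0] r unfolding e by simp
  from integrable_mult_right[OF this, of "1 / r ^ 4"]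
  show "integrable lborel (\<lambda>s. (s ^ 4 / 2) * exp (- (r\<^sup>2 * s\<^sup>2)))"
    using r by simp
  have "(\<integral>s. (s ^ 4 / 2) * exp (- s\<^sup>2) \<partial>lborel) = r * (\<integral>s. r ^ 4 * ((s ^ 4 / 2) * exp (- (r\<^sup>2 * s\<^sup>2))) \<partial>lborel)"
    using lborel_integral_real_affine[of r "\<lambda>s. (s ^ 4 / 2) * exp (- s\<^sup>2)" 0] r unfolding e by simp
  also have "\<dots> = r ^ 5 * (\<integral>s. (s ^ 4 / 2) * exp (- (r\<^sup>2 * s\<^sup>2)) \<partial>lborel)"
    by (simp add: numeral_eq_Suc)
  finally show "(\<integral>s. (s ^ 4 / 2) * exp (- (r\<^sup>2 * s\<^sup>2)) \<partial>lborel) = (\<integral>s. (s ^ 4 / 2) * exp (- s\<^sup>2) \<partial>lborel) / r ^ 5"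
    using r by (simp add: field_simps)
qed

text \<open>After a rotation that brings \<open>x\<close> into the open right half-plane, the integral is a complex Gaussian up to an
error controlled by \<open>|exp (-u) - 1| \<le> |u|\<close> for \<open>Re u \<ge> 0\<close>. The constant depends only on the distance \<open>d\<close> of the
rotated argument from \<open>\<pi>/2\<close>.\<close>

lemma quartic_moment_asymptotic:
  assumes d: "0 < d" "d \<le> pi / 2"
  obtains C where "\<And>x \<theta>. x \<noteq> 0 \<Longrightarrow> \<bar>\<theta>\<bar> < pi / 8 \<Longrightarrow> \<bar>Arg x + 2 * \<theta>\<bar> \<le> pi / 2 - d \<Longrightarrow>
    cmod (csqrt x * quartic_moment 0 x - of_real (sqrt pi)) \<le> C / (cmod x)\<^sup>2"
proof -
  define K :: real where "K = (\<integral>s. (s ^ 4 / 2) * exp (- s\<^sup>2) \<partial>lborel)"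
  define k where "k = sin d"
  have k: "k > 0" using d by (auto simp: k_def intro!: sin_gt_zero)
  show ?thesis
  proof (rule that[of "K / (k\<^sup>2 * sqrt k)"])
    fix x :: complex and \<theta> :: real
    assume x: "x \<noteq> 0" and th: "\<bar>\<theta>\<bar> < pi / 8" and arg: "\<bar>Arg x + 2 * \<theta>\<bar> \<le> pi / 2 - d"
    define y where "y = x * cis (2 * \<theta>)"
    define r where "r = sqrt (k * cmod x)"
    have r: "r > 0" "r\<^sup>2 = k * cmod x" using k x by (auto simp: r_def)
    have "k \<le> cos (Arg x + 2 * \<theta>)"
    proof -
      have "k = cos (pi / 2 - d)" by (simp add: k_def cos_diff)
      also have "\<dots> \<le> cos \<bar>Arg x + 2 * \<theta>\<bar>"
        using arg d by (intro cos_monotone_0_pi_le) auto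
      finally show ?thesis by (simp only: cos_abs_real)
    qed
    moreover have "Re y = cmod x * cos (Arg x + 2 * \<theta>)"
    proof -
      have "y = of_real (cmod x) * cis (Arg x + 2 * \<theta>)"
        using Arg_eq[OF x] unfolding y_def cis_mult[symmetric] by (simp add: cis_conv_exp mult_ac)
      then show ?thesis by simp
    qed
    ultimately have Rey: "r\<^sup>2 \<le> Re y"
      using x r by (simp add: mult.commute)
    then have y: "Re y > 0" using r by (smt (verit) zero_less_power)
    let ?f = "\<lambda>s. exp (- y * of_real (s\<^sup>2) - cis (4 * \<theta>) * of_real (s ^ 4 / 2))"
    let ?g = "\<lambda>s::real. exp (- y * of_real (s\<^sup>2))"
    have intf: "integrable lborel ?f" and rot: "quartic_moment 0 x = cis \<theta> * (\<integral>s. ?f s \<partial>lborel)"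
      using quartic_moment_rotate[OF th, of x] unfolding y_def by auto
    have intg: "integrable lborel ?g" and gauss: "(\<integral>s. ?g s \<partial>lborel) = of_real (sqrt pi) / csqrt y"
      using integral_complex_gaussian[OF y] by auto
    have csq: "csqrt y = csqrt x * cis \<theta>"
      unfolding y_def using x arg d by (intro csqrt_times_cis) auto
    have "cmod (\<integral>s. ?f s - ?g s \<partial>lborel) \<le> (\<integral>s. (s ^ 4 / 2) * exp (- (r\<^sup>2 * s\<^sup>2)) \<partial>lborel)"
    proof (rule Bochner_Integration.integral_norm_bound_integral)
      show "integrable lborel (\<lambda>s. ?f s - ?g s)" using intf intg by (rule Bochner_Integration.integrable_diff)
      show "integrable lborel (\<lambda>s. (s ^ 4 / 2) * exp (- (r\<^sup>2 * s\<^sup>2)))"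
        by (rule integral_quartic_gaussian_scale(1)[OF r(1)])
      fix s :: real
      have "?f s - ?g s = ?g s * (exp (- (cis (4 * \<theta>) * of_real (s ^ 4 / 2))) - 1)"
        by (simp add: exp_add[symmetric] algebra_simps)
      then have "cmod (?f s - ?g s) = exp (- (Re y * s\<^sup>2)) * cmod (exp (- (cis (4 * \<theta>) * of_real (s ^ 4 / 2))) - 1)"
        by (simp add: norm_mult)
      also have "\<dots> \<le> exp (- (r\<^sup>2 * s\<^sup>2)) * (s ^ 4 / 2)"
      proof (rule mult_mono)
        show "exp (- (Re y * s\<^sup>2)) \<le> exp (- (r\<^sup>2 * s\<^sup>2))"
          using Rey by (simp add: mult_right_mono)
        have "cos (4 * \<theta>) > 0" using th cos_gt_zero_pi[of "4 * \<theta>"] by (simp add: abs_less_iff)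
        then have "cmod (exp (- (cis (4 * \<theta>) * of_real (s ^ 4 / 2))) - 1) \<le> cmod (cis (4 * \<theta>) * of_real (s ^ 4 / 2))"
          by (intro norm_exp_minus_one_le) simp
        then show "cmod (exp (- (cis (4 * \<theta>) * of_real (s ^ 4 / 2))) - 1) \<le> s ^ 4 / 2"
          by (simp add: norm_mult norm_power norm_divide)
      qed auto
      finally show "cmod (?f s - ?g s) \<le> (s ^ 4 / 2) * exp (- (r\<^sup>2 * s\<^sup>2))" by (simp only: mult.commute)
    qed
    also have "\<dots> = K / r ^ 5" unfolding K_def by (rule integral_quartic_gaussian_scale(2)[OF r(1)])
    finally have err: "cmod (\<integral>s. ?f s - ?g s \<partial>lborel) \<le> K / r ^ 5" .
    have y0: "csqrt y \<noteq> 0" using y by auto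
    have "csqrt x * quartic_moment 0 x - of_real (sqrt pi) = csqrt y * (\<integral>s. ?f s - ?g s \<partial>lborel)"
      unfolding Bochner_Integration.integral_diff[OF intf intg] gauss rot csq
      using y0 csq by (simp add: field_simps)
    then have "cmod (csqrt x * quartic_moment 0 x - of_real (sqrt pi)) = cmod (csqrt y) * cmod (\<integral>s. ?f s - ?g s \<partial>lborel)"
      by (simp only: norm_mult)
    also have "\<dots> \<le> cmod (csqrt y) * (K / r ^ 5)" using err by (intro mult_left_mono) auto
    also have "cmod (csqrt y) = r / sqrt k"
      using k by (simp add: csq norm_mult norm_csqrt r_def real_sqrt_mult)
    also have "r / sqrt k * (K / r ^ 5) = K / (r\<^sup>2)\<^sup>2 / sqrt k"
      using r(1) by (simp add: field_simps numeral_eq_Suc)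
    also have "\<dots> = K / (k\<^sup>2 * sqrt k) / (cmod x)\<^sup>2"
      unfolding r(2) by (simp add: power_mult_distrib mult_ac)
    finally show "cmod (csqrt x * quartic_moment 0 x - of_real (sqrt pi)) \<le> K / (k\<^sup>2 * sqrt k) / (cmod x)\<^sup>2" .
  qed
qed

section \<open>Characterization of \<open>D\<close> and the connection formula\<close>

lemma pcf_asymptotic:
  assumes "\<delta> > 0"
  shows "((\<lambda>\<eta>. pcf \<eta> / (\<eta> powr (- 1/2) * exp (- \<eta>\<^sup>2 / 4))) \<longlongrightarrow> 1)
    (inf at_infinity (principal {\<eta>. \<bar>Arg \<eta>\<bar> \<le> 3 * pi / 4 - \<delta>}))"
proof -
  define d where "d = min \<delta> (pi / 4)"
  have d: "0 < d" "d \<le> \<delta>" "d \<le> pi / 4" using assms by (auto simp: d_def)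
  obtain C where C: "\<And>x \<theta>. x \<noteq> 0 \<Longrightarrow> \<bar>\<theta>\<bar> < pi / 8 \<Longrightarrow> \<bar>Arg x + 2 * \<theta>\<bar> \<le> pi / 2 - d / 2 \<Longrightarrow>
    cmod (csqrt x * quartic_moment 0 x - of_real (sqrt pi)) \<le> C / (cmod x)\<^sup>2"
    using quartic_moment_asymptotic[of "d / 2"] d by auto
  have bound: "cmod (pcf \<eta> / (\<eta> powr (- 1/2) * exp (- \<eta>\<^sup>2 / 4)) - 1) \<le> C / sqrt pi / (cmod \<eta>)\<^sup>2"
    if \<eta>: "\<eta> \<noteq> 0" "\<bar>Arg \<eta>\<bar> \<le> 3 * pi / 4 - \<delta>" for \<eta>
  proof -
    \<comment> \<open>The largest rotation allowed, less a margin of \<open>d / 4\<close>, in the direction that lowers \<open>|Arg \<eta>|\<close>.\<close>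
    define \<theta> where "\<theta> = (if Arg \<eta> \<ge> 0 then - (pi / 8 - d / 4) else pi / 8 - d / 4)"
    have "\<bar>\<theta>\<bar> < pi / 8" using d pi_gt_zero by (auto simp: \<theta>_def)
    moreover have "\<bar>Arg \<eta> + 2 * \<theta>\<bar> \<le> pi / 2 - d / 2"
      using \<eta> d by (auto simp: \<theta>_def abs_le_iff)
    ultimately have "cmod (csqrt \<eta> * quartic_moment 0 \<eta> - of_real (sqrt pi)) \<le> C / (cmod \<eta>)\<^sup>2"
      using C \<eta> by blast
    then have "cmod (csqrt \<eta> * quartic_moment 0 \<eta> - of_real (sqrt pi)) / sqrt pi \<le> C / (cmod \<eta>)\<^sup>2 / sqrt pi"
      by (intro divide_right_mono) auto
    moreover have "pcf \<eta> / (\<eta> powr (- 1/2) * exp (- \<eta>\<^sup>2 / 4)) - 1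
        = (csqrt \<eta> * quartic_moment 0 \<eta> - of_real (sqrt pi)) / of_real (sqrt pi)"
    proof -
      have "\<eta> powr (- 1/2) = inverse (csqrt \<eta>)"
        using powr_minus[of \<eta> "1/2"] by (simp add: csqrt_conv_powr)
      then show ?thesis
        unfolding pcf_def using \<eta> by (simp add: field_simps)
    qed
    ultimately show ?thesis
      by (simp add: norm_divide mult.commute)
  qed
  show ?thesis
  proof (rule LIM_zero_cancel, rule Lim_null_comparison)
    have "\<forall>\<^sub>F \<eta>::complex in at_infinity. \<eta> \<noteq> 0"
      unfolding eventually_at_infinity by (intro exI[of _ 1]) auto
    then show "\<forall>\<^sub>F \<eta> in inf at_infinity (principal {\<eta>. \<bar>Arg \<eta>\<bar> \<le> 3 * pi / 4 - \<delta>}).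
        cmod (pcf \<eta> / (\<eta> powr (- 1/2) * exp (- \<eta>\<^sup>2 / 4)) - 1) \<le> C / sqrt pi / (cmod \<eta>)\<^sup>2"
      unfolding eventually_inf_principal by eventually_elim (use bound in auto)
    have "filterlim (\<lambda>\<eta>::complex. (cmod \<eta>)\<^sup>2) at_top at_infinity"
      by (intro filterlim_pow_at_top filterlim_norm_at_top) auto
    then have "((\<lambda>\<eta>::complex. C / sqrt pi / (cmod \<eta>)\<^sup>2) \<longlongrightarrow> 0) at_infinity"
      by (intro tendsto_divide_0[OF tendsto_const] filterlim_at_top_imp_at_infinity)
    then show "((\<lambda>\<eta>. C / sqrt pi / (cmod \<eta>)\<^sup>2) \<longlongrightarrow> 0)
        (inf at_infinity (principal {\<eta>. \<bar>Arg \<eta>\<bar> \<le> 3 * pi / 4 - \<delta>}))"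
      by (rule tendsto_mono[OF inf_le1])
  qed
qed

lemma is_parabolic_cylinder_pcf: "is_parabolic_cylinder (- 1/2) pcf"
  unfolding is_parabolic_cylinder_def
proof (intro conjI allI impI)
  show "pcf holomorphic_on UNIV"
    using pcf_has_field_derivative
    by (auto simp: holomorphic_on_def field_differentiable_def intro: has_field_derivative_at_within)
  have "deriv pcf = pcf'"
    using pcf_has_field_derivative by (intro ext DERIV_imp_deriv)
  moreover have "(deriv ^^ 2) pcf = deriv (deriv pcf)" by (simp add: numeral_2_eq_2)
  ultimately have "(deriv ^^ 2) pcf \<eta> = \<eta>\<^sup>2 / 4 * pcf \<eta>" for \<eta>
    using DERIV_imp_deriv[OF pcf'_has_field_derivative] by simp
  then show "(deriv ^^ 2) pcf \<eta> + (- 1/2 + 1/2 - \<eta>\<^sup>2 / 4) * pcf \<eta> = 0" for \<eta>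
    by simp
qed (rule pcf_asymptotic)

text \<open>The equation \<open>D'' = x\<^sup>2 D / 4\<close> is invariant under \<open>x \<mapsto> c x\<close> for fourth roots of unity \<open>c\<close>; this symmetry is special
to the index \<open>-1/2\<close>, for which \<open>\<nu> + 1/2\<close> vanishes.\<close>

lemma pcf_reflect_derivatives:
  assumes "c ^ 4 = 1"
  shows "((\<lambda>x. pcf (c * x)) has_field_derivative c * pcf' (c * x)) (at x)"
    and "((\<lambda>x. c * pcf' (c * x)) has_field_derivative x\<^sup>2 / 4 * pcf (c * x)) (at x)"
proof -
  have c: "((\<lambda>x. c * x) has_field_derivative c) (at x)"
    using DERIV_cmult[OF DERIV_ident, of c] by simp
  show "((\<lambda>x. pcf (c * x)) has_field_derivative c * pcf' (c * x)) (at x)"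
    using DERIV_chain2[OF pcf_has_field_derivative c] by (simp add: mult.commute)
  have "((\<lambda>x. c * pcf' (c * x)) has_field_derivative c * ((c * x)\<^sup>2 / 4 * pcf (c * x) * c)) (at x)"
    by (intro DERIV_cmult DERIV_chain2[OF pcf'_has_field_derivative c])
  also have "c * ((c * x)\<^sup>2 / 4 * pcf (c * x) * c) = c ^ 4 * (x\<^sup>2 / 4 * pcf (c * x))"
    by (simp add: power2_eq_square power4_eq_xxxx)
  finally show "((\<lambda>x. c * pcf' (c * x)) has_field_derivative x\<^sup>2 / 4 * pcf (c * x)) (at x)"
    by (simp add: assms)
qed

text \<open>A solution is determined by its value and derivative at 0, so identities between solutions reduce to two
scalar equations.\<close>

lemma weber_solution_eq:
  assumes U: "\<And>x. (U has_field_derivative U' x) (at x)" "\<And>x. (U' has_field_derivative x\<^sup>2 / 4 * U x) (at x)"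
    and c: "c1 ^ 4 = 1" "c2 ^ 4 = 1"
    and init: "U 0 = (a1 + a2) * pcf 0" "U' 0 = (a1 * c1 + a2 * c2) * pcf' 0"
  shows "U x = a1 * pcf (c1 * x) + a2 * pcf (c2 * x)"
proof -
  let ?W = "\<lambda>x. U x - (a1 * pcf (c1 * x) + a2 * pcf (c2 * x))"
  let ?W' = "\<lambda>x. U' x - (a1 * (c1 * pcf' (c1 * x)) + a2 * (c2 * pcf' (c2 * x)))"
  have "?W x = 0"
  proof (rule linear_ode_unique[where U = ?W and U' = ?W' and V = pcf and V' = pcf' and q = "\<lambda>x. x\<^sup>2 / 4"])
    show "(?W has_field_derivative ?W' x) (at x)" for x
      by (intro DERIV_diff DERIV_add DERIV_cmult U pcf_reflect_derivatives c)
    have "(?W' has_field_derivative x\<^sup>2 / 4 * U x - (a1 * (x\<^sup>2 / 4 * pcf (c1 * x)) + a2 * (x\<^sup>2 / 4 * pcf (c2 * x)))) (at x)" for x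
      by (intro DERIV_diff DERIV_add DERIV_cmult U pcf_reflect_derivatives c)
    moreover have "x\<^sup>2 / 4 * U x - (a1 * (x\<^sup>2 / 4 * pcf (c1 * x)) + a2 * (x\<^sup>2 / 4 * pcf (c2 * x))) = x\<^sup>2 / 4 * ?W x" for x
      by (simp add: algebra_simps)
    ultimately show "(?W' has_field_derivative x\<^sup>2 / 4 * ?W x) (at x)" for x
      by (simp only:)
    show "(pcf has_field_derivative pcf' x) (at x)" "(pcf' has_field_derivative x\<^sup>2 / 4 * pcf x) (at x)" for x
      by (rule pcf_has_field_derivative pcf'_has_field_derivative)+
  qed (use init pcf_0 in \<open>simp_all add: algebra_simps\<close>)
  then show ?thesis by simp
qed

lemma pcf_connection:
  "pcf x = \<i> * pcf (- x) + of_real (sqrt 2) * cis (- pi / 4) * pcf (\<i> * x)"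
proof -
  have c: "of_real (sqrt 2) * cis (- pi / 4) = 1 - \<i>"
    by (simp add: complex_eq_iff cos_45 sin_45)
  have "pcf x = \<i> * pcf ((- 1) * x) + (of_real (sqrt 2) * cis (- pi / 4)) * pcf (\<i> * x)"
    unfolding c by (rule weber_solution_eq[OF pcf_has_field_derivative pcf'_has_field_derivative])
      (simp_all add: algebra_simps power4_eq_xxxx)
  then show ?thesis by simp
qed

lemma parabolic_cylinder_along_reals:
  assumes "is_parabolic_cylinder \<nu> D"
  shows "((\<lambda>x. D (of_real x) / (of_real x powr \<nu> * exp (- (of_real x)\<^sup>2 / 4))) \<longlongrightarrow> 1) at_top"
proof -
  let ?S = "{\<eta>. \<bar>Arg \<eta>\<bar> \<le> 3 * pi / 4 - pi / 4}"
  have "\<forall>\<delta>>0. ((\<lambda>\<eta>. D \<eta> / (\<eta> powr \<nu> * exp (- \<eta>\<^sup>2 / 4))) \<longlongrightarrow> 1)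
      (inf at_infinity (principal {\<eta>. \<bar>Arg \<eta>\<bar> \<le> 3 * pi / 4 - \<delta>}))"
    using assms unfolding is_parabolic_cylinder_def by (elim conjE)
  then have lim: "((\<lambda>\<eta>. D \<eta> / (\<eta> powr \<nu> * exp (- \<eta>\<^sup>2 / 4))) \<longlongrightarrow> 1) (inf at_infinity (principal ?S))"
    by (elim allE[of _ "pi / 4"]) simp
  have "filterlim complex_of_real (principal ?S) at_top"
    unfolding filterlim_principal using eventually_gt_at_top[of 0] by eventually_elim auto
  then have "filterlim complex_of_real (inf at_infinity (principal ?S)) at_top"
    unfolding filterlim_inf using filterlim_of_real_at_infinity by blast
  from filterlim_compose[OF lim this] show ?thesis .
qed

text \<open>The bound from below that shows \<open>pcf (- x)\<close> to be larger than \<open>x^(-1/2) exp (- x\<^sup>2 / 4)\<close> by an unbounded factor.\<close>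

lemma quartic_moment_growth:
  assumes "x \<ge> 0"
  shows "cmod (quartic_moment 0 0) \<le> cmod (quartic_moment 0 (- of_real x))"
proof -
  have "(\<integral>s. s ^ (2 * 0) * exp (- (0::real) * s\<^sup>2 - s ^ 4 / 2) \<partial>lborel) \<le> (\<integral>s. s ^ (2 * 0) * exp (- (- x) * s\<^sup>2 - s ^ 4 / 2) \<partial>lborel)"
    by (rule integral_mono[OF integrable_quartic_even integrable_quartic_even]) (use assms in simp)
  moreover have "0 < (\<integral>s. s ^ (2 * 0) * exp (- (0::real) * s\<^sup>2 - s ^ 4 / 2) \<partial>lborel)"
    by (rule integral_quartic_pos)
  ultimately show ?thesis
    using quartic_moment_of_real[of 0 0] quartic_moment_of_real[of 0 "- x"] by simp
qed

text \<open>Any other candidate is \<open>a pcf x + b pcf (- x)\<close>. Along the positive axis its quotient by \<open>x^(-1/2) exp (- x\<^sup>2 / 4)\<close>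
tends to 1, as for \<open>pcf x\<close>, while that of \<open>pcf (- x)\<close> is unbounded; this forces \<open>b = 0\<close> and then \<open>a = 1\<close>.\<close>

lemma parabolic_cylinder_D_eq_pcf: "parabolic_cylinder_D (- 1/2) = pcf"
  unfolding parabolic_cylinder_D_def
proof (rule the_equality)
  show "is_parabolic_cylinder (- 1/2) pcf" by (rule is_parabolic_cylinder_pcf)
  fix D assume D: "is_parabolic_cylinder (- 1/2) D"
  then have hol: "D holomorphic_on UNIV" by (simp add: is_parabolic_cylinder_def)
  then have hol': "deriv D holomorphic_on UNIV" by (rule holomorphic_deriv) auto
  have D1: "(D has_field_derivative deriv D x) (at x)" for x
    using holomorphic_derivI[OF hol] by auto
  have D2: "(deriv D has_field_derivative x\<^sup>2 / 4 * D x) (at x)" for x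
  proof -
    have "deriv (deriv D) x = x\<^sup>2 / 4 * D x"
      using D by (simp add: is_parabolic_cylinder_def numeral_2_eq_2)
    then show ?thesis using holomorphic_derivI[OF hol' open_UNIV UNIV_I, of x UNIV] by (simp only:)
  qed
  define p q where "p = D 0 / pcf 0" and "q = deriv D 0 / pcf' 0"
  then have init: "D 0 = p * pcf 0" "deriv D 0 = q * pcf' 0" by (simp_all add: pcf_0 pcf'_0)
  define a b where "a = (p + q) / 2" and "b = (p - q) / 2"
  have ab: "a + b = p" "a - b = q" by (simp_all add: a_def b_def field_simps)
  have comb: "D x = a * pcf x + b * pcf (- x)" for x
  proof -
    have "D x = a * pcf (1 * x) + b * pcf ((- 1) * x)"
      by (rule weber_solution_eq[OF D1 D2]) (simp_all add: init ab)
    then show ?thesis by simp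
  qed
  let ?\<phi> = "\<lambda>x::real. of_real x powr (- 1/2) * exp (- (of_real x)\<^sup>2 / 4) :: complex"
  have lim: "((\<lambda>x. b * (pcf (- of_real x) / ?\<phi> x)) \<longlongrightarrow> 1 - a * 1) at_top"
  proof -
    have "((\<lambda>x. D (of_real x) / ?\<phi> x - a * (pcf (of_real x) / ?\<phi> x)) \<longlongrightarrow> 1 - a * 1) at_top"
      by (intro tendsto_diff tendsto_mult tendsto_const parabolic_cylinder_along_reals
          D is_parabolic_cylinder_pcf)
    moreover have "D (of_real x) / ?\<phi> x - a * (pcf (of_real x) / ?\<phi> x) = b * (pcf (- of_real x) / ?\<phi> x)" for x
      unfolding comb by (simp only: add_divide_distrib times_divide_eq_right add_diff_cancel_left')
    ultimately show ?thesis by (simp only:)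
  qed
  have grow: "filterlim (\<lambda>x. cmod (pcf (- of_real x) / ?\<phi> x)) at_top at_top"
  proof (rule filterlim_at_top_mono)
    show "filterlim (\<lambda>x. cmod (quartic_moment 0 0) / sqrt pi * sqrt x) at_top at_top"
      by (intro filterlim_tendsto_pos_mult_at_top[OF tendsto_const] sqrt_at_top) (simp add: quartic_moment_0_neq_0)
    show "\<forall>\<^sub>F x in at_top. cmod (quartic_moment 0 0) / sqrt pi * sqrt x \<le> cmod (pcf (- of_real x) / ?\<phi> x)"
      using eventually_gt_at_top[of 0]
    proof eventually_elim
      case (elim x)
      have "of_real x powr (- 1/2) = inverse (csqrt (of_real x))"
        using powr_minus[of "of_real x :: complex" "1/2"] by (simp add: csqrt_conv_powr)
      then have "pcf (- of_real x) / ?\<phi> x = quartic_moment 0 (- of_real x) / of_real (sqrt pi) * csqrt (of_real x)"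
        using elim unfolding pcf_def by (simp add: field_simps)
      then show ?case
        using quartic_moment_growth[of x] elim
        by (simp add: norm_mult norm_divide divide_right_mono mult_right_mono)
    qed
  qed
  have "b = 0"
  proof (rule ccontr)
    assume "b \<noteq> 0"
    then have "filterlim (\<lambda>x. cmod (b * (pcf (- of_real x) / ?\<phi> x))) at_top at_top"
      unfolding norm_mult by (intro filterlim_tendsto_pos_mult_at_top[OF tendsto_const _ grow]) auto
    moreover have "((\<lambda>x. cmod (b * (pcf (- of_real x) / ?\<phi> x))) \<longlongrightarrow> cmod (1 - a * 1)) at_top"
      by (rule tendsto_norm[OF lim])
    ultimately show False
      using not_tendsto_and_filterlim_at_infinity[OF trivial_limit_at_top_linorder]
        filterlim_at_top_imp_at_infinity by blast
  qed
  moreover have "a = 1"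
    using lim unfolding \<open>b = 0\<close> by (simp add: tendsto_const_iff)
  ultimately show "D = pcf" using comb by auto
qed

section \<open>An Euler integral for the Jacobi polynomials\<close>

lemma integrable_on_interval:
  fixes f :: "real \<Rightarrow> complex"
  assumes "continuous_on {a..b} f"
  shows "integrable lborel (\<lambda>s. indicator {a..b} s *\<^sub>R f s)"
  using borel_integrable_compact[OF compact_Icc assms] .

lemma half_integer_pochhammer_neq_0: "pochhammer (of_nat k + 1/2 :: complex) n \<noteq> 0"
proof -
  have "pochhammer (of_nat k + 1/2 :: complex) n = of_real (pochhammer (real k + 1/2) n)"
    by (simp flip: pochhammer_of_real)
  moreover have "pochhammer (real k + 1/2) n > 0" by (rule pochhammer_pos) simp
  ultimately show ?thesis by simp
qed

text \<open>The beta function \<open>B(k + 1/2, m + 1)\<close>, after \<open>t = s\<^sup>2\<close>. Multiplying the integrand by \<open>1 - s\<^sup>2\<close> gives the recursion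
\<open>I k (m + 1) = I k m - I (k + 1) m\<close>, which the closed form satisfies.\<close>

lemma beta_integral:
  "(\<integral>s. indicator {-1..1} s *\<^sub>R complex_of_real (s ^ (2 * k) * (1 - s\<^sup>2) ^ m) \<partial>lborel)
     = fact m / pochhammer (of_nat k + 1/2) (Suc m)"
proof (induction m arbitrary: k)
  case 0
  let ?F = "\<lambda>s::real. complex_of_real (s ^ Suc (2 * k) / (2 * k + 1))"
  have "(\<integral>s. indicator {-1..1} s *\<^sub>R complex_of_real (s ^ (2 * k)) \<partial>lborel) = ?F 1 - ?F (- 1)"
  proof (rule integral_FTC_atLeastAtMost)
    fix s :: real
    have "((\<lambda>s. s ^ Suc (2 * k) / (2 * k + 1)) has_real_derivative s ^ (2 * k)) (at s within {-1..1})"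
      using DERIV_cdivide[OF DERIV_pow[of "Suc (2 * k)" s], of "2 * k + 1"]
      by (simp add: nonzero_eq_divide_eq add_ac)
    then show "(?F has_vector_derivative complex_of_real (s ^ (2 * k))) (at s within {-1..1})"
      by (rule has_vector_derivative_of_real)
  next
    show "continuous_on {-1..1} (\<lambda>s::real. complex_of_real (s ^ (2 * k)))" by (intro continuous_intros)
  qed simp
  also have "\<dots> = 1 / (of_nat k + 1/2)"
    by (simp add: complex_eq_iff field_simps)
  finally show ?case by simp
next
  case (Suc m)
  let ?g = "\<lambda>k m s. indicator {-1..1::real} s *\<^sub>R complex_of_real (s ^ (2 * k) * (1 - s\<^sup>2) ^ m)"
  have int: "integrable lborel (?g k m)" for k m
    by (intro integrable_on_interval continuous_intros)
  have split: "?g k (Suc m) = (\<lambda>s. ?g k m s - ?g (Suc k) m s)"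
    by (rule ext) (simp add: algebra_simps power2_eq_square scaleR_conv_of_real)
  have "(\<integral>s. ?g k (Suc m) s \<partial>lborel) = (\<integral>s. ?g k m s \<partial>lborel) - (\<integral>s. ?g (Suc k) m s \<partial>lborel)"
    unfolding split by (rule Bochner_Integration.integral_diff[OF int int])
  also have "\<dots> = fact m / pochhammer (of_nat k + 1/2) (Suc m) - fact m / pochhammer (of_nat (Suc k) + 1/2) (Suc m)"
    unfolding Suc.IH ..
  also have "\<dots> = fact (Suc m) / pochhammer (of_nat k + 1/2) (Suc (Suc m))"
  proof -
    define a where "a = (of_nat k + 1/2 :: complex)"
    have 1: "pochhammer a (Suc (Suc m)) = (a + of_nat (Suc m)) * pochhammer a (Suc m)"
      by (rule pochhammer_rec')
    have 2: "pochhammer a (Suc (Suc m)) = a * pochhammer (a + 1) (Suc m)"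
      by (rule pochhammer_rec)
    have nz: "pochhammer a (Suc (Suc m)) \<noteq> 0" "pochhammer a (Suc m) \<noteq> 0" "pochhammer (a + 1) (Suc m) \<noteq> 0"
      using half_integer_pochhammer_neq_0[of k] half_integer_pochhammer_neq_0[of "Suc k"]
      unfolding a_def by (simp_all add: add_ac del: pochhammer_Suc)
    have "fact m / pochhammer a (Suc m) = fact m * (a + of_nat (Suc m)) / pochhammer a (Suc (Suc m))"
      using nz unfolding 1 by (simp add: field_simps)
    moreover have "fact m / pochhammer (a + 1) (Suc m) = fact m * a / pochhammer a (Suc (Suc m))"
      using nz unfolding 2 by (simp add: field_simps)
    ultimately have "fact m / pochhammer a (Suc m) - fact m / pochhammer (a + 1) (Suc m)
        = (fact m * (a + of_nat (Suc m)) - fact m * a) / pochhammer a (Suc (Suc m))"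
      by (simp only: diff_divide_distrib)
    then show ?thesis unfolding a_def by (simp add: algebra_simps)
  qed
  finally show ?case .
qed

definition euler_const :: "nat \<Rightarrow> real" where
  "euler_const m = pochhammer (1/2) (2 * m + 1) / fact (2 * m)"

text \<open>Coefficientwise form of Euler's integral: \<open>(1/2)\<^sub>2\<^sub>m\<^sub>+\<^sub>1\<close> splits as
\<open>(1/2)\<^sub>k (k + 1/2)\<^sub>m\<^sub>+\<^sub>1 (k + m + 3/2)\<^sub>m\<^sub>-\<^sub>k\<close>; the outer factors give the coefficient of the polynomial and the middle
one the beta integral.\<close>

lemma jacobi_coefficient:
  assumes "k \<le> m"
  shows "((2 * of_nat m + 1/2) gchoose (m - k)) * (pochhammer (1/2) k / fact k) / of_nat ((2 * m) choose m)
    = complex_of_real (euler_const m) * (of_nat (m choose k) * (fact m / pochhammer (of_nat k + 1/2) (Suc m)))"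
proof -
  have g: "((2 * of_nat m + 1/2 :: complex) gchoose (m - k)) = pochhammer (of_nat (k + Suc m) + 1/2) (m - k) / fact (m - k)"
  proof -
    have "(2 * of_nat m + 1/2 :: complex) - of_nat (m - k) + 1 = of_nat (k + Suc m) + 1/2"
      using assms by (simp add: of_nat_diff)
    then show ?thesis unfolding gbinomial_pochhammer' by (simp only:)
  qed
  have e: "complex_of_real (euler_const m) = pochhammer (1/2) (2 * m + 1) / fact (2 * m)"
    unfolding euler_const_def using pochhammer_of_real[of "1/2", where 'a = complex] by simp
  have "2 * m + 1 = k + (Suc m + (m - k))" using assms by simp
  then have p: "pochhammer (1/2 :: complex) (2 * m + 1)
      = pochhammer (1/2) k * (pochhammer (of_nat k + 1/2) (Suc m) * pochhammer (of_nat (k + Suc m) + 1/2) (m - k))"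
    by (simp only: pochhammer_product') (simp add: add_ac del: pochhammer_Suc)
  have b: "of_nat ((2 * m) choose m) = (fact (2 * m) / (fact m * fact m) :: complex)"
    using binomial_fact[of m "2 * m", where 'a = complex] by (simp add: mult_2)
  show ?thesis
    unfolding g e p b binomial_fact[OF assms]
    using half_integer_pochhammer_neq_0[of k "Suc m"] by (simp add: field_simps del: pochhammer_Suc)
qed

text \<open>Dividing the defining sum by \<open>(1 + z)^m\<close> leaves a polynomial in \<open>w\<close>, namely a multiple of the hypergeometric
function with parameters \<open>-m, 1/2; m + 3/2\<close> at \<open>-w\<close>. In its Euler integral the two exponents coincide, because
\<open>(m + 3/2) - 1/2 - 1 = m\<close>.\<close>

lemma monic_pi_eq_integral:
  assumes "z \<noteq> - 1"
  defines "w \<equiv> (1 - z) / (1 + z)"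
  shows "monic_pi m z = (1 + z) ^ m * (of_real (euler_const m) *
    (\<integral>s. indicator {-1..1} s *\<^sub>R ((1 - of_real (s\<^sup>2)) * (1 + w * of_real (s\<^sup>2))) ^ m \<partial>lborel))"
proof -
  have z1: "1 + z \<noteq> 0" using assms by (simp add: add_eq_0_iff)
  let ?c = "\<lambda>k. fact m / pochhammer (of_nat k + 1/2 :: complex) (Suc m)"
  let ?f = "\<lambda>k s. indicator {-1..1::real} s *\<^sub>R complex_of_real (s ^ (2 * k) * (1 - s\<^sup>2) ^ m)"
  have int: "integrable lborel (?f k)" for k
    by (intro integrable_on_interval continuous_intros)
  have "(\<integral>s. indicator {-1..1} s *\<^sub>R ((1 - of_real (s\<^sup>2)) * (1 + w * of_real (s\<^sup>2))) ^ m \<partial>lborel)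
      = (\<integral>s. (\<Sum>k\<le>m. (of_nat (m choose k) * w ^ k) * ?f k s) \<partial>lborel)"
  proof (rule Bochner_Integration.integral_cong[OF refl])
    fix s :: real
    have "(1 + w * of_real (s\<^sup>2)) ^ m = (\<Sum>k\<le>m. of_nat (m choose k) * (w * of_real (s\<^sup>2)) ^ k)"
      using binomial_ring[of "w * of_real (s\<^sup>2)" 1 m] by (simp add: add.commute)
    moreover have "complex_of_real (s ^ (2 * k) * (1 - s\<^sup>2) ^ m) = of_real (s\<^sup>2) ^ k * (1 - of_real (s\<^sup>2)) ^ m" for k
      by (simp only: power_mult of_real_mult of_real_power of_real_diff of_real_1)
    ultimately have "((1 - of_real (s\<^sup>2)) * (1 + w * of_real (s\<^sup>2))) ^ m
        = (\<Sum>k\<le>m. (of_nat (m choose k) * w ^ k) * complex_of_real (s ^ (2 * k) * (1 - s\<^sup>2) ^ m))"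
      by (simp only: power_mult_distrib sum_distrib_left mult_ac)
    then show "indicator {-1..1} s *\<^sub>R ((1 - of_real (s\<^sup>2)) * (1 + w * of_real (s\<^sup>2))) ^ m
        = (\<Sum>k\<le>m. (of_nat (m choose k) * w ^ k) * ?f k s)"
      by (simp add: scaleR_sum_right)
  qed
  also have "\<dots> = (\<Sum>k\<le>m. (of_nat (m choose k) * w ^ k) * ?c k)"
    by (subst Bochner_Integration.integral_sum)
      (simp_all only: integrable_mult_right int integral_mult_right_zero beta_integral)
  finally have I: "(\<integral>s. indicator {-1..1} s *\<^sub>R ((1 - of_real (s\<^sup>2)) * (1 + w * of_real (s\<^sup>2))) ^ m \<partial>lborel)
      = (\<Sum>k\<le>m. (of_nat (m choose k) * w ^ k) * ?c k)" .
  let ?J = "\<lambda>k. ((2 * of_nat m + 1/2) gchoose (m - k)) * (pochhammer (1/2) k / fact k) :: complex"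
  have term_eq: "((2 * of_nat m + 1/2) gchoose (m - k)) * ((- 1/2) gchoose k) * (z - 1) ^ k * (z + 1) ^ (m - k)
      = (1 + z) ^ m * (?J k * w ^ k)" if "k \<le> m" for k
  proof -
    let ?G = "(2 * of_nat m + 1/2 :: complex) gchoose (m - k)"
    have 1: "(1 + z) ^ (m - k) * (1 + z) ^ k = (1 + z) ^ m"
      using that by (simp flip: power_add)
    have 2: "(1 - z) ^ k = (1 + z) ^ k * w ^ k"
      unfolding w_def power_mult_distrib[symmetric] using z1 by simp
    have 3: "((- 1/2 :: complex) gchoose k) * (z - 1) ^ k = pochhammer (1/2) k / fact k * (1 - z) ^ k"
    proof -
      have "(z - 1) ^ k = (- 1) ^ k * (1 - z) ^ k"
        using power_minus[of "1 - z" k] by simp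
      moreover have "(- 1) ^ k * (- 1) ^ k = (1 :: complex)"
        by (simp flip: power_mult_distrib)
      ultimately show ?thesis
        unfolding gbinomial_pochhammer by (simp add: mult_ac)
    qed
    have "?G * ((- 1/2) gchoose k) * (z - 1) ^ k * (z + 1) ^ (m - k)
        = ?G * (((- 1/2) gchoose k) * (z - 1) ^ k) * (1 + z) ^ (m - k)"
      by (simp only: mult.assoc add.commute[of z 1])
    also have "\<dots> = ((1 + z) ^ (m - k) * (1 + z) ^ k) * (?J k * w ^ k)"
      unfolding 3 2 by (simp only: mult_ac)
    finally show ?thesis unfolding 1 .
  qed
  have "(\<Sum>k = 0..m. ((2 * of_nat m + 1/2) gchoose (m - k)) * ((- 1/2) gchoose k) * (z - 1) ^ k * (z + 1) ^ (m - k))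
      = (\<Sum>k\<le>m. (1 + z) ^ m * (?J k * w ^ k))"
    unfolding atMost_atLeast0 by (rule sum.cong[OF refl]) (rule term_eq, simp)
  then have "monic_pi m z = (\<Sum>k\<le>m. (1 + z) ^ m * (?J k * w ^ k)) / of_nat ((2 * m) choose m)"
    unfolding monic_pi_def jacobi_P_def lead_kappa_def by simp
  also have "\<dots> = (1 + z) ^ m * (\<Sum>k\<le>m. (?J k / of_nat ((2 * m) choose m)) * w ^ k)"
    by (simp only: sum_distrib_left sum_divide_distrib times_divide_eq_right times_divide_eq_left mult_ac)
  also have "(\<Sum>k\<le>m. (?J k / of_nat ((2 * m) choose m)) * w ^ k)
      = (\<Sum>k\<le>m. of_real (euler_const m) * ((of_nat (m choose k) * w ^ k) * ?c k))"
  proof (rule sum.cong[OF refl])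
    fix k assume "k \<in> {..m}"
    then have "k \<le> m" by simp
    then show "?J k / of_nat ((2 * m) choose m) * w ^ k
        = of_real (euler_const m) * ((of_nat (m choose k) * w ^ k) * ?c k)"
      by (simp only: jacobi_coefficient) (simp only: mult_ac)
  qed
  also have "\<dots> = of_real (euler_const m) * (\<Sum>k\<le>m. (of_nat (m choose k) * w ^ k) * ?c k)"
    by (simp only: sum_distrib_left)
  finally show ?thesis unfolding I .
qed

lemma divide_le_divide_cross:
  fixes a b c d :: real
  assumes "a * d \<le> c * b" "b > 0" "d > 0"
  shows "a / b \<le> c / d"
  using assms by (subst pos_divide_le_eq) (simp_all add: pos_le_divide_eq)

text \<open>The quotients \<open>p\<^sup>2 / (n + 1/2)\<close> and \<open>p\<^sup>2 / (n + 1)\<close> are monotone in opposite directions and have the common limit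
\<open>1 / \<pi>\<close>, by the product formula for \<open>\<Gamma>(1/2)\<close>. This yields a rate, which the limit alone does not.\<close>

lemma half_pochhammer_bounds:
  fixes n :: nat
  defines "p \<equiv> pochhammer (1/2 :: real) (Suc n) / fact n"
  shows "(real n + 1/2) / pi \<le> p\<^sup>2" "p\<^sup>2 \<le> (real n + 1) / pi"
proof -
  define q where "q n = pochhammer (1/2 :: real) (Suc n) / fact n" for n
  have q_pos: "q n > 0" for n unfolding q_def by (intro divide_pos_pos pochhammer_pos) auto
  have q_Suc: "q (Suc n) = q n * ((real n + 3/2) / (real n + 1))" for n
    unfolding q_def pochhammer_rec'[of _ "Suc n"] by (simp add: field_simps del: pochhammer_Suc)
  \<comment> \<open>\<open>q n / sqrt n\<close> is the partial product for \<open>1 / \<Gamma>(1/2)\<close>.\<close>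
  have "(\<lambda>n. q n / sqrt n) \<longlonglongrightarrow> 1 / sqrt pi"
  proof (rule Lim_transform_eventually)
    show "rGamma_series (1/2) \<longlonglongrightarrow> 1 / sqrt pi"
      using rGamma_series_LIMSEQ[of "1/2 :: real"] by (simp add: rGamma_inverse_Gamma Gamma_one_half_real inverse_eq_divide)
    show "\<forall>\<^sub>F n in sequentially. rGamma_series (1/2) n = q n / sqrt n"
      using eventually_gt_at_top[of 0]
      by eventually_elim (simp add: rGamma_series_def q_def ln_sqrt[symmetric] del: pochhammer_Suc)
  qed
  from tendsto_power[OF this, of 2] have lim: "(\<lambda>n. (q n)\<^sup>2 / n) \<longlonglongrightarrow> 1 / pi"
    by (simp add: power_divide)
  have r1: "(\<lambda>n. real n / (real n + 1/2)) \<longlonglongrightarrow> 1" and r2: "(\<lambda>n. real n / (real n + 1)) \<longlonglongrightarrow> 1"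
    by real_asymp+
  have l1: "(\<lambda>n. (q n)\<^sup>2 / (real n + 1/2)) \<longlonglongrightarrow> 1 / pi"
  proof (rule Lim_transform_eventually)
    show "(\<lambda>n. (q n)\<^sup>2 / n * (real n / (real n + 1/2))) \<longlonglongrightarrow> 1 / pi"
      using tendsto_mult[OF lim r1] by simp
    show "\<forall>\<^sub>F n in sequentially. (q n)\<^sup>2 / n * (real n / (real n + 1/2)) = (q n)\<^sup>2 / (real n + 1/2)"
      using eventually_gt_at_top[of 0] by eventually_elim simp
  qed
  have l2: "(\<lambda>n. (q n)\<^sup>2 / (real n + 1)) \<longlonglongrightarrow> 1 / pi"
  proof (rule Lim_transform_eventually)
    show "(\<lambda>n. (q n)\<^sup>2 / n * (real n / (real n + 1))) \<longlonglongrightarrow> 1 / pi"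
      using tendsto_mult[OF lim r2] by simp
    show "\<forall>\<^sub>F n in sequentially. (q n)\<^sup>2 / n * (real n / (real n + 1)) = (q n)\<^sup>2 / (real n + 1)"
      using eventually_gt_at_top[of 0] by eventually_elim simp
  qed
  have "decseq (\<lambda>n. (q n)\<^sup>2 / (real n + 1/2))"
  proof (rule decseq_SucI)
    fix n :: nat
    define x where "x = real n"
    have x: "x \<ge> 0" by (simp add: x_def)
    have "(q (Suc n))\<^sup>2 / (real (Suc n) + 1/2) = (q n * ((x + 3/2) / (x + 1)))\<^sup>2 / (x + 3/2)"
      unfolding q_Suc x_def by (simp add: add_ac)
    also have "\<dots> = (q n)\<^sup>2 * ((x + 3/2) / (x + 1)\<^sup>2)"
      using x by (simp add: power2_eq_square)
    also have "(x + 3/2) / (x + 1)\<^sup>2 \<le> 1 / (x + 1/2)"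
    proof -
      have "(x + 1)\<^sup>2 - (x + 3/2) * (x + 1/2) = 1/4" by (simp add: power2_eq_square field_simps)
      then have "(x + 3/2) * (x + 1/2) \<le> 1 * (x + 1)\<^sup>2" by linarith
      then show ?thesis using x by (intro divide_le_divide_cross) simp_all
    qed
    finally show "(q (Suc n))\<^sup>2 / (real (Suc n) + 1/2) \<le> (q n)\<^sup>2 / (real n + 1/2)"
      by (simp add: mult_left_mono x_def)
  qed
  from decseq_ge[OF this l1, of n] show "(real n + 1/2) / pi \<le> p\<^sup>2"
    unfolding p_def q_def by (simp add: pos_le_divide_eq pos_divide_le_eq mult.commute del: pochhammer_Suc)
  have "incseq (\<lambda>n. (q n)\<^sup>2 / (real n + 1))"
  proof (rule incseq_SucI)
    fix n :: nat
    define x where "x = real n"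
    have x: "x \<ge> 0" by (simp add: x_def)
    have "(q n)\<^sup>2 / (real n + 1) = (q n)\<^sup>2 * (1 / (x + 1))" by (simp add: x_def)
    also have "\<dots> \<le> (q n)\<^sup>2 * ((x + 3/2)\<^sup>2 / ((x + 1)\<^sup>2 * (x + 2)))"
    proof (rule mult_left_mono)
      have "(x + 3/2)\<^sup>2 - (x + 1) * (x + 2) = 1/4" by (simp add: power2_eq_square field_simps)
      then have "(x + 1) * (x + 2) \<le> (x + 3/2)\<^sup>2" by linarith
      then have "(x + 1) * (x + 2) / ((x + 1)\<^sup>2 * (x + 2)) \<le> (x + 3/2)\<^sup>2 / ((x + 1)\<^sup>2 * (x + 2))"
        by (rule divide_right_mono) (use x in simp)
      then show "1 / (x + 1) \<le> (x + 3/2)\<^sup>2 / ((x + 1)\<^sup>2 * (x + 2))"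
        using x by (simp add: power2_eq_square)
    qed simp
    also have "\<dots> = (q n * ((x + 3/2) / (x + 1)))\<^sup>2 / (x + 2)"
      by (simp add: power_mult_distrib power_divide)
    also have "\<dots> = (q (Suc n))\<^sup>2 / (real (Suc n) + 1)"
      unfolding q_Suc x_def by (simp add: add_ac)
    finally show "(q n)\<^sup>2 / (real n + 1) \<le> (q (Suc n))\<^sup>2 / (real (Suc n) + 1)" .
  qed
  from incseq_le[OF this l2, of n] show "p\<^sup>2 \<le> (real n + 1) / pi"
    unfolding p_def q_def by (simp add: pos_le_divide_eq pos_divide_le_eq mult.commute del: pochhammer_Suc)
qed

lemma euler_const_asymptotic:
  assumes "m \<ge> 1"
  shows "\<bar>euler_const m / sqrt (2 * real m) - 1 / sqrt pi\<bar> \<le> 1 / (2 * real m)"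
    and "\<bar>euler_const m / sqrt (2 * real m)\<bar> \<le> 1"
proof -
  define n where "n = 2 * m"
  have n: "real n \<ge> 2" using assms by (simp add: n_def)
  define e where "e = euler_const m / sqrt n"
  have pos: "euler_const m > 0"
    unfolding euler_const_def by (intro divide_pos_pos pochhammer_pos) auto
  then have e_pos: "e > 0" using n by (simp add: e_def)
  have sq: "e\<^sup>2 = (euler_const m)\<^sup>2 / n" using n by (simp add: e_def power_divide)
  have lo: "(1 / sqrt pi)\<^sup>2 \<le> e\<^sup>2"
  proof -
    have "1 / pi = n / pi / n" using n by simp
    also have "\<dots> \<le> (real n + 1/2) / pi / n" using n by (intro divide_right_mono) auto
    also have "\<dots> \<le> (euler_const m)\<^sup>2 / n"
      using half_pochhammer_bounds(1)[of n] by (intro divide_right_mono) (auto simp: euler_const_def n_def)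
    finally show ?thesis by (simp add: sq power_divide)
  qed
  have hi: "e\<^sup>2 \<le> ((1 + 1 / n) / sqrt pi)\<^sup>2"
  proof -
    have "e\<^sup>2 \<le> (real n + 1) / pi / n"
      unfolding sq using half_pochhammer_bounds(2)[of n]
      by (intro divide_right_mono) (auto simp: euler_const_def n_def)
    also have "\<dots> = (1 + 1 / n) / pi" using n by (simp add: field_simps)
    also have "\<dots> \<le> (1 + 1 / n)\<^sup>2 / pi"
      by (intro divide_right_mono self_le_power) auto
    finally show ?thesis by (simp add: power_divide)
  qed
  have lo': "1 / sqrt pi \<le> e" using e_pos by (intro power2_le_imp_le[OF lo]) simp
  have hi': "e \<le> (1 + 1 / n) / sqrt pi" by (rule power2_le_imp_le[OF hi]) simp
  have sp: "sqrt pi > 3/2"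
    using pi_gt3 by (intro real_less_rsqrt) (auto simp: power2_eq_square)
  then have "1 / n / sqrt pi \<le> 1 / n" using n pi_gt3 by (simp add: field_simps)
  then have 1: "\<bar>e - 1 / sqrt pi\<bar> \<le> 1 / n" using lo' hi' by (simp add: add_divide_distrib)
  show "\<bar>euler_const m / sqrt (2 * real m) - 1 / sqrt pi\<bar> \<le> 1 / (2 * real m)"
    using 1 by (simp add: e_def n_def)
  have "(1 + 1 / n) / sqrt pi \<le> (1 + 1 / 2) / sqrt pi"
    using n by (intro divide_right_mono add_mono) (auto simp: field_simps)
  also have "\<dots> \<le> 1" using sp by (simp add: field_simps)
  finally have "\<bar>e\<bar> \<le> 1" using hi' e_pos by linarith
  then show "\<bar>euler_const m / sqrt (2 * real m)\<bar> \<le> 1" by (simp add: e_def n_def)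
qed

section \<open>Laplace's method with an error bound\<close>

text \<open>Comparison of the bases before they are raised to the power \<open>m\<close>. Both agree with \<open>1 - 2 \<zeta> t - t\<^sup>2\<close> up to terms
that stay of order \<open>1/N\<close> after multiplication by \<open>m\<close>, when \<open>\<zeta> = O(1/N)\<close> and \<open>t = v\<^sup>2 / N\<close>; both have a common
majorant whose \<open>m\<close>-th power decays like a quartic exponential.\<close>

lemma laplace_base_bounds:
  fixes t :: real and w \<zeta> :: complex
  assumes t: "0 \<le> t" "t \<le> 1" and \<zeta>: "cmod \<zeta> \<le> 1" and \<kappa>: "0 \<le> \<kappa>"
    and w: "cmod (1 - w - 2 * \<zeta>) \<le> \<kappa> * (cmod \<zeta>)\<^sup>2"
  defines "a \<equiv> (1 - of_real t) * (1 + w * of_real t)" and "b \<equiv> exp (- (2 * \<zeta> * of_real t + of_real (t\<^sup>2)))"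
  shows "cmod a \<le> exp ((2 + \<kappa>) * cmod \<zeta> * t - t\<^sup>2)"
    and "cmod b \<le> exp ((2 + \<kappa>) * cmod \<zeta> * t - t\<^sup>2)"
    and "cmod (a - b) \<le> (2 + 2 * \<kappa> + 8 * exp 3) * ((cmod \<zeta>)\<^sup>2 * t + cmod \<zeta> * t\<^sup>2 + t ^ 4)"
proof -
  define x where "x = cmod \<zeta>"
  have x: "0 \<le> x" "x \<le> 1" using \<zeta> by (simp_all add: x_def)
  have x2: "x\<^sup>2 \<le> x" using x by (simp add: power2_eq_square mult_left_le)
  have t2: "t\<^sup>2 \<le> t" "t\<^sup>2 \<le> 1" using t by (simp_all add: power2_eq_square mult_left_le mult_le_one)
  have w1: "cmod (1 - w) \<le> (2 + \<kappa>) * x"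
  proof -
    have "cmod (1 - w) \<le> cmod (1 - w - 2 * \<zeta>) + cmod (2 * \<zeta>)"
      using norm_triangle_ineq[of "1 - w - 2 * \<zeta>" "2 * \<zeta>"] by simp
    also have "\<dots> \<le> \<kappa> * x + 2 * x"
      using w mult_left_mono[OF x2 \<kappa>] by (simp add: norm_mult x_def)
    finally show ?thesis by (simp add: algebra_simps)
  qed
  have "cmod w \<le> 1 + (2 + \<kappa>) * x"
    using norm_triangle_ineq4[of 1 "1 - w"] w1 by simp
  then have "cmod (1 + w * of_real t) \<le> 1 + (1 + (2 + \<kappa>) * x) * t"
    using t by (intro order_trans[OF norm_triangle_ineq]) (simp add: norm_mult mult_right_mono)
  moreover have "cmod (1 - of_real t) = 1 - t"
    using t norm_of_real[of "1 - t", where 'a = complex] by simp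
  ultimately have "cmod a \<le> (1 - t) * (1 + (1 + (2 + \<kappa>) * x) * t)"
    using t unfolding a_def by (simp add: norm_mult mult_left_mono)
  also have "\<dots> = 1 + ((2 + \<kappa>) * x * t - t\<^sup>2) - (2 + \<kappa>) * x * t\<^sup>2"
    by (simp add: algebra_simps power2_eq_square)
  also have "\<dots> \<le> 1 + ((2 + \<kappa>) * x * t - t\<^sup>2)"
    using x \<kappa> by simp
  also have "\<dots> \<le> exp ((2 + \<kappa>) * x * t - t\<^sup>2)" by (rule exp_ge_add_one_self)
  finally show "cmod a \<le> exp ((2 + \<kappa>) * cmod \<zeta> * t - t\<^sup>2)" by (simp add: x_def)
  have "cmod b = exp (- (2 * Re \<zeta> * t + t\<^sup>2))" unfolding b_def by simp
  also have "\<dots> \<le> exp ((2 + \<kappa>) * x * t - t\<^sup>2)"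
  proof -
    have "- 2 * Re \<zeta> \<le> 2 * x" using abs_Re_le_cmod[of \<zeta>] by (simp add: x_def)
    also have "\<dots> \<le> (2 + \<kappa>) * x" using x \<kappa> by (intro mult_right_mono) auto
    finally have "- 2 * Re \<zeta> * t \<le> (2 + \<kappa>) * x * t" using t by (intro mult_right_mono) auto
    then show ?thesis by simp
  qed
  finally show "cmod b \<le> exp ((2 + \<kappa>) * cmod \<zeta> * t - t\<^sup>2)" by (simp add: x_def)
  define p where "p = 2 * \<zeta> * of_real t + of_real (t\<^sup>2)"
  have np: "cmod p \<le> 2 * x * t + t\<^sup>2"
    unfolding p_def using t by (intro order_trans[OF norm_triangle_ineq]) (simp add: norm_mult norm_power x_def)
  have xt: "0 \<le> x * t" "x * t \<le> 1" using x t by (simp_all add: mult_le_one)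
  have p3: "cmod p \<le> 3" using np xt t2 by linarith
  have "b - (1 - p) = exp (- p) - 1 - (- p)" by (simp add: b_def p_def)
  then have "cmod (b - (1 - p)) \<le> exp (cmod p) * (cmod p)\<^sup>2"
    using exp_minus_one_minus_bound[of "- p"] by (simp only: norm_minus_cancel)
  also have "\<dots> \<le> exp 3 * (8 * (x\<^sup>2 * t) + 2 * t ^ 4)"
  proof (intro mult_mono)
    have "(cmod p)\<^sup>2 \<le> (2 * (x * t) + t\<^sup>2)\<^sup>2" using np by (intro power_mono) (auto simp: mult.assoc)
    also have "\<dots> \<le> 2 * (2 * (x * t))\<^sup>2 + 2 * (t\<^sup>2)\<^sup>2"
      using sum_squares_bound[of "2 * (x * t)" "t\<^sup>2"] by (simp add: power2_sum)
    also have "\<dots> = 8 * (x\<^sup>2 * t\<^sup>2) + 2 * t ^ 4"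
      by (simp add: power_mult_distrib)
    also have "\<dots> \<le> 8 * (x\<^sup>2 * t) + 2 * t ^ 4" using t2 by (simp add: mult_left_mono)
    finally show "(cmod p)\<^sup>2 \<le> 8 * (x\<^sup>2 * t) + 2 * t ^ 4" .
  qed (use p3 in auto)
  finally have B: "cmod (b - (1 - p)) \<le> 8 * exp 3 * (x\<^sup>2 * t) + 2 * exp 3 * t ^ 4"
    by (simp add: algebra_simps)
  have "a - (1 - p) = (1 - w) * of_real (t\<^sup>2) - (1 - w - 2 * \<zeta>) * of_real t"
    by (simp add: a_def p_def algebra_simps power2_eq_square)
  then have "cmod (a - (1 - p)) \<le> cmod (1 - w) * t\<^sup>2 + cmod (1 - w - 2 * \<zeta>) * t"
    using t norm_triangle_ineq4[of "(1 - w) * of_real (t\<^sup>2)" "(1 - w - 2 * \<zeta>) * of_real t"]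
    by (simp add: norm_mult norm_power)
  also have "\<dots> \<le> (2 + \<kappa>) * x * t\<^sup>2 + \<kappa> * x\<^sup>2 * t"
    using w w1 t by (intro add_mono mult_right_mono) (auto simp: x_def)
  finally have A: "cmod (a - (1 - p)) \<le> (2 + \<kappa>) * (x * t\<^sup>2) + \<kappa> * (x\<^sup>2 * t)" by (simp add: mult.assoc)
  define E where "E = exp (3::real)"
  have E: "E > 0" by (simp add: E_def)
  have nn: "0 \<le> x\<^sup>2 * t" "0 \<le> x * t\<^sup>2" "0 \<le> t ^ 4" using x t by auto
  have "cmod (a - b) \<le> cmod (a - (1 - p)) + cmod (b - (1 - p))"
    using norm_triangle_ineq4[of "a - (1 - p)" "b - (1 - p)"] by simp
  also have "\<dots> \<le> (\<kappa> + 8 * E) * (x\<^sup>2 * t) + (2 + \<kappa>) * (x * t\<^sup>2) + 2 * E * t ^ 4"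
    using A B by (simp add: algebra_simps E_def)
  also have "\<dots> \<le> (2 + 2 * \<kappa> + 8 * E) * (x\<^sup>2 * t) + (2 + 2 * \<kappa> + 8 * E) * (x * t\<^sup>2) + (2 + 2 * \<kappa> + 8 * E) * t ^ 4"
  proof -
    have "\<kappa> + 8 * E \<le> 2 + 2 * \<kappa> + 8 * E" "2 + \<kappa> \<le> 2 + 2 * \<kappa> + 8 * E" "2 * E \<le> 2 + 2 * \<kappa> + 8 * E"
      using \<kappa> E by linarith+
    then show ?thesis using nn by (meson add_mono mult_right_mono)
  qed
  finally show "cmod (a - b) \<le> (2 + 2 * \<kappa> + 8 * exp 3) * ((cmod \<zeta>)\<^sup>2 * t + cmod \<zeta> * t\<^sup>2 + t ^ 4)"
    by (simp add: algebra_simps E_def x_def)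
qed

lemma norm_power_diff_le:
  fixes a b :: complex
  assumes "cmod a \<le> M" "cmod b \<le> M" "M > 0"
  shows "cmod (a ^ Suc n - b ^ Suc n) \<le> M ^ n * (real (Suc n) * cmod (a - b))"
proof -
  have "cmod ((a / of_real M) ^ Suc n - (b / of_real M) ^ Suc n) \<le> Suc n * cmod (a / of_real M - b / of_real M)"
    using assms by (intro norm_power_diff) (auto simp: norm_divide)
  moreover have "(a / of_real M) ^ Suc n - (b / of_real M) ^ Suc n = (a ^ Suc n - b ^ Suc n) / of_real (M ^ Suc n)"
    by (simp only: power_divide diff_divide_distrib of_real_power)
  moreover have "a / of_real M - b / of_real M = (a - b) / of_real M"
    by (simp only: diff_divide_distrib)
  ultimately have "cmod (a ^ Suc n - b ^ Suc n) / M ^ Suc n \<le> Suc n * (cmod (a - b) / M)"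
    using assms by (simp only: norm_divide norm_of_real) simp
  then show ?thesis using assms by (simp add: field_simps)
qed

text \<open>With \<open>t = v\<^sup>2 / N\<close> the exponential base raised to the power \<open>m\<close> is exactly \<open>exp (- N \<zeta> v\<^sup>2 - v^4 / 2)\<close>. Only \<open>m - 1\<close>
factors of the majorant are left in the difference of the powers; \<open>m - 1 \<ge> m / 2\<close> is why the exponent of the
bound is \<open>v^4 / 4\<close> and not \<open>v^4 / 2\<close>.\<close>

lemma laplace_integrand_error:
  fixes v R \<kappa> :: real and w \<zeta> :: complex and m :: nat
  assumes m: "m \<ge> 2" and \<kappa>: "0 \<le> \<kappa>"
    and w: "cmod (1 - w - 2 * \<zeta>) \<le> \<kappa> * (cmod \<zeta>)\<^sup>2"
    and \<zeta>: "cmod \<zeta> \<le> 1" "sqrt (2 * real m) * cmod \<zeta> \<le> R" and v: "v\<^sup>2 \<le> sqrt (2 * real m)"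
  defines "N \<equiv> sqrt (2 * real m)"
  shows "cmod (((1 - of_real (v\<^sup>2 / N)) * (1 + w * of_real (v\<^sup>2 / N))) ^ m - exp (- (of_real N * \<zeta>) * of_real (v\<^sup>2) - of_real (v ^ 4 / 2)))
    \<le> (2 + 2 * \<kappa> + 8 * exp 3) * (1 + R + R\<^sup>2) / N * ((v\<^sup>2 + v ^ 4 + v ^ 6) * exp ((2 + \<kappa>) * R * v\<^sup>2 - v ^ 4 / 4))"
proof -
  define t where "t = v\<^sup>2 / N"
  define x where "x = cmod \<zeta>"
  define A where "A = 2 + 2 * \<kappa> + 8 * exp (3::real)"
  define L where "L = 2 + \<kappa>"
  have A: "A \<ge> 0" using \<kappa> by (simp add: A_def)
  have L: "L \<ge> 0" using \<kappa> by (simp add: L_def)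
  have N: "N > 0" "N\<^sup>2 = 2 * real m" using m by (auto simp: N_def)
  have t: "0 \<le> t" "t \<le> 1" using v N(1) unfolding t_def N_def by (simp_all add: divide_le_eq_1)
  have x: "0 \<le> x" "N * x \<le> R" using \<zeta> by (simp_all add: x_def N_def)
  have R: "R \<ge> 0" using x N mult_nonneg_nonneg[of N x] by linarith
  have Nt: "N * t = v\<^sup>2" using N by (simp add: t_def)
  define a where "a = (1 - complex_of_real t) * (1 + w * of_real t)"
  define b where "b = exp (- (2 * \<zeta> * of_real t + of_real (t\<^sup>2)))"
  define M where "M = exp (L * x * t - t\<^sup>2)"
  have ab: "cmod a \<le> M" "cmod b \<le> M" "cmod (a - b) \<le> A * (x\<^sup>2 * t + x * t\<^sup>2 + t ^ 4)"
    using laplace_base_bounds[OF t \<zeta>(1) \<kappa> w] unfolding a_def b_def M_def L_def A_def x_def by auto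
  obtain n where n: "m = Suc n" using m by (cases m) auto
  have bm: "b ^ m = exp (- (of_real N * \<zeta>) * of_real (v\<^sup>2) - of_real (v ^ 4 / 2))"
  proof -
    have "of_nat m * (2 * \<zeta> * of_real t) = of_real (N\<^sup>2) * \<zeta> * of_real t" unfolding N(2) by simp
    also have "\<dots> = of_real N * \<zeta> * of_real (N * t)" by (simp add: power2_eq_square mult_ac)
    finally have 1: "of_nat m * (2 * \<zeta> * of_real t) = of_real N * \<zeta> * of_real (v\<^sup>2)" unfolding Nt .
    have "real m * t\<^sup>2 = (N * t)\<^sup>2 / 2" using N(2) by (simp add: power_mult_distrib)
    also have "\<dots> = v ^ 4 / 2" unfolding Nt by simp
    finally have 2: "of_nat m * of_real (t\<^sup>2) = complex_of_real (v ^ 4 / 2)"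
      by (metis of_real_mult of_real_of_nat_eq)
    have "b ^ m = exp (of_nat m * (- (2 * \<zeta> * of_real t + of_real (t\<^sup>2))))"
      unfolding b_def by (rule exp_of_nat_mult[symmetric])
    also have "of_nat m * (- (2 * \<zeta> * of_real t + of_real (t\<^sup>2))) = - (of_real N * \<zeta>) * of_real (v\<^sup>2) - of_real (v ^ 4 / 2)"
      unfolding 1[symmetric] 2[symmetric] mult_minus_left by (simp only: mult_minus_right distrib_left minus_add_distrib diff_conv_add_uminus 1 mult_minus_left)
    finally show ?thesis .
  qed
  have "M ^ n \<le> exp (L * R * v\<^sup>2 - v ^ 4 / 4)"
  proof -
    have "M ^ n = exp (n * (L * x * t - t\<^sup>2))" unfolding M_def by (rule exp_of_nat_mult[symmetric])
    also have "\<dots> \<le> exp (L * R * v\<^sup>2 - v ^ 4 / 4)"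
    proof -
      have "n * (L * x * t) \<le> N\<^sup>2 * (L * x * t)"
        using N(2) n L x t by (intro mult_right_mono) auto
      also have "\<dots> = L * (N * x) * (N * t)" by (simp add: power2_eq_square mult_ac)
      also have "\<dots> \<le> L * R * v\<^sup>2" unfolding Nt using L x by (intro mult_right_mono mult_left_mono) auto
      finally have 1: "n * (L * x * t) \<le> L * R * v\<^sup>2" .
      have "v ^ 4 / 4 = (N * t)\<^sup>2 / 4" unfolding Nt by simp
      also have "\<dots> = m / 2 * t\<^sup>2" using N(2) by (simp add: power_mult_distrib)
      also have "\<dots> \<le> n * t\<^sup>2" using n m by (intro mult_right_mono) auto
      finally have 2: "v ^ 4 / 4 \<le> n * t\<^sup>2" .
      show ?thesis using 1 2 by (simp add: right_diff_distrib)
    qed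
    finally show ?thesis .
  qed
  moreover have "m * cmod (a - b) \<le> A * (1 + R + R\<^sup>2) / N * (v\<^sup>2 + v ^ 4 + v ^ 6)"
  proof -
    have "m * cmod (a - b) \<le> N\<^sup>2 * (A * (x\<^sup>2 * t + x * t\<^sup>2 + t ^ 4))"
      using ab(3) N(2) by (intro mult_mono) auto
    also have "\<dots> = A * ((N * x)\<^sup>2 * (N * t) + (N * x) * (N * t)\<^sup>2 + (N * t) ^ 3 * t) / N"
      using N(1) by (simp add: field_simps power2_eq_square power3_eq_cube power4_eq_xxxx)
    also have "\<dots> \<le> A * (R\<^sup>2 * v\<^sup>2 + R * (v\<^sup>2)\<^sup>2 + (v\<^sup>2) ^ 3 * 1) / N"
      unfolding Nt using N A R x t
      by (intro divide_right_mono mult_left_mono add_mono mult_right_mono power_mono) auto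
    also have "\<dots> \<le> A * ((1 + R + R\<^sup>2) * (v\<^sup>2 + v ^ 4 + v ^ 6)) / N"
    proof (intro divide_right_mono mult_left_mono)
      have "R\<^sup>2 * v\<^sup>2 + R * v ^ 4 + 1 * v ^ 6 \<le> (1 + R + R\<^sup>2) * v\<^sup>2 + (1 + R + R\<^sup>2) * v ^ 4 + (1 + R + R\<^sup>2) * v ^ 6"
        using R by (intro add_mono mult_right_mono) (auto simp: zero_le_even_power)
      then show "R\<^sup>2 * v\<^sup>2 + R * (v\<^sup>2)\<^sup>2 + (v\<^sup>2) ^ 3 * 1 \<le> (1 + R + R\<^sup>2) * (v\<^sup>2 + v ^ 4 + v ^ 6)"
        by (simp add: distrib_left flip: power_mult)
    qed (use A N in auto)
    finally show ?thesis by simp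
  qed
  ultimately have "M ^ n * (m * cmod (a - b)) \<le> exp (L * R * v\<^sup>2 - v ^ 4 / 4) * (A * (1 + R + R\<^sup>2) / N * (v\<^sup>2 + v ^ 4 + v ^ 6))"
    by (rule mult_mono) auto
  moreover have "cmod (a ^ m - b ^ m) \<le> M ^ n * (m * cmod (a - b))"
    using norm_power_diff_le[OF ab(1,2), of n] unfolding n M_def by simp
  ultimately have "cmod (a ^ m - b ^ m) \<le> A * (1 + R + R\<^sup>2) / N * ((v\<^sup>2 + v ^ 4 + v ^ 6) * exp (L * R * v\<^sup>2 - v ^ 4 / 4))"
    by (simp only: mult_ac)
  then show ?thesis unfolding bm a_def t_def A_def L_def .
qed


text \<open>The part of the limit integral beyond \<open>|v| = sqrt N\<close> obeys the same bound as the difference inside, because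
\<open>1 \<le> v\<^sup>2 / N\<close> there; so one integrable function dominates the error on the whole line.\<close>

lemma laplace_integral_error:
  fixes R \<kappa> :: real
  assumes R: "0 \<le> R" and \<kappa>: "0 \<le> \<kappa>"
  obtains C where "\<And>m \<zeta> w. m \<ge> 2 \<Longrightarrow> cmod \<zeta> \<le> 1 \<Longrightarrow> sqrt (2 * real m) * cmod \<zeta> \<le> R \<Longrightarrow>
      cmod (1 - w - 2 * \<zeta>) \<le> \<kappa> * (cmod \<zeta>)\<^sup>2 \<Longrightarrow>
    cmod (of_real (sqrt (sqrt (2 * real m))) * (\<integral>s. indicator {-1..1} s *\<^sub>R ((1 - of_real (s\<^sup>2)) * (1 + w * of_real (s\<^sup>2))) ^ m \<partial>lborel)
        - quartic_moment 0 (of_real (sqrt (2 * real m)) * \<zeta>)) \<le> C / sqrt (2 * real m)"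
proof -
  define A where "A = (2 + 2 * \<kappa> + 8 * exp 3) * (1 + R + R\<^sup>2)"
  define H where "H = (\<lambda>v::real. (v\<^sup>2 + v ^ 4 + v ^ 6) * exp ((2 + \<kappa>) * R * v\<^sup>2 - v ^ 4 / 4))"
  have A1: "A \<ge> 1"
  proof -
    have "1 * 1 \<le> A" unfolding A_def using R \<kappa> exp_gt_zero[of "3::real"] by (intro mult_mono) auto
    then show ?thesis by simp
  qed
  have H: "integrable lborel H"
  proof -
    have "integrable lborel (\<lambda>v::real. \<bar>v\<bar> ^ 2 * exp ((2 + \<kappa>) * R * v\<^sup>2 - (1/4) * v ^ 4) + \<bar>v\<bar> ^ 4 * exp ((2 + \<kappa>) * R * v\<^sup>2 - (1/4) * v ^ 4)
        + \<bar>v\<bar> ^ 6 * exp ((2 + \<kappa>) * R * v\<^sup>2 - (1/4) * v ^ 4))"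
      by (intro Bochner_Integration.integrable_add integrable_quartic) simp_all
    moreover have "H = (\<lambda>v. \<bar>v\<bar> ^ 2 * exp ((2 + \<kappa>) * R * v\<^sup>2 - (1/4) * v ^ 4) + \<bar>v\<bar> ^ 4 * exp ((2 + \<kappa>) * R * v\<^sup>2 - (1/4) * v ^ 4)
        + \<bar>v\<bar> ^ 6 * exp ((2 + \<kappa>) * R * v\<^sup>2 - (1/4) * v ^ 4))"
      by (rule ext) (simp add: H_def distrib_right)
    ultimately show ?thesis by simp
  qed
  show ?thesis
  proof (rule that[of "A * (\<integral>v. H v \<partial>lborel)"])
    fix m :: nat and \<zeta> w :: complex
    assume m: "m \<ge> 2" and \<zeta>: "cmod \<zeta> \<le> 1" "sqrt (2 * real m) * cmod \<zeta> \<le> R"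
      and w: "cmod (1 - w - 2 * \<zeta>) \<le> \<kappa> * (cmod \<zeta>)\<^sup>2"
    define N where "N = sqrt (2 * real m)"
    define r where "r = sqrt N"
    have N: "N > 0" using m by (simp add: N_def)
    then have r: "r > 0" "r\<^sup>2 = N" by (simp_all add: r_def)
    let ?F = "\<lambda>v::real. indicator {-r..r} v *\<^sub>R ((1 - complex_of_real (v\<^sup>2 / N)) * (1 + w * of_real (v\<^sup>2 / N))) ^ m"
    let ?E = "\<lambda>v::real. exp (- (of_real N * \<zeta>) * of_real (v\<^sup>2) - complex_of_real (v ^ 4 / 2))"
    have intF: "integrable lborel ?F"
      using N by (intro integrable_on_interval continuous_intros) auto
    have intE: "integrable lborel ?E"
      using integrable_quartic_integrand[of 0 "of_real N * \<zeta>"] by simp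
    have scale: "of_real r * (\<integral>s. indicator {-1..1} s *\<^sub>R ((1 - of_real (s\<^sup>2)) * (1 + w * of_real (s\<^sup>2))) ^ m \<partial>lborel)
        = (\<integral>v. ?F v \<partial>lborel)"
    proof -
      have "?F (0 + r * s) = indicator {-1..1} s *\<^sub>R ((1 - of_real (s\<^sup>2)) * (1 + w * of_real (s\<^sup>2))) ^ m" for s
      proof -
        have "(0 + r * s)\<^sup>2 / N = s\<^sup>2" using N by (simp add: power_mult_distrib r)
        moreover have "indicator {-r..r} (0 + r * s) = (indicator {-1..1} s :: real)"
        proof -
          have "- r \<le> r * s \<longleftrightarrow> - 1 \<le> s" using mult_le_cancel_left_pos[OF r(1), of "- 1" s] by simp
          moreover have "r * s \<le> r \<longleftrightarrow> s \<le> 1" using mult_le_cancel_left_pos[OF r(1), of s 1] by simp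
          ultimately show ?thesis by (simp add: indicator_def)
        qed
        ultimately show ?thesis by (simp only:)
      qed
      then show ?thesis
        using lborel_integral_real_affine[of r ?F 0] r by (simp only: scaleR_conv_of_real) simp
    qed
    have bound: "cmod (?F v - ?E v) \<le> A / N * H v" for v
    proof (cases "v \<in> {-r..r}")
      case True
      then have "v\<^sup>2 \<le> r\<^sup>2" by (intro abs_le_square_iff[THEN iffD1]) auto
      then have "v\<^sup>2 \<le> N" using r by simp
      then show ?thesis
        using laplace_integrand_error[OF m \<kappa> w \<zeta>, of v] True
        by (simp only: N_def[symmetric] A_def H_def indicator_simps scaleR_one)
    next
      case False
      then have "r\<^sup>2 \<le> v\<^sup>2" using r by (intro abs_le_square_iff[THEN iffD1]) auto
      then have v: "1 \<le> v\<^sup>2 / N" using N r by simp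
      have "cmod (?F v - ?E v) = exp (- (N * Re \<zeta>) * v\<^sup>2 - v ^ 4 / 2)"
        using False by simp
      also have "\<dots> \<le> exp ((2 + \<kappa>) * R * v\<^sup>2 - v ^ 4 / 4)"
      proof -
        have "- (N * Re \<zeta>) \<le> N * cmod \<zeta>"
          using N abs_Re_le_cmod[of \<zeta>] mult_left_mono[of "- Re \<zeta>" "cmod \<zeta>" N] by simp
        also have "\<dots> \<le> 1 * R" using \<zeta> by (simp add: N_def)
        also have "\<dots> \<le> (2 + \<kappa>) * R" using R \<kappa> by (intro mult_right_mono) auto
        finally have "- (N * Re \<zeta>) * v\<^sup>2 \<le> (2 + \<kappa>) * R * v\<^sup>2" by (rule mult_right_mono) simp
        moreover have "v ^ 4 / 4 \<le> v ^ 4 / 2" by simp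
        ultimately have "- (N * Re \<zeta>) * v\<^sup>2 - v ^ 4 / 2 \<le> (2 + \<kappa>) * R * v\<^sup>2 - v ^ 4 / 4" by linarith
        then show ?thesis by simp
      qed
      also have "\<dots> \<le> (A / N * (v\<^sup>2 + v ^ 4 + v ^ 6)) * exp ((2 + \<kappa>) * R * v\<^sup>2 - v ^ 4 / 4)"
      proof -
        have "1 * 1 \<le> A * (v\<^sup>2 / N)" using A1 v by (intro mult_mono) auto
        also have "\<dots> = A / N * v\<^sup>2" by simp
        also have "\<dots> \<le> A / N * (v\<^sup>2 + v ^ 4 + v ^ 6)"
          using A1 N by (intro mult_left_mono) (auto simp: zero_le_even_power)
        finally have "1 \<le> A / N * (v\<^sup>2 + v ^ 4 + v ^ 6)" by simp
        from mult_right_mono[OF this, of "exp ((2 + \<kappa>) * R * v\<^sup>2 - v ^ 4 / 4)"] show ?thesis by simp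
      qed
      finally show ?thesis by (simp only: H_def mult.assoc)
    qed
    have "cmod ((\<integral>v. ?F v \<partial>lborel) - (\<integral>v. ?E v \<partial>lborel)) \<le> (\<integral>v. A / N * H v \<partial>lborel)"
      unfolding Bochner_Integration.integral_diff[OF intF intE, symmetric]
      by (rule Bochner_Integration.integral_norm_bound_integral
          [OF Bochner_Integration.integrable_diff[OF intF intE] integrable_mult_right[OF H] bound])
    also have "(\<integral>v. A / N * H v \<partial>lborel) = A * (\<integral>v. H v \<partial>lborel) / N"
      by simp
    finally show "cmod (of_real (sqrt (sqrt (2 * real m))) * (\<integral>s. indicator {-1..1} s *\<^sub>R ((1 - of_real (s\<^sup>2)) * (1 + w * of_real (s\<^sup>2))) ^ m \<partial>lborel)
        - quartic_moment 0 (of_real (sqrt (2 * real m)) * \<zeta>)) \<le> A * (\<integral>v. H v \<partial>lborel) / sqrt (2 * real m)"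
      unfolding scale[symmetric] N_def[symmetric] r_def[symmetric] by (simp add: quartic_moment_def)
  qed
qed

lemma quartic_moment_bounded:
  fixes R :: real
  obtains B where "B > 0" "\<And>x. cmod x \<le> R \<Longrightarrow> cmod (quartic_moment 0 x) \<le> B"
proof -
  have "continuous_on (cball 0 R) (quartic_moment 0)"
    using quartic_moment_has_field_derivative DERIV_isCont by (blast intro: continuous_at_imp_continuous_on)
  then have "bounded (quartic_moment 0 ` cball 0 R)"
    by (intro compact_imp_bounded compact_continuous_image) auto
  then obtain B where "B > 0" "\<And>y. y \<in> quartic_moment 0 ` cball 0 R \<Longrightarrow> cmod y \<le> B"
    unfolding bounded_pos by blast
  then show ?thesis by (intro that[of B]) auto
qed

lemma monic_pi_asymptotic:
  fixes R \<kappa> :: real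
  assumes R: "0 \<le> R" and \<kappa>: "0 \<le> \<kappa>"
  obtains C where "C \<ge> 0" "\<And>m \<zeta> z. m \<ge> 2 \<Longrightarrow> z \<noteq> - 1 \<Longrightarrow> cmod \<zeta> \<le> 1 \<Longrightarrow> sqrt (2 * real m) * cmod \<zeta> \<le> R \<Longrightarrow>
      cmod (1 - (1 - z) / (1 + z) - 2 * \<zeta>) \<le> \<kappa> * (cmod \<zeta>)\<^sup>2 \<Longrightarrow>
    \<exists>e. cmod e \<le> C / sqrt (real m) \<and> monic_pi m z = (1 + z) ^ m * of_real (sqrt (sqrt (2 * real m)))
      * (quartic_moment 0 (of_real (sqrt (2 * real m)) * \<zeta>) / of_real (sqrt pi) + e)"
proof -
  obtain C where C: "\<And>m \<zeta> w. m \<ge> 2 \<Longrightarrow> cmod \<zeta> \<le> 1 \<Longrightarrow> sqrt (2 * real m) * cmod \<zeta> \<le> R \<Longrightarrow>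
      cmod (1 - w - 2 * \<zeta>) \<le> \<kappa> * (cmod \<zeta>)\<^sup>2 \<Longrightarrow>
    cmod (of_real (sqrt (sqrt (2 * real m))) * (\<integral>s. indicator {-1..1} s *\<^sub>R ((1 - of_real (s\<^sup>2)) * (1 + w * of_real (s\<^sup>2))) ^ m \<partial>lborel)
        - quartic_moment 0 (of_real (sqrt (2 * real m)) * \<zeta>)) \<le> C / sqrt (2 * real m)"
    using laplace_integral_error[OF R \<kappa>] by blast
  obtain B where B: "B > 0" "\<And>x. cmod x \<le> R \<Longrightarrow> cmod (quartic_moment 0 x) \<le> B"
    using quartic_moment_bounded[of R] by blast
  show ?thesis
  proof (rule that[of "\<bar>C\<bar> + B"])
    show "0 \<le> \<bar>C\<bar> + B" using B by simp
    fix m :: nat and \<zeta> z :: complex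
    assume m: "m \<ge> 2" and z: "z \<noteq> - 1" and \<zeta>: "cmod \<zeta> \<le> 1" "sqrt (2 * real m) * cmod \<zeta> \<le> R"
      and w: "cmod (1 - (1 - z) / (1 + z) - 2 * \<zeta>) \<le> \<kappa> * (cmod \<zeta>)\<^sup>2"
    define N where "N = sqrt (2 * real m)"
    define r where "r = sqrt N"
    have N: "N > 0" using m by (simp add: N_def)
    then have r: "r > 0" "r\<^sup>2 = N" by (simp_all add: r_def)
    define J where "J = (\<integral>s. indicator {-1..1} s *\<^sub>R ((1 - of_real (s\<^sup>2)) * (1 + (1 - z) / (1 + z) * of_real (s\<^sup>2))) ^ m \<partial>lborel)"
    define M where "M = quartic_moment 0 (of_real N * \<zeta>)"
    define k where "k = euler_const m / N"
    have J: "cmod (of_real r * J - M) \<le> \<bar>C\<bar> / N"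
    proof -
      have "cmod (of_real r * J - M) \<le> C / N"
        using C[OF m \<zeta> w] unfolding N_def[symmetric] r_def[symmetric] J_def[symmetric] M_def[symmetric] .
      also have "\<dots> \<le> \<bar>C\<bar> / N" using N by (intro divide_right_mono) auto
      finally show ?thesis .
    qed
    have M: "cmod M \<le> B"
      unfolding M_def using \<zeta> N by (intro B(2)) (simp add: norm_mult N_def)
    have k: "\<bar>k - 1 / sqrt pi\<bar> \<le> 1 / (2 * real m)" "\<bar>k\<bar> \<le> 1"
      using euler_const_asymptotic[of m] m by (simp_all add: k_def N_def)
    define e where "e = of_real k * (of_real r * J - M) + of_real (k - 1 / sqrt pi) * M"
    have sm: "sqrt (real m) > 0" "sqrt (real m) \<le> N" "sqrt (real m) \<le> 2 * real m"
      using m by (auto simp: N_def intro!: real_le_lsqrt simp: power2_eq_square)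
    have "cmod e \<le> \<bar>k\<bar> * cmod (of_real r * J - M) + \<bar>k - 1 / sqrt pi\<bar> * cmod M"
      unfolding e_def by (intro order_trans[OF norm_triangle_ineq]) (simp only: norm_mult norm_of_real order_refl)
    also have "\<dots> \<le> 1 * (\<bar>C\<bar> / N) + 1 / (2 * real m) * B"
      using k J M B N by (intro add_mono mult_mono) auto
    also have "\<dots> \<le> \<bar>C\<bar> / sqrt (real m) + B / sqrt (real m)"
    proof (intro add_mono)
      show "1 * (\<bar>C\<bar> / N) \<le> \<bar>C\<bar> / sqrt (real m)"
        using sm N by (simp add: divide_left_mono)
      have "B / (2 * real m) \<le> B / sqrt (real m)"
        using sm B m by (intro divide_left_mono) auto
      then show "1 / (2 * real m) * B \<le> B / sqrt (real m)" by simp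
    qed
    finally have e: "cmod e \<le> (\<bar>C\<bar> + B) / sqrt (real m)" by (simp add: add_divide_distrib)
    have "monic_pi m z = (1 + z) ^ m * (of_real (euler_const m) * J)"
      unfolding J_def by (rule monic_pi_eq_integral[OF z])
    also have "euler_const m = k * (r * r)"
      using N r by (simp add: k_def power2_eq_square)
    also have "of_real (k * (r * r)) * J = of_real r * (M / of_real (sqrt pi) + e)"
      unfolding e_def by (simp add: algebra_simps)
    finally have "monic_pi m z = (1 + z) ^ m * of_real r * (M / of_real (sqrt pi) + e)" by (simp only: mult.assoc)
    with e show "\<exists>e. cmod e \<le> (\<bar>C\<bar> + B) / sqrt (real m) \<and> monic_pi m z = (1 + z) ^ m * of_real (sqrt (sqrt (2 * real m)))
      * (quartic_moment 0 (of_real (sqrt (2 * real m)) * \<zeta>) / of_real (sqrt pi) + e)"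
      unfolding N_def[symmetric] r_def[symmetric] M_def[symmetric] by blast
  qed
qed

section \<open>Branches of the square root and the local variable\<close>

lemma power2_sqrt_pos: "(sqrt_pos w)\<^sup>2 = w"
proof -
  have "(sqrt_pos w)\<^sup>2 = of_real (cmod w) * exp (\<i> * of_real (Arg2pi w))"
    unfolding sqrt_pos_def power_mult_distrib exp_double[symmetric]
    by (simp flip: of_real_power)
  then show ?thesis using Arg2pi_eq[of w] by simp
qed

lemma Im_sqrt_pos_nonneg: "0 \<le> Im (sqrt_pos w)"
proof -
  have "0 \<le> sin (Arg2pi w / 2)"
    using Arg2pi_ge_0[of w] Arg2pi_lt_2pi[of w] by (intro sin_ge_zero) auto
  then show ?thesis by (simp add: sqrt_pos_def Im_exp)
qed

text \<open>The branch with arguments in \<open>[0, 2\<pi>)\<close> takes values in the closed upper half-plane; a square root in the open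
upper half-plane is therefore the right one.\<close>

lemma sqrt_pos_unique:
  assumes "s\<^sup>2 = w" "0 < Im s"
  shows "sqrt_pos w = s"
proof -
  have "(sqrt_pos w)\<^sup>2 = s\<^sup>2"
    by (simp only: power2_sqrt_pos assms(1))
  then have "sqrt_pos w = s \<or> sqrt_pos w = - s"
    by (simp only: power2_eq_iff)
  then show ?thesis
    using Im_sqrt_pos_nonneg[of w] assms(2) by auto
qed

lemma upper_half_plane_csqrt:
  assumes "0 < Im w"
  shows "0 < Re (csqrt w)" "0 < Im (csqrt w)"
proof -
  define p q where "p = Re (csqrt w)" and "q = Im (csqrt w)"
  have "Im w = 2 * p * q"
    unfolding p_def q_def using Im_power2[of "csqrt w"] by (simp only: power2_csqrt)
  moreover have "0 \<le> p" unfolding p_def by (rule Re_csqrt)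
  ultimately have "0 < p \<and> 0 < q"
    using assms by (cases "p = 0") (auto simp: zero_less_mult_iff)
  then show "0 < Re (csqrt w)" "0 < Im (csqrt w)" unfolding p_def q_def by blast+
qed

lemma sqrt_pos_upper_half_plane: "0 < Im w \<Longrightarrow> sqrt_pos w = csqrt w"
  by (rule sqrt_pos_unique) (simp_all only: power2_csqrt upper_half_plane_csqrt)

lemma Re_csqrt_pos:
  assumes "w \<notin> \<real>\<^sub>\<le>\<^sub>0"
  shows "0 < Re (csqrt w)"
proof -
  have "Re (csqrt w) \<noteq> 0"
  proof
    assume *: "Re (csqrt w) = 0"
    have "w = (csqrt w)\<^sup>2" by simp
    also have "csqrt w = \<i> * of_real (Im (csqrt w))" by (rule complex_eqI) (simp_all only: *, simp_all)
    finally have "w = - (of_real (Im (csqrt w)))\<^sup>2" by (simp only: power_mult_distrib power2_i) simp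
    then have "w = of_real (- (Im (csqrt w))\<^sup>2)" by (simp only: of_real_minus of_real_power)
    then have "w \<in> \<real>\<^sub>\<le>\<^sub>0" by (metis nonpos_Reals_of_real_iff neg_le_0_iff_le zero_le_power2)
    with assms show False ..
  qed
  with Re_csqrt[of w] show ?thesis by linarith
qed

lemma sqrt_one_minus_eq_csqrt:
  assumes "0 < Im z"
  shows "sqrt_one_minus z = - csqrt (1 - z)"
proof -
  have "1 - z \<notin> \<real>\<^sub>\<le>\<^sub>0" using assms by (auto simp: complex_nonpos_Reals_iff)
  then have "0 < Im (\<i> * csqrt (1 - z))"
    unfolding Im_i_times by (rule Re_csqrt_pos)
  moreover have "(\<i> * csqrt (1 - z))\<^sup>2 = z - 1"
    unfolding power_mult_distrib power2_csqrt by simp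
  ultimately have "sqrt_pos (z - 1) = \<i> * csqrt (1 - z)"
    by (intro sqrt_pos_unique)
  moreover have "sqrt_one_minus z = \<i> * sqrt_pos (z - 1)"
  proof -
    have "cis ((Arg2pi (z - 1) + pi) / 2) = cis (Arg2pi (z - 1) / 2) * cis (pi / 2)"
      by (simp only: cis_mult add_divide_distrib)
    then show ?thesis
      unfolding sqrt_one_minus_def sqrt_pos_def cis_conv_exp[symmetric]
      by (simp only: cis_pi_half norm_minus_commute mult_ac)
  qed
  ultimately show ?thesis by simp
qed

lemma Im_of_real_times: "Im (of_real c * w) = c * Im w"
  by simp

text \<open>No jump of the branch occurs: for \<open>z\<close> in the upper half-plane and \<open>t\<close> in the right half-plane the factors on the
right have arguments \<open>\<pi>/4\<close>, \<open>0\<close>, something in \<open>(0, \<pi>/2)\<close> and something in \<open>(-\<pi>/4, \<pi>/4)\<close>, with sum in \<open>(0, \<pi>)\<close>. With \<open>t = \<tau>(z)\<close>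
this evaluates \<open>(\<xi> exp (-5\<pi>\<i>/4))^(1/2)\<close>.\<close>

lemma sqrt_pos_rotated_product:
  assumes z: "0 < Im z" and t: "0 < Re t" and r: "0 < r"
  shows "sqrt_pos (\<i> * of_real (r\<^sup>2) * z * t) = cis (pi / 4) * of_real r * csqrt z * csqrt t"
proof (rule sqrt_pos_unique)
  show "(cis (pi / 4) * of_real r * csqrt z * csqrt t)\<^sup>2 = \<i> * of_real (r\<^sup>2) * z * t"
    by (simp only: power_mult_distrib power2_csqrt cis_power2 of_real_power) simp
  obtain p q where pq: "csqrt z = Complex p q" "0 < p" "0 < q"
    using upper_half_plane_csqrt[OF z] by (metis complex.collapse)
  obtain a b where ab: "csqrt t = Complex a b" by (metis complex.collapse)
  have "t = (Complex a b)\<^sup>2" using power2_csqrt[of t] ab by simp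
  then have "0 < a\<^sup>2 - b\<^sup>2" using t by (simp add: Re_power2)
  moreover have "0 \<le> a" using Re_csqrt[of t] unfolding ab by simp
  ultimately have ba: "\<bar>b\<bar> < a" using power2_less_imp_less[of "\<bar>b\<bar>" a] by simp
  have "cis (pi / 4) = of_real (sqrt 2 / 2) * Complex 1 1"
    by (simp add: complex_eq_iff cos_45 sin_45)
  then have "cis (pi / 4) * of_real r * csqrt z * csqrt t = of_real (sqrt 2 / 2 * r) * (Complex 1 1 * Complex p q * Complex a b)"
    unfolding pq ab by simp
  moreover have "Im (Complex 1 1 * Complex p q * Complex a b) = (p - q) * b + (p + q) * a" by simp
  moreover have "0 < (p - q) * b + (p + q) * a"
  proof -
    have "\<bar>(p - q) * b\<bar> \<le> (p + q) * \<bar>b\<bar>"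
      unfolding abs_mult using pq by (intro mult_right_mono) auto
    also have "\<dots> < (p + q) * a" using pq ba by (intro mult_strict_left_mono) auto
    finally show ?thesis by linarith
  qed
  ultimately show "0 < Im (cis (pi / 4) * of_real r * csqrt z * csqrt t)"
    using r by (simp only: Im_of_real_times) simp
qed

lemma norm_csqrt_minus_one_le: "cmod (csqrt u - 1) \<le> cmod (u - 1)"
proof -
  have "1 \<le> Re (csqrt u + 1)" using Re_csqrt[of u] by (simp only: plus_complex.simps one_complex.simps)
  then have "1 \<le> cmod (csqrt u + 1)" using complex_Re_le_cmod order_trans by blast
  then have "cmod (csqrt u - 1) * 1 \<le> cmod (csqrt u - 1) * cmod (csqrt u + 1)"
    by (intro mult_left_mono) auto
  also have "\<dots> = cmod ((csqrt u)\<^sup>2 - 1)"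
    unfolding norm_mult[symmetric] by (simp only: power2_eq_square) (simp add: algebra_simps)
  finally show ?thesis by simp
qed

lemma inverse_product_near_one:
  fixes p q :: complex
  assumes p: "cmod (p - 1) \<le> d" and q: "cmod (q - 1) \<le> d" and d: "d \<le> 1 / 8"
  shows "p * q \<noteq> 0" "cmod (1 / (p * q) - 1) \<le> 6 * d" "cmod (1 / (p * q)) \<le> 2"
proof -
  have d0: "0 \<le> d" using p norm_ge_zero order_trans by blast
  have "p * q - 1 = (p - 1) + (q - 1) + (p - 1) * (q - 1)" by (simp add: algebra_simps)
  then have "cmod (p * q - 1) \<le> cmod ((p - 1) + (q - 1)) + cmod ((p - 1) * (q - 1))"
    by (simp only: norm_triangle_ineq)
  also have "\<dots> \<le> cmod (p - 1) + cmod (q - 1) + cmod (p - 1) * cmod (q - 1)"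
    unfolding norm_mult by (intro add_mono norm_triangle_ineq order_refl)
  also have "\<dots> \<le> d + d + 1 * d" using p q d d0 by (intro add_mono mult_mono) auto
  finally have pq: "cmod (p * q - 1) \<le> 3 * d" by simp
  have "1 - cmod (p * q - 1) \<le> cmod (p * q)"
    using norm_triangle_ineq4[of "p * q" "p * q - 1"] by simp
  then have half: "1/2 \<le> cmod (p * q)" using pq d by linarith
  then show nz: "p * q \<noteq> 0" by auto
  have "1 / cmod (p * q) \<le> 1 / (1/2)" using half by (intro divide_left_mono) auto
  then show inv: "cmod (1 / (p * q)) \<le> 2" by (simp only: norm_divide norm_one) simp
  have "1 / (p * q) - 1 = (1 / (p * q)) * (1 - p * q)" using nz by (simp add: field_simps)
  then have "cmod (1 / (p * q) - 1) = cmod (1 / (p * q)) * cmod (p * q - 1)"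
    by (simp only: norm_mult norm_minus_commute)
  also have "\<dots> \<le> 2 * (3 * d)" using inv pq by (intro mult_mono) auto
  finally show "cmod (1 / (p * q) - 1) \<le> 6 * d" by simp
qed

text \<open>The power series of \<open>- Ln (1 - z\<^sup>2) / z\<^sup>2\<close>, the square of \<open>\<tau>\<close>.\<close>

definition log_series :: "complex \<Rightarrow> complex" where
  "log_series z = (\<Sum>k. z ^ (2 * k) / of_nat (k + 1))"

lemma summable_log_series:
  assumes "cmod u < 1"
  shows "summable (\<lambda>k. u ^ k / of_nat (k + 1))"
proof (rule summable_comparison_test')
  show "summable (\<lambda>k. cmod u ^ k)" using assms by (simp add: summable_geometric)
  show "cmod (u ^ k / of_nat (k + 1)) \<le> cmod u ^ k" if "0 \<le> k" for k
  proof -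
    have "cmod u ^ k / (real k + 1) \<le> cmod u ^ k / 1" by (intro divide_left_mono) auto
    then show ?thesis by (simp add: norm_divide norm_power add.commute flip: of_nat_Suc)
  qed
qed

lemma log_series_near_one:
  assumes z: "cmod z \<le> 1 / 2"
  shows "cmod (log_series z - 1) \<le> 2 * (cmod z)\<^sup>2"
proof -
  define x where "x = (cmod z)\<^sup>2"
  have x: "0 \<le> x" "x \<le> 1/4"
    using power_mono[OF z, of 2] by (simp_all add: x_def power2_eq_square)
  have s: "summable (\<lambda>k. z ^ (2 * k) / of_nat (k + 1))"
    using summable_log_series[of "z\<^sup>2"] x by (simp add: power_mult norm_power x_def)
  have "log_series z - 1 = (\<Sum>k. z ^ (2 * Suc k) / of_nat (Suc k + 1))"
    unfolding log_series_def suminf_split_head[OF s] by simp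
  also have "cmod \<dots> \<le> (\<Sum>k. x * x ^ k)"
  proof (rule norm_suminf_le)
    show "summable (\<lambda>k. x * x ^ k)" using x by (intro summable_mult summable_geometric) auto
    fix k
    have "cmod (z ^ (2 * Suc k) / of_nat (Suc k + 1)) = x ^ Suc k / real (Suc k + 1)"
      by (simp only: norm_divide norm_power power_mult x_def norm_of_nat)
    also have "\<dots> \<le> x ^ Suc k / 1" using x by (intro divide_left_mono) auto
    finally show "cmod (z ^ (2 * Suc k) / of_nat (Suc k + 1)) \<le> x * x ^ k" by simp
  qed
  also have "\<dots> = x * (1 / (1 - x))"
    using x suminf_geometric[of x] by (subst suminf_mult) (auto intro: summable_geometric)
  also have "\<dots> \<le> x * 2"
    using x by (intro mult_left_mono) (auto simp: field_simps)
  finally show ?thesis by (simp add: x_def)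
qed

lemma log_series_holomorphic: "log_series holomorphic_on ball 0 1"
proof -
  have "(\<lambda>u. \<Sum>k. u ^ k / of_nat (k + 1)) holomorphic_on ball 0 1"
  proof (rule power_series_holomorphic)
    fix w :: complex assume "w \<in> ball 0 1"
    then have "summable (\<lambda>k. w ^ k / of_nat (k + 1))" by (intro summable_log_series) simp
    then show "(\<lambda>n. 1 / of_nat (n + 1) * (w - 0) ^ n) sums (\<Sum>k. w ^ k / of_nat (k + 1))"
      by (simp add: summable_sums)
  qed
  then have "((\<lambda>u. \<Sum>k. u ^ k / of_nat (k + 1)) \<circ> (\<lambda>z. z\<^sup>2)) holomorphic_on ball 0 1"
  proof (rule holomorphic_on_compose_gen[rotated])
    show "(\<lambda>z. z\<^sup>2) holomorphic_on ball 0 1" by (intro holomorphic_intros)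
    show "(\<lambda>z. z\<^sup>2) ` ball 0 1 \<subseteq> (ball 0 1 :: complex set)"
      by (auto simp: norm_power power_less_one_iff)
  qed
  then show ?thesis
    by (simp add: o_def log_series_def[abs_def] power_mult)
qed

lemma tau_near_one:
  assumes "cmod z \<le> 1 / 2"
  shows "cmod (tau z - 1) \<le> 2 * (cmod z)\<^sup>2"
  unfolding tau_def log_series_def[symmetric]
  using norm_csqrt_minus_one_le log_series_near_one[OF assms] by (rule order_trans)

lemma tau_holomorphic: "tau holomorphic_on ball 0 (1/2)"
proof -
  have "log_series z \<notin> \<real>\<^sub>\<le>\<^sub>0" if "z \<in> ball 0 (1/2)" for z
  proof -
    have z: "cmod z < 1/2" using that by simp
    have "cmod (log_series z - 1) \<le> 2 * (cmod z)\<^sup>2" using z by (intro log_series_near_one) simp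
    also have "\<dots> < 1"
      using z power_strict_mono[of "cmod z" "1/2" 2] by (simp add: power2_eq_square)
    finally have "\<bar>Re (log_series z - 1)\<bar> < 1" using abs_Re_le_cmod le_less_trans by blast
    then have "0 < Re (log_series z)" by simp
    then show ?thesis by (auto simp: complex_nonpos_Reals_iff)
  qed
  then have "(\<lambda>z. csqrt (log_series z)) holomorphic_on ball 0 (1/2)"
    by (intro holomorphic_on_csqrt' holomorphic_on_subset[OF log_series_holomorphic]) auto
  then show ?thesis by (simp add: tau_def[abs_def] log_series_def)
qed

text \<open>The maps \<open>lam m\<close> are constant multiples of \<open>z \<tau>(z)\<close>, so one radius of injectivity serves every \<open>m\<close>.\<close>

lemma locally_injective_z_tau:
  obtains r where "0 < r" "r \<le> 1/8" "inj_on (\<lambda>z. z * tau z) (ball 0 r)"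
proof -
  have hol: "(\<lambda>z. z * tau z) holomorphic_on ball 0 (1/2)"
    by (intro holomorphic_intros tau_holomorphic)
  have "tau 0 = 1" using tau_near_one[of 0] by simp
  moreover have "(tau has_field_derivative deriv tau 0) (at 0)"
    by (rule holomorphic_derivI[OF tau_holomorphic open_ball]) simp
  ultimately have "((\<lambda>z. z * tau z) has_field_derivative 1) (at 0)"
    by (auto intro!: derivative_eq_intros)
  then have "deriv (\<lambda>z. z * tau z) 0 \<noteq> 0" by (simp add: DERIV_imp_deriv)
  then obtain r where r: "r > 0" "inj_on (\<lambda>z. z * tau z) (ball 0 r)"
    using has_complex_derivative_locally_injective[OF hol, of 0] by auto
  show ?thesis
    by (rule that[of "min r (1/8)"]) (use r in \<open>auto intro: inj_on_subset\<close>)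
qed

lemma admissible_radius_of_inj:
  assumes \<epsilon>: "0 < \<epsilon>" "\<epsilon> \<le> 1/2" and inj: "inj_on (\<lambda>z. z * tau z) (ball 0 \<epsilon>)"
  shows "admissible_radius \<epsilon>"
  unfolding admissible_radius_def
proof (intro conjI allI impI)
  have hol: "tau holomorphic_on ball 0 \<epsilon>"
    using tau_holomorphic \<epsilon> by (rule_tac holomorphic_on_subset) auto
  then show "tau analytic_on ball 0 \<epsilon>" by (simp add: analytic_on_open)
  fix m :: nat assume m: "1 \<le> m"
  define c where "c = of_real (sqrt (2 * real m)) * exp (- (\<i> * of_real pi / 4))"
  have c: "c \<noteq> 0" using m by (simp add: c_def)
  have lam: "lam m = (\<lambda>z. c * (z * tau z))" by (rule ext) (simp add: lam_def c_def mult_ac)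
  show holl: "lam m holomorphic_on ball 0 \<epsilon>" unfolding lam by (intro holomorphic_intros hol)
  show injl: "inj_on (lam m) (ball 0 \<epsilon>)" unfolding lam using inj c by (auto simp: inj_on_def)
  show "lam_inv \<epsilon> m holomorphic_on lam m ` ball 0 \<epsilon>"
  proof (rule holomorphic_has_inverse[OF holl open_ball injl])
    fix g assume g: "g holomorphic_on lam m ` ball 0 \<epsilon>" "\<And>z. z \<in> ball 0 \<epsilon> \<Longrightarrow> g (lam m z) = z"
    show "lam_inv \<epsilon> m holomorphic_on lam m ` ball 0 \<epsilon>"
      by (rule holomorphic_transform[OF g(1)]) (auto simp: lam_inv_def the_inv_into_f_f[OF injl] g(2))
  qed
qed (rule \<epsilon>)

section \<open>The expansion near the origin\<close>

text \<open>The connection formula at \<open>x = exp (\<i>\<pi>/4) \<xi>\<close>, since \<open>-x = exp (-3\<pi>\<i>/4) \<xi>\<close> and \<open>\<i> x = exp (-5\<pi>\<i>/4) \<xi>\<close>.\<close>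

lemma bracket_eq_pcf:
  "exp (of_real pi * \<i> / 4) * parabolic_cylinder_D (- 1/2) (exp (- (3 * of_real pi * \<i> / 4)) * \<xi>)
     - \<i> * of_real (sqrt 2) * parabolic_cylinder_D (- 1/2) (exp (- (5 * of_real pi * \<i> / 4)) * \<xi>)
   = cis (- pi / 4) * pcf (cis (pi / 4) * \<xi>)"
proof -
  have e: "exp (of_real pi * \<i> / 4) = cis (pi / 4)" "exp (- (3 * of_real pi * \<i> / 4)) = cis (- (3 * pi / 4))"
    "exp (- (5 * of_real pi * \<i> / 4)) = cis (- (5 * pi / 4))"
    by (simp_all add: cis_conv_exp mult_ac)
  have c1: "cis (- (3 * pi / 4)) = - cis (pi / 4)"
  proof -
    have "cis (- (3 * pi / 4)) = cis (pi / 4 + - pi)" by (simp add: field_simps)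
    also have "\<dots> = - cis (pi / 4)" unfolding cis_mult[symmetric] by (simp add: complex_eq_iff)
    finally show ?thesis .
  qed
  have c2: "cis (- (5 * pi / 4)) = \<i> * cis (pi / 4)"
  proof -
    have "cis (- (5 * pi / 4)) = cis (pi / 4 + (pi / 2 + - (2 * pi)))" by (simp add: field_simps)
    also have "\<dots> = \<i> * cis (pi / 4)" unfolding cis_mult[symmetric] by (simp add: complex_eq_iff)
    finally show ?thesis .
  qed
  have c3: "cis (- pi / 4) * \<i> = cis (pi / 4)" "cis (- pi / 4) * cis (- pi / 4) = - \<i>"
    by (simp_all add: complex_eq_iff cos_45 sin_45)
  have "cis (- pi / 4) * pcf (cis (pi / 4) * \<xi>)
      = (cis (- pi / 4) * \<i>) * pcf (- (cis (pi / 4) * \<xi>))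
        + of_real (sqrt 2) * (cis (- pi / 4) * cis (- pi / 4)) * pcf (\<i> * (cis (pi / 4) * \<xi>))"
    by (subst pcf_connection) (simp only: distrib_left mult_ac)
  then show ?thesis
    unfolding e c1 c2 c3 parabolic_cylinder_D_eq_pcf by (simp add: mult_ac)
qed

text \<open>The error bound for the Laplace integral asks for a \<open>\<zeta>\<close> with \<open>1 - w = 2 \<zeta> + O(\<zeta>\<^sup>2)\<close>. The choice \<open>\<zeta> = z \<tau>(z)\<close>
qualifies, since \<open>1 - w = 2 z / (1 + z)\<close>, and it makes \<open>N \<zeta>\<close> equal to \<open>\<xi>\<close> up to a rotation.\<close>

lemma z_tau_estimates:
  assumes z: "cmod z \<le> 1 / 8"
  shows "cmod (tau z - 1) \<le> cmod z" "0 < Re (tau z)" "cmod z \<le> 2 * cmod (z * tau z)"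
    "cmod (z * tau z) \<le> 1" "cmod (1 - (1 - z) / (1 + z) - 2 * (z * tau z)) \<le> 20 * (cmod (z * tau z))\<^sup>2"
proof -
  define x where "x = cmod z"
  have x: "0 \<le> x" "x \<le> 1/8" using z by (simp_all add: x_def)
  have t: "cmod (tau z - 1) \<le> 2 * x\<^sup>2" using tau_near_one[of z] z by (simp add: x_def)
  also have "\<dots> = (2 * x) * x" by (simp add: power2_eq_square)
  also have "\<dots> \<le> 1 * x" using x by (intro mult_right_mono) auto
  finally show t1: "cmod (tau z - 1) \<le> cmod z" by (simp add: x_def)
  have "\<bar>Re (tau z - 1)\<bar> \<le> 1/8" using abs_Re_le_cmod t1 x order_trans unfolding x_def by (meson order_trans)
  then show "0 < Re (tau z)" unfolding minus_complex.simps one_complex.simps by linarith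
  have half: "1/2 \<le> cmod (tau z)"
    using norm_triangle_ineq4[of "tau z" "tau z - 1"] t1 x by (simp add: x_def)
  have two: "cmod (tau z) \<le> 2"
    using norm_triangle_ineq[of "tau z - 1" 1] t1 x by (simp add: x_def)
  have "x * (1/2) \<le> x * cmod (tau z)" using half x by (intro mult_left_mono) auto
  then show lo: "cmod z \<le> 2 * cmod (z * tau z)" by (simp add: norm_mult x_def)
  have "x * cmod (tau z) \<le> 1/8 * 2" using two x by (intro mult_mono) auto
  then show "cmod (z * tau z) \<le> 1" by (simp add: norm_mult x_def)
  have lo1: "7/8 \<le> cmod (1 + z)"
    using norm_triangle_ineq4[of "1 + z" z] x by (simp add: x_def)
  then have z1: "1 + z \<noteq> 0" by auto
  have "1 - (1 - z) / (1 + z) - 2 * (z * tau z) = - (2 * z\<^sup>2 / (1 + z)) - 2 * z * (tau z - 1)"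
    using z1 by (simp add: field_simps power2_eq_square)
  also have "cmod \<dots> \<le> cmod (2 * z\<^sup>2 / (1 + z)) + cmod (2 * z * (tau z - 1))"
    using norm_triangle_ineq4[of "- (2 * z\<^sup>2 / (1 + z))" "2 * z * (tau z - 1)"] by (simp only: norm_minus_cancel)
  also have "\<dots> \<le> 3 * x\<^sup>2 + 2 * x\<^sup>2"
  proof (rule add_mono)
    have "cmod (2 * z\<^sup>2 / (1 + z)) = 2 * x\<^sup>2 / cmod (1 + z)" by (simp add: norm_divide norm_mult norm_power x_def)
    also have "\<dots> \<le> 2 * x\<^sup>2 / (7/8)" using lo1 by (intro divide_left_mono) auto
    also have "\<dots> \<le> 3 * x\<^sup>2" by simp
    finally show "cmod (2 * z\<^sup>2 / (1 + z)) \<le> 3 * x\<^sup>2" .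
    have "cmod (2 * z * (tau z - 1)) = 2 * x * cmod (tau z - 1)" by (simp add: norm_mult x_def)
    also have "\<dots> \<le> 2 * x * x" using t1 x by (intro mult_left_mono) (auto simp: x_def)
    finally show "cmod (2 * z * (tau z - 1)) \<le> 2 * x\<^sup>2" by (simp add: power2_eq_square)
  qed
  also have "\<dots> = 5 * x\<^sup>2" by simp
  also have "\<dots> \<le> 5 * (2 * cmod (z * tau z))\<^sup>2"
    using lo x by (intro mult_left_mono power_mono) (auto simp: x_def)
  finally show "cmod (1 - (1 - z) / (1 + z) - 2 * (z * tau z)) \<le> 20 * (cmod (z * tau z))\<^sup>2"
    by (simp add: power_mult_distrib)
qed

text \<open>Since \<open>exp (\<i> \<xi>\<^sup>2 / 4)\<close> is bounded above and below for \<open>|\<xi>| < R\<close>, dividing by the prefactor of the theorem costs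
only a constant. What remains is to replace \<open>2 / ((1 + z)^(1/2) \<tau>^(1/2))\<close> by \<open>1 - (1 - z)^(-1/2) (1 + z)^(-1/2)\<close>, both of
which are \<open>2 + O(z)\<close> because the prescribed branch of \<open>(1 - z)^(1/2)\<close> is near \<open>-1\<close>.\<close>

lemma prefactor_asymptotic:
  fixes R :: real
  assumes R: "0 < R"
  obtains C where "0 < C" "\<And>m z \<xi>. m \<ge> 2 \<Longrightarrow> cmod z \<le> 1/8 \<Longrightarrow> 0 < Im z \<Longrightarrow> \<xi> = lam m z \<Longrightarrow> cmod \<xi> < R \<Longrightarrow>
    \<exists>err. cmod err \<le> C / sqrt (real m) \<and> monic_pi m z =
            ((1 + z) ^ m * sqrt_pos (1 + z)
               * sqrt_pos (\<xi> * exp (- (5 * of_real pi * \<i> / 4))) * exp (\<i> * \<xi>\<^sup>2 / 4))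
            / (2 * sqrt_pos z)
            * ((1 - 1 / (sqrt_one_minus z * sqrt_pos (1 + z)))
                 * (cis (- pi / 4) * pcf (cis (pi / 4) * \<xi>)) + err)"
proof -
  obtain C where C: "0 \<le> C" "\<And>m \<zeta> z. m \<ge> 2 \<Longrightarrow> z \<noteq> - 1 \<Longrightarrow> cmod \<zeta> \<le> 1 \<Longrightarrow> sqrt (2 * real m) * cmod \<zeta> \<le> R \<Longrightarrow>
      cmod (1 - (1 - z) / (1 + z) - 2 * \<zeta>) \<le> 20 * (cmod \<zeta>)\<^sup>2 \<Longrightarrow>
    \<exists>e. cmod e \<le> C / sqrt (real m) \<and> monic_pi m z = (1 + z) ^ m * of_real (sqrt (sqrt (2 * real m)))
      * (quartic_moment 0 (of_real (sqrt (2 * real m)) * \<zeta>) / of_real (sqrt pi) + e)"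
    using monic_pi_asymptotic[of R 20] R by auto
  obtain B where B: "B > 0" "\<And>x. cmod x \<le> R \<Longrightarrow> cmod (quartic_moment 0 x) \<le> B"
    using quartic_moment_bounded[of R] by blast
  define K where "K = exp (R\<^sup>2 / 4) * (36 * R * (B / sqrt pi) + 4 * C)"
  have K: "K > 0" using R B C unfolding K_def by (intro mult_pos_pos add_pos_nonneg) auto
  show ?thesis
  proof (rule that[OF K])
    fix m :: nat and z \<xi> :: complex
    assume m: "m \<ge> 2" and z: "cmod z \<le> 1/8" and Imz: "0 < Im z" and \<xi>: "\<xi> = lam m z" "cmod \<xi> < R"
    define N where "N = sqrt (2 * real m)"
    define r where "r = sqrt N"
    have N: "N > 0" using m by (simp add: N_def)
    then have r: "r > 0" "r\<^sup>2 = N" by (simp_all add: r_def)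
    define \<zeta> where "\<zeta> = z * tau z"
    note est = z_tau_estimates[OF z, folded \<zeta>_def]
    have \<xi>_eq: "\<xi> = of_real N * \<zeta> * cis (- pi / 4)"
      unfolding \<xi>(1) lam_def \<zeta>_def N_def by (simp add: cis_conv_exp mult_ac)
    have norm_\<xi>: "cmod \<xi> = N * cmod \<zeta>" unfolding \<xi>_eq using N by (simp add: norm_mult)
    define x where "x = cis (pi / 4) * \<xi>"
    have x_eq: "x = of_real N * \<zeta>"
      unfolding x_def \<xi>_eq using cis_mult[of "pi / 4" "- pi / 4"] by (simp add: mult_ac)
    have x2: "x\<^sup>2 = \<i> * \<xi>\<^sup>2" unfolding x_def by (simp add: power_mult_distrib cis_power2)
    have z_ne: "z \<noteq> 0" "z \<noteq> - 1" using Imz by auto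
    have "N * cmod \<zeta> \<le> R" using \<xi>(2) norm_\<xi> by simp
    then obtain e where e: "cmod e \<le> C / sqrt (real m)"
      and pi_eq: "monic_pi m z = (1 + z) ^ m * of_real r * (quartic_moment 0 x / of_real (sqrt pi) + e)"
      using C(2)[OF m z_ne(2) est(4) _ est(5)] unfolding x_eq r_def N_def by blast
    define s where "s = csqrt (1 + z)"
    define t where "t = csqrt (tau z)"
    define u where "u = csqrt (1 - z)"
    have dist: "cmod (s - 1) \<le> cmod z" "cmod (t - 1) \<le> cmod z" "cmod (u - 1) \<le> cmod z"
      using norm_csqrt_minus_one_le[of "1 + z"] norm_csqrt_minus_one_le[of "tau z"] norm_csqrt_minus_one_le[of "1 - z"] est(1)
      unfolding s_def t_def u_def by simp_all
    note st = inverse_product_near_one[OF dist(1,2) z] and us = inverse_product_near_one[OF dist(3,1) z]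
    have sq1: "sqrt_pos (1 + z) = s" unfolding s_def using Imz by (intro sqrt_pos_upper_half_plane) simp
    have sq2: "sqrt_one_minus z = - u" unfolding u_def by (rule sqrt_one_minus_eq_csqrt[OF Imz])
    have sq3: "sqrt_pos z = csqrt z" by (rule sqrt_pos_upper_half_plane[OF Imz])
    have sq4: "sqrt_pos (\<xi> * exp (- (5 * of_real pi * \<i> / 4))) = cis (pi / 4) * of_real r * csqrt z * t"
    proof -
      have "exp (- (5 * of_real pi * \<i> / 4)) = cis (- (5 * pi / 4))" by (simp add: cis_conv_exp mult_ac)
      moreover have "cis (- pi / 4) * cis (- (5 * pi / 4)) = \<i>"
      proof -
        have "- pi / 4 + - (5 * pi / 4) = pi / 2 + - (2 * pi)" by simp
        then have "cis (- pi / 4) * cis (- (5 * pi / 4)) = cis (pi / 2) * cis (- (2 * pi))"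
          by (simp only: cis_mult)
        then show ?thesis by (simp add: complex_eq_iff)
      qed
      ultimately have "\<xi> * exp (- (5 * of_real pi * \<i> / 4)) = \<i> * of_real (r\<^sup>2) * z * tau z"
        unfolding \<xi>_eq \<zeta>_def r by (simp add: mult_ac)
      then show ?thesis
        unfolding t_def by (simp only: sqrt_pos_rotated_product[OF Imz est(2) r(1)])
    qed
    define Q where "Q = quartic_moment 0 x / of_real (sqrt pi)"
    define E where "E = exp (- (\<i> * \<xi>\<^sup>2 / 4))"
    define b where "b = 1 - 1 / (sqrt_one_minus z * sqrt_pos (1 + z))"
    have pcf_eq: "pcf x = E * Q" unfolding pcf_def Q_def E_def x2 by simp
    \<comment> \<open>The error is solved for; \<open>2 / (s t)\<close> times \<open>Q + e\<close> is the exact value, \<open>b Q\<close> the main term.\<close>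
    define err where "err = cis (- pi / 4) * E * ((2 / (s * t) - b) * Q + 2 / (s * t) * e)"
    have bound: "cmod err \<le> K / sqrt (real m)"
    proof -
      have sm: "sqrt (real m) > 0" using m by simp
      have zb: "cmod z \<le> 2 * R / sqrt (real m)"
      proof -
        have "sqrt (real m) \<le> N" unfolding N_def by simp
        then have "sqrt (real m) * cmod \<zeta> \<le> R" using \<open>N * cmod \<zeta> \<le> R\<close> mult_right_mono[of "sqrt (real m)" N "cmod \<zeta>"] by simp
        then have "cmod \<zeta> \<le> R / sqrt (real m)" using sm by (simp add: pos_le_divide_eq mult.commute)
        then show ?thesis using est(3) by simp
      qed
      have E: "cmod E \<le> exp (R\<^sup>2 / 4)"
      proof -
        have "Re (- (\<i> * \<xi>\<^sup>2 / 4)) \<le> cmod (- (\<i> * \<xi>\<^sup>2 / 4))" by (rule complex_Re_le_cmod)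
        also have "\<dots> = (cmod \<xi>)\<^sup>2 / 4" by (simp add: norm_mult norm_power norm_divide)
        also have "\<dots> \<le> R\<^sup>2 / 4" using \<xi>(2) by (intro divide_right_mono power_mono) auto
        finally show ?thesis unfolding E_def norm_exp_eq_Re by simp
      qed
      have Q: "cmod Q \<le> B / sqrt pi"
      proof -
        have "cmod x \<le> R" unfolding x_def using \<xi>(2) by (simp add: norm_mult)
        then show ?thesis unfolding Q_def norm_divide by (simp add: B(2) divide_right_mono)
      qed
      have "b = 1 + 1 / (u * s)" unfolding b_def sq1 sq2 by simp
      then have "2 / (s * t) - b = 2 * (1 / (s * t) - 1) - (1 / (u * s) - 1)" by simp
      then have "cmod (2 / (s * t) - b) \<le> cmod (2 * (1 / (s * t) - 1)) + cmod (1 / (u * s) - 1)"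
        by (simp only: norm_triangle_ineq4)
      also have "\<dots> = 2 * cmod (1 / (s * t) - 1) + cmod (1 / (u * s) - 1)"
        by (simp only: norm_mult norm_numeral)
      also have "\<dots> \<le> 18 * cmod z" using st(2) us(2) by linarith
      also have "\<dots> \<le> 36 * R / sqrt (real m)" using zb by simp
      finally have d: "cmod (2 / (s * t) - b) \<le> 36 * R / sqrt (real m)" .
      have two: "cmod (2 / (s * t)) \<le> 4"
      proof -
        have "2 / (s * t) = 2 * (1 / (s * t))" by simp
        then have "cmod (2 / (s * t)) = 2 * cmod (1 / (s * t))" by (simp only: norm_mult norm_numeral)
        then show ?thesis using st(3) by linarith
      qed
      have "cmod ((2 / (s * t) - b) * Q + 2 / (s * t) * e) \<le> cmod (2 / (s * t) - b) * cmod Q + cmod (2 / (s * t)) * cmod e"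
        by (intro order_trans[OF norm_triangle_ineq]) (simp only: norm_mult order_refl)
      also have "\<dots> \<le> 36 * R / sqrt (real m) * (B / sqrt pi) + 4 * (C / sqrt (real m))"
        using d Q two e R B sm by (intro add_mono mult_mono) auto
      also have "\<dots> = (36 * R * (B / sqrt pi) + 4 * C) / sqrt (real m)"
        by (simp add: add_divide_distrib)
      finally have "cmod E * cmod ((2 / (s * t) - b) * Q + 2 / (s * t) * e)
          \<le> exp (R\<^sup>2 / 4) * ((36 * R * (B / sqrt pi) + 4 * C) / sqrt (real m))"
        using E by (intro mult_mono) auto
      then show ?thesis unfolding err_def K_def norm_mult[of "_ * _"] norm_mult[of "cis _"] by simp
    qed
    have csz: "csqrt z \<noteq> 0" using z_ne by simp
    have err_eq: "b * (cis (- pi / 4) * pcf x) + err = cis (- pi / 4) * E * (2 / (s * t)) * (Q + e)"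
      unfolding pcf_eq err_def by (simp add: algebra_simps add_divide_distrib)
    have one: "cis (pi / 4) * cis (- pi / 4) = 1" "exp (\<i> * \<xi>\<^sup>2 / 4) * E = 1" "(s * t) / (s * t) = 1"
      using st(1) unfolding E_def by (simp_all add: cis_mult exp_minus_inverse)
    have "((1 + z) ^ m * s * (cis (pi / 4) * of_real r * csqrt z * t) * exp (\<i> * \<xi>\<^sup>2 / 4))
            / (2 * csqrt z) * (cis (- pi / 4) * E * (2 / (s * t)) * (Q + e))
        = (1 + z) ^ m * of_real r * (Q + e) * (cis (pi / 4) * cis (- pi / 4)) * (exp (\<i> * \<xi>\<^sup>2 / 4) * E) * ((s * t) / (s * t))"
      using csz by simp
    then have "monic_pi m z = ((1 + z) ^ m * sqrt_pos (1 + z) * sqrt_pos (\<xi> * exp (- (5 * of_real pi * \<i> / 4))) * exp (\<i> * \<xi>\<^sup>2 / 4))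
            / (2 * sqrt_pos z) * (b * (cis (- pi / 4) * pcf x) + err)"
      unfolding sq1 sq3 sq4 err_eq one pi_eq Q_def by (simp only: mult_1_right)
    with bound show "\<exists>err. cmod err \<le> K / sqrt (real m) \<and> monic_pi m z =
            ((1 + z) ^ m * sqrt_pos (1 + z)
               * sqrt_pos (\<xi> * exp (- (5 * of_real pi * \<i> / 4))) * exp (\<i> * \<xi>\<^sup>2 / 4))
            / (2 * sqrt_pos z)
            * ((1 - 1 / (sqrt_one_minus z * sqrt_pos (1 + z)))
                 * (cis (- pi / 4) * pcf (cis (pi / 4) * \<xi>)) + err)"
      unfolding b_def x_def by blast
  qed
qed

theorem theorem1p4:
  shows "\<exists>\<epsilon>0>0. \<forall>\<epsilon>::real. 0 < \<epsilon> \<and> \<epsilon> < \<epsilon>0 \<longrightarrow>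
    admissible_radius \<epsilon> \<and>
    (\<forall>g. admissible_arc \<epsilon> g \<longrightarrow>
      (\<forall>R>0. \<exists>C::real>0. \<exists>M::nat>0. \<forall>m\<ge>M. \<forall>\<xi> z::complex.
        \<xi> \<in> lam m ` ball 0 \<epsilon> \<and> cmod \<xi> < R \<and> z = lam_inv \<epsilon> m \<xi> \<and>
        z \<in> Omega_minus \<epsilon> g \<inter> ball 0 \<epsilon> \<inter> upper_half_plane \<longrightarrow>
        (\<exists>err::complex. cmod err \<le> C / sqrt (real m) \<and>
          monic_pi m z =
            ((1 + z) ^ m * sqrt_pos (1 + z)
               * sqrt_pos (\<xi> * exp (- (5 * of_real pi * \<i> / 4))) * exp (\<i> * \<xi>\<^sup>2 / 4))
            / (2 * sqrt_pos z)
            * ((1 - 1 / (sqrt_one_minus z * sqrt_pos (1 + z)))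
                 * (exp (of_real pi * \<i> / 4)
                      * parabolic_cylinder_D (- 1/2) (exp (- (3 * of_real pi * \<i> / 4)) * \<xi>)
                    - \<i> * of_real (sqrt 2)
                      * parabolic_cylinder_D (- 1/2) (exp (- (5 * of_real pi * \<i> / 4)) * \<xi>))
               + err))))"
proof -
  obtain r where r: "0 < r" "r \<le> 1/8" "inj_on (\<lambda>z. z * tau z) (ball 0 r)"
    by (rule locally_injective_z_tau)
  show ?thesis
  proof (rule exI[of _ r], intro conjI allI impI)
    show "0 < r" by (rule r)
    fix \<epsilon> assume \<epsilon>: "0 < \<epsilon> \<and> \<epsilon> < r"
    then have "inj_on (\<lambda>z. z * tau z) (ball 0 \<epsilon>)" by (intro inj_on_subset[OF r(3)]) auto
    then show adm: "admissible_radius \<epsilon>" using \<epsilon> r by (intro admissible_radius_of_inj) auto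
    fix g and R :: real assume "0 < R"
    then obtain C where C: "0 < C" "\<And>m z \<xi>. m \<ge> 2 \<Longrightarrow> cmod z \<le> 1/8 \<Longrightarrow> 0 < Im z \<Longrightarrow> \<xi> = lam m z \<Longrightarrow> cmod \<xi> < R \<Longrightarrow>
      \<exists>err. cmod err \<le> C / sqrt (real m) \<and> monic_pi m z =
            ((1 + z) ^ m * sqrt_pos (1 + z)
               * sqrt_pos (\<xi> * exp (- (5 * of_real pi * \<i> / 4))) * exp (\<i> * \<xi>\<^sup>2 / 4))
            / (2 * sqrt_pos z)
            * ((1 - 1 / (sqrt_one_minus z * sqrt_pos (1 + z)))
                 * (cis (- pi / 4) * pcf (cis (pi / 4) * \<xi>)) + err)"
      using prefactor_asymptotic by blast
    show "\<exists>C>0. \<exists>M::nat>0. \<forall>m\<ge>M. \<forall>\<xi> z::complex.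
        \<xi> \<in> lam m ` ball 0 \<epsilon> \<and> cmod \<xi> < R \<and> z = lam_inv \<epsilon> m \<xi> \<and>
        z \<in> Omega_minus \<epsilon> g \<inter> ball 0 \<epsilon> \<inter> upper_half_plane \<longrightarrow>
        (\<exists>err::complex. cmod err \<le> C / sqrt (real m) \<and>
          monic_pi m z =
            ((1 + z) ^ m * sqrt_pos (1 + z)
               * sqrt_pos (\<xi> * exp (- (5 * of_real pi * \<i> / 4))) * exp (\<i> * \<xi>\<^sup>2 / 4))
            / (2 * sqrt_pos z)
            * ((1 - 1 / (sqrt_one_minus z * sqrt_pos (1 + z)))
                 * (exp (of_real pi * \<i> / 4)
                      * parabolic_cylinder_D (- 1/2) (exp (- (3 * of_real pi * \<i> / 4)) * \<xi>)
                    - \<i> * of_real (sqrt 2)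
                      * parabolic_cylinder_D (- 1/2) (exp (- (5 * of_real pi * \<i> / 4)) * \<xi>))
               + err))"
    proof (rule exI[of _ C], rule conjI[OF C(1)], rule exI[of _ 2], rule conjI, simp, intro allI impI, elim conjE)
      fix m :: nat and \<xi> z :: complex
      assume m: "2 \<le> m" and \<xi>: "\<xi> \<in> lam m ` ball 0 \<epsilon>" "cmod \<xi> < R" and z: "z = lam_inv \<epsilon> m \<xi>"
        and zin: "z \<in> Omega_minus \<epsilon> g \<inter> ball 0 \<epsilon> \<inter> upper_half_plane"
      have "inj_on (lam m) (ball 0 \<epsilon>)" using adm m unfolding admissible_radius_def by auto
      then have lamz: "\<xi> = lam m z" unfolding z lam_inv_def using f_the_inv_into_f \<xi>(1) by metis
      have zb: "cmod z \<le> 1/8" and Imz: "0 < Im z" using zin \<epsilon> r by (auto simp: upper_half_plane_def)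
      show "\<exists>err::complex. cmod err \<le> C / sqrt (real m) \<and>
          monic_pi m z =
            ((1 + z) ^ m * sqrt_pos (1 + z)
               * sqrt_pos (\<xi> * exp (- (5 * of_real pi * \<i> / 4))) * exp (\<i> * \<xi>\<^sup>2 / 4))
            / (2 * sqrt_pos z)
            * ((1 - 1 / (sqrt_one_minus z * sqrt_pos (1 + z)))
                 * (exp (of_real pi * \<i> / 4)
                      * parabolic_cylinder_D (- 1/2) (exp (- (3 * of_real pi * \<i> / 4)) * \<xi>)
                    - \<i> * of_real (sqrt 2)
                      * parabolic_cylinder_D (- 1/2) (exp (- (5 * of_real pi * \<i> / 4)) * \<xi>))
               + err)"
        unfolding bracket_eq_pcf by (rule C(2)[OF m zb Imz lamz \<xi>(2)])
    qed
  qed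
qed

end
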